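(* Let $Q$ be a quiver of type $A_n$ (vertices $1,\dots,n$, one arrow between $i$ and $i+1$ for each $1\le i\le n-1$, arbitrary orientation), and let $\mathbf D=k\tilde Q/\mathcal I$ be as in the context. For every non-zero vector $\mathbf d\in\mathbb N^n$ there exists an exceptional $\Delta$-filtered $\mathbf D$-module $M(\mathbf d)$ with $\Delta$-dimension vector $\mathbf d$, and it is unique up to isomorphism: any two exceptional $\Delta$-filtered $\mathbf D$-modules with $\Delta$-dimension vector $\mathbf d$ are isomorphic.
   Context: Let $k$ be an algebraically closed field of characteristic zero. For a quiver $Q=(Q_0,Q_1,s,t)$ without oriented cycles, its double $\tilde Q$ has vertex set $Q_0$ and arrow set $Q_1\cup\{\alpha^*:\alpha\in Q_1\}$ with $\alpha^*:t(\alpha)\to s(\alpha)$. Paths are composed from right to left ($\rho\gamma$ means first $\gamma$, then $\rho$). Let $\mathcal I\subseteq k\tilde Q$ be the ideal generated by (1) $\alpha^*\alpha-\sum_{\gamma\in Q_1,\ t(\gamma)=s(\alpha)}\gamma\gamma^*$ for every $\alpha\in Q_1$, and (2) $\beta^*\alpha$ for all $\alpha\neq\beta\in Q_1$ with $t(\alpha)=t(\beta)$. Put $\mathbf D=k\tilde Q/\mathcal I$; modules are finite-dimensional left modules, identified with representations of $(\tilde Q,\mathcal I)$. The path algebra $kQ$ is a subalgebra of $\mathbf D$, and sending each $\alpha^*$ to $0$ gives a surjection $\mathbf D\to kQ$; modules are transported along these maps. For $i\in Q_0$, $\Delta(i)$ denotes the indecomposable projective $kQ$-module with simple top $L(i)$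 (a basis is given by the paths of $Q$ starting at $i$), regarded as a $\mathbf D$-module. A $\mathbf D$-module $M$ is $\Delta$-filtered if it has a chain of submodules $M=M(1)\supset M(2)\supset\cdots\supset M(r)=0$ with each $M(l)/M(l+1)$ isomorphic to some $\Delta(j)$; equivalently, the restriction of $M$ to $kQ$ is a projective $kQ$-module; equivalently, every $M_\alpha$ ($\alpha\in Q_1$) is injective and $\mathrm{Im}(M_\alpha)\cap\sum_{\beta\in Q_1\setminus\{\alpha\},\,t(\beta)=t(\alpha)}\mathrm{Im}(M_\beta)=0$. The $\Delta$-dimension vector $\underline{\dim}_\Delta(M)\in\mathbb N^{Q_0}$ has $i$-th entry the multiplicity of $\Delta(i)$ in such a filtration (equivalently, in the decomposition of $M$ as a projective $kQ$-module). A $\mathbf D$-module $M$ is exceptional if $\mathrm{Ext}^1_{\mathbf D}(M,M)=0$. *)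

theory Defs
  imports "Jordan_Normal_Form.Matrix" "HOL-Computational_Algebra.Polynomial"
begin

record ('v, 'a) quiver =
  verts :: "'v set"
  arrs  :: "'a set"
  src   :: "'a \<Rightarrow> 'v"
  tgt   :: "'a \<Rightarrow> 'v"

definition quiverA :: "nat \<Rightarrow> (nat \<Rightarrow> bool) \<Rightarrow> (nat, nat) quiver" where
  "quiverA n orient =
     \<lparr> verts = {1..n}, arrs = {1..<n},
       src = (\<lambda>i. if orient i then i else i + 1),
       tgt = (\<lambda>i. if orient i then i + 1 else i) \<rparr>"

text \<open>A finite-dimensional representation of the double quiver: at vertex v the space k^(dimv v);
  arr a is the matrix of alpha (from src a to tgt a), darr a the matrix of alpha^* (from tgt a to src a).
  Every finite-dimensional module is isomorphic to one of this form.\<close>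
record ('v, 'a, 'k) drep =
  dimv :: "'v \<Rightarrow> nat"
  arr  :: "'a \<Rightarrow> 'k mat"
  darr :: "'a \<Rightarrow> 'k mat"

definition msum :: "nat \<Rightarrow> nat \<Rightarrow> 'b set \<Rightarrow> ('b \<Rightarrow> 'k::comm_monoid_add mat) \<Rightarrow> 'k mat" where
  "msum r c S F = mat r c (\<lambda>(i, j). \<Sum>x\<in>S. F x $$ (i, j))"

definition lincomb :: "nat \<Rightarrow> 'b set \<Rightarrow> ('b \<Rightarrow> 'k::semiring_0) \<Rightarrow> ('b \<Rightarrow> 'k vec) \<Rightarrow> 'k vec" where
  "lincomb n S c f = vec n (\<lambda>i. \<Sum>x\<in>S. c x * (f x $ i))"

text \<open>M is a module over D = k(double Q)/I: correct matrix sizes, and the relations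
  (1) alpha^* alpha = sum over gamma with t(gamma) = s(alpha) of gamma gamma^*,
  (2) beta^* alpha = 0 for alpha /= beta with t(alpha) = t(beta).
  (Composition right to left: the path rho gamma acts as M_rho * M_gamma.)\<close>
definition is_Dmod :: "('v, 'a) quiver \<Rightarrow> ('v, 'a, 'k::field) drep \<Rightarrow> bool" where
  "is_Dmod Q M \<longleftrightarrow>
     (\<forall>a\<in>arrs Q. arr M a \<in> carrier_mat (dimv M (tgt Q a)) (dimv M (src Q a))
              \<and> darr M a \<in> carrier_mat (dimv M (src Q a)) (dimv M (tgt Q a)))
   \<and> (\<forall>a\<in>arrs Q. darr M a * arr M a =
          msum (dimv M (src Q a)) (dimv M (src Q a)) {g\<in>arrs Q. tgt Q g = src Q a}
               (\<lambda>g. arr M g * darr M g))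
   \<and> (\<forall>a\<in>arrs Q. \<forall>b\<in>arrs Q. a \<noteq> b \<and> tgt Q a = tgt Q b \<longrightarrow>
          darr M b * arr M a = 0\<^sub>m (dimv M (src Q b)) (dimv M (src Q a)))"

definition is_hom :: "('v, 'a) quiver \<Rightarrow> ('v, 'a, 'k::field) drep \<Rightarrow> ('v, 'a, 'k) drep
                       \<Rightarrow> ('v \<Rightarrow> 'k mat) \<Rightarrow> bool" where
  "is_hom Q M N f \<longleftrightarrow>
     (\<forall>v\<in>verts Q. f v \<in> carrier_mat (dimv N v) (dimv M v))
   \<and> (\<forall>a\<in>arrs Q. f (tgt Q a) * arr M a = arr N a * f (src Q a)
              \<and> f (src Q a) * darr M a = darr N a * f (tgt Q a))"

definition iso_Dmod :: "('v, 'a) quiver \<Rightarrow> ('v, 'a, 'k::field) drep \<Rightarrow> ('v, 'a, 'k) drep \<Rightarrow> bool" where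
  "iso_Dmod Q M N \<longleftrightarrow>
     (\<exists>f g. is_hom Q M N f \<and> is_hom Q N M g \<and>
        (\<forall>v\<in>verts Q. g v * f v = 1\<^sub>m (dimv M v) \<and> f v * g v = 1\<^sub>m (dimv N v)))"

definition short_exact :: "('v, 'a) quiver \<Rightarrow> ('v, 'a, 'k::field) drep \<Rightarrow> ('v, 'a, 'k) drep
    \<Rightarrow> ('v, 'a, 'k) drep \<Rightarrow> ('v \<Rightarrow> 'k mat) \<Rightarrow> ('v \<Rightarrow> 'k mat) \<Rightarrow> bool" where
  "short_exact Q M E N f g \<longleftrightarrow>
     is_hom Q M E f \<and> is_hom Q E N g \<and>
     (\<forall>v\<in>verts Q.
        (\<forall>x\<in>carrier_vec (dimv M v). f v *\<^sub>v x = 0\<^sub>v (dimv E v) \<longrightarrow> x = 0\<^sub>v (dimv M v))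
      \<and> (\<forall>y\<in>carrier_vec (dimv N v). \<exists>x\<in>carrier_vec (dimv E v). g v *\<^sub>v x = y)
      \<and> (\<forall>y\<in>carrier_vec (dimv E v).
            g v *\<^sub>v y = 0\<^sub>v (dimv N v) \<longleftrightarrow> (\<exists>x\<in>carrier_vec (dimv M v). y = f v *\<^sub>v x)))"

text \<open>Ext^1_D(M,M) = 0 (Yoneda description): every short exact sequence 0 -> M -> E -> M -> 0
  of D-modules splits.\<close>
definition exceptional :: "('v, 'a) quiver \<Rightarrow> ('v, 'a, 'k::field) drep \<Rightarrow> bool" where
  "exceptional Q M \<longleftrightarrow>
     (\<forall>E f g. is_Dmod Q E \<and> short_exact Q M E M f g \<longrightarrow>
        (\<exists>h. is_hom Q M E h \<and> (\<forall>v\<in>verts Q. g v * h v = 1\<^sub>m (dimv M v))))"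

fun is_path :: "('v, 'a) quiver \<Rightarrow> 'v \<Rightarrow> 'a list \<Rightarrow> 'v \<Rightarrow> bool" where
  "is_path Q j [] v \<longleftrightarrow> j = v"
| "is_path Q j (a # as) v \<longleftrightarrow> a \<in> arrs Q \<and> src Q a = j \<and> is_path Q (tgt Q a) as v"

fun path_act :: "('v, 'a, 'k::field) drep \<Rightarrow> 'a list \<Rightarrow> 'k vec \<Rightarrow> 'k vec" where
  "path_act M [] x = x"
| "path_act M (a # as) x = path_act M as (arr M a *\<^sub>v x)"

text \<open>delta_dim Q M d: the restriction of M to kQ is isomorphic to the direct sum over j of
  Delta(j)^(d j), where Delta(j) has basis the paths of Q starting at j. Unfolded: there are
  generators x_(j,l) in M_j (l < d j) such that, for every vertex v, the vectors p.x_(j,l), with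
  p ranging over the paths from j to v, form a basis of M_v (they are the images of the
  path basis of the direct sum under the isomorphism).\<close>
definition delta_dim :: "('v, 'a) quiver \<Rightarrow> ('v, 'a, 'k::field) drep \<Rightarrow> ('v \<Rightarrow> nat) \<Rightarrow> bool" where
  "delta_dim Q M d \<longleftrightarrow>
     (\<exists>x :: 'v \<Rightarrow> nat \<Rightarrow> 'k vec.
        (\<forall>j\<in>verts Q. \<forall>l<d j. x j l \<in> carrier_vec (dimv M j)) \<and>
        (\<forall>v\<in>verts Q.
           let S = {(j, l, p). j \<in> verts Q \<and> l < d j \<and> is_path Q j p v};
               b = (\<lambda>(j, l, p). path_act M p (x j l))
           in finite S
            \<and> (\<forall>c. lincomb (dimv M v) S c b = 0\<^sub>v (dimv M v) \<longrightarrow> (\<forall>z\<in>S. c z = 0))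
            \<and> (\<forall>w\<in>carrier_vec (dimv M v). \<exists>c. lincomb (dimv M v) S c b = w)))"

text \<open>Delta-filtered = restriction to kQ is projective = a direct sum of the Delta(j).\<close>
definition delta_filtered :: "('v, 'a) quiver \<Rightarrow> ('v, 'a, 'k::field) drep \<Rightarrow> bool" where
  "delta_filtered Q M \<longleftrightarrow> (\<exists>d. delta_dim Q M d)"

definition alg_closed :: "'k::field itself \<Rightarrow> bool" where
  "alg_closed _ \<longleftrightarrow> (\<forall>p :: 'k poly. degree p > 0 \<longrightarrow> (\<exists>z. poly p z = 0))"

end

theory Submission
  imports Defs "Jordan_Normal_Form.Determinant" "HOL-Library.Function_Algebras"
begin

text \<open>Once the matrices of the arrows \<open>\<alpha>\<close> are fixed, the relations are linear in the starred arrows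
  \<open>\<alpha>\<^sup>*\<close>, so the modules with a given restriction to \<open>kQ\<close> form a vector space. For a module \<open>M\<close> with
  projective restriction, \<open>Ext(M, M) = 0\<close> means that every vector \<open>\<delta>\<close> of this space is inner:
  \<open>\<delta> = [f, M\<^sup>*]\<close> for some \<open>kQ\<close>-endomorphism \<open>f\<close>.

  Uniqueness: on the line joining two exceptional modules, Cramer's rule yields a family of morphisms from
  either end point, polynomial in the parameter and equal to the identity at that end point, hence
  invertible for all but finitely many parameters. So some member of the line is isomorphic to both ends.

  Existence: the \<open>kQ\<close>-endomorphisms of \<open>\<Oplus> \<Delta>(i)\<close> with \<open>d i\<close> summands \<open>\<Delta>(i)\<close> form an algebra \<open>A\<close> of block
  matrices with radical \<open>R\<close>, and one needs \<open>x \<in> R\<close> with \<open>[A, x] = R\<close> (a Richardson element of a seaweed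
  algebra). It is built by adding the vertices one by one, keeping track of a basis of a cokernel of \<open>x\<close> on
  which the centraliser of \<open>x\<close> realises all triangular matrix units; where the orientation turns, one
  passes to transposes.\<close>

section \<open>Richardson elements of block algebras of type A\<close>

text \<open>Why a single algebra carries the whole problem: on a projective \<open>kQ\<close>-module
  P, starred arrows that satisfy the relations assemble at each vertex v into one operator, the sum
  of \<open>\<gamma> \<gamma>\<^sup>*\<close> over the arrows \<gamma> into v. The relations make
  these operators commute with the arrows, so they form an endomorphism of P with image in the
  radical. Conversely each starred arrow can be recovered from it, because the images of the arrows
  into v are independent. Module structures and derivations are therefore both elements of R, and
  the inner derivations are the commutators with x. The obstacle: [A, x] = R by itself does not
  survive the addition of a vertex. A new column with its entry at a basis vector outside the image
  of the enlarged x has to be produced by an element commuting with the old x, so the induction must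
  control the centraliser. Full matrix units cannot be kept: a generator killed by x cannot be moved
  to one that is not killed by an element commuting with x. This is the origin of the triangular
  order.\<close>

definition reach :: "(nat \<Rightarrow> bool) \<Rightarrow> nat \<Rightarrow> nat \<Rightarrow> bool" where
  "reach orient i j \<longleftrightarrow> (\<forall>k. i \<le> k \<and> k < j \<longrightarrow> orient k) \<and> (\<forall>k. j \<le> k \<and> k < i \<longrightarrow> \<not> orient k)"

lemma reach_refl [simp]: "reach orient i i"
  by (auto simp: reach_def)

lemma reach_opposite: "reach (\<lambda>k. \<not> orient k) i j \<longleftrightarrow> reach orient j i"
  by (auto simp: reach_def)

lemma reach_trans:
  assumes "reach orient i j" "reach orient j k" shows "reach orient i k"
  unfolding reach_def
proof (intro conjI allI impI)
  fix m assume "i \<le> m \<and> m < k"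
  then show "orient m" using assms by (cases "m < j") (auto simp: reach_def)
next
  fix m assume "k \<le> m \<and> m < i"
  then show "\<not> orient m" using assms by (cases "m < j") (auto simp: reach_def)
qed

lemma reach_antisym:
  assumes "reach orient i j" "reach orient j i" shows "i = j"
  using assms unfolding reach_def by (metis linorder_neqE_nat order_refl)

lemma reach_Suc: "orient n \<Longrightarrow> j \<le> n \<Longrightarrow> reach orient j (Suc n) \<longleftrightarrow> reach orient j n"
  by (auto simp: reach_def less_Suc_eq)

lemma not_reach_from_Suc: "orient n \<Longrightarrow> j \<le> n \<Longrightarrow> \<not> reach orient (Suc n) j"
  by (auto simp: reach_def)

section \<open>Block matrices whose zero pattern is given by paths\<close>

type_synonym 'k imat = "nat \<times> nat \<Rightarrow> nat \<times> nat \<Rightarrow> 'k"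

text \<open>The index set is an argument because all products are taken over the final set of
  blocks, while the factors live on the blocks added so far. Enlarging the support then leaves the
  multiplication unchanged.\<close>

definition kmul :: "(nat \<times> nat) set \<Rightarrow> 'k::field imat \<Rightarrow> 'k imat \<Rightarrow> 'k imat" where
  "kmul B a b = (\<lambda>p q. \<Sum>u\<in>B. a p u * b u q)"

definition munit :: "nat \<times> nat \<Rightarrow> nat \<times> nat \<Rightarrow> 'k::field imat" where
  "munit p q = (\<lambda>u v. if u = p \<and> v = q then 1 else 0)"

definition imat_transp :: "'k imat \<Rightarrow> 'k imat" where
  "imat_transp a = (\<lambda>p q. a q p)"

definition blocks :: "(nat \<Rightarrow> nat) \<Rightarrow> nat \<Rightarrow> (nat \<times> nat) set" where
  "blocks d n = {(i, l). 1 \<le> i \<and> i \<le> n \<and> l < d i}"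

text \<open>For \<open>reach orient\<close> this describes the algebra A: column q holds the image
  of the generator q, and a generator at j can only go to combinations of elements obtained by
  transporting generators at vertices i along paths from i to j.\<close>

definition supported :: "(nat \<times> nat) set \<Rightarrow> (nat \<Rightarrow> nat \<Rightarrow> bool) \<Rightarrow> 'k::field imat \<Rightarrow> bool" where
  "supported B rel a \<longleftrightarrow> (\<forall>p q. a p q \<noteq> 0 \<longrightarrow> p \<in> B \<and> q \<in> B \<and> rel (fst p) (fst q))"

abbreviation sreach :: "(nat \<Rightarrow> bool) \<Rightarrow> nat \<Rightarrow> nat \<Rightarrow> bool" where
  "sreach orient i j \<equiv> i \<noteq> j \<and> reach orient i j"

lemma finite_blocks [simp]: "finite (blocks d n)"
proof -
  have "blocks d n \<subseteq> (SIGMA i:{1..n}. {..<d i})" by (auto simp: blocks_def)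
  then show ?thesis by (rule finite_subset) auto
qed

lemma blocks_Suc: "blocks d (Suc n) = blocks d n \<union> {(i, l). i = Suc n \<and> l < d i}"
  by (auto simp: blocks_def le_Suc_eq)

lemma blocks_mono: "n \<le> m \<Longrightarrow> blocks d n \<subseteq> blocks d m"
  by (auto simp: blocks_def)

lemma kmul_add_left: "kmul B (a + b) c = kmul B a c + kmul B b c"
  by (simp add: kmul_def fun_eq_iff distrib_right sum.distrib)

lemma kmul_add_right: "kmul B c (a + b) = kmul B c a + kmul B c b"
  by (simp add: kmul_def fun_eq_iff distrib_left sum.distrib)

lemma kmul_zero [simp]: "kmul B 0 c = 0" "kmul B c 0 = 0"
  by (simp_all add: kmul_def fun_eq_iff)

lemma kmul_sum_left: "kmul B (\<Sum>i\<in>I. f i) c = (\<Sum>i\<in>I. kmul B (f i) c)"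
  by (induction I rule: infinite_finite_induct) (simp_all only: sum.infinite sum.empty sum.insert kmul_zero kmul_add_left not_False_eq_True)

lemma kmul_sum_right: "kmul B c (\<Sum>i\<in>I. f i) = (\<Sum>i\<in>I. kmul B c (f i))"
  by (induction I rule: infinite_finite_induct) (simp_all only: sum.infinite sum.empty sum.insert kmul_zero kmul_add_right not_False_eq_True)

lemma kmul_assoc: "kmul B (kmul B a b) c = kmul B a (kmul B b c)"
proof (intro ext)
  fix p q
  have "kmul B (kmul B a b) c p q = (\<Sum>u\<in>B. \<Sum>v\<in>B. a p v * b v u * c u q)"
    by (simp add: kmul_def sum_distrib_right)
  also have "\<dots> = (\<Sum>v\<in>B. \<Sum>u\<in>B. a p v * b v u * c u q)" by (rule sum.swap)
  also have "\<dots> = kmul B a (kmul B b c) p q"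
    by (simp add: kmul_def sum_distrib_left mult.assoc)
  finally show "kmul B (kmul B a b) c p q = kmul B a (kmul B b c) p q" .
qed

lemma kmul_transp: "kmul B (imat_transp a) (imat_transp b) = imat_transp (kmul B b a)"
  unfolding kmul_def imat_transp_def by (intro ext sum.cong refl mult.commute)

lemma kmul_munit_left:
  "finite B \<Longrightarrow> q \<in> B \<Longrightarrow> kmul B (munit p q) b = (\<lambda>u v. if u = p then b q v else 0)"
  by (auto simp: kmul_def munit_def fun_eq_iff if_distrib[of "\<lambda>z. z * _"] sum.delta cong: if_cong)

lemma kmul_munit_right:
  "finite B \<Longrightarrow> p \<in> B \<Longrightarrow> kmul B a (munit p q) = (\<lambda>u v. if v = q then a u p else 0)"
  by (auto simp: kmul_def munit_def fun_eq_iff if_distrib[of "\<lambda>z. _ * z"] sum.delta cong: if_cong)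

lemma supported_add: "supported B rel a \<Longrightarrow> supported B rel b \<Longrightarrow> supported B rel (a + b)"
  unfolding supported_def by (metis add.right_neutral plus_fun_apply)

lemma supported_diff: "supported B rel a \<Longrightarrow> supported B rel b \<Longrightarrow> supported B rel (a - b)"
  unfolding supported_def by (metis diff_0_right minus_apply)

lemma supported_sum: "(\<And>i. i \<in> I \<Longrightarrow> supported B rel (f i)) \<Longrightarrow> supported B rel (\<Sum>i\<in>I. f i)"
  by (induction I rule: infinite_finite_induct) (auto intro: supported_add, auto simp: supported_def)

lemma supported_scale: "supported B rel a \<Longrightarrow> supported B rel (\<lambda>p q. c * a p q)"
  unfolding supported_def by auto

lemma supported_mono:
  assumes "supported B rel a" "B \<subseteq> B'" "\<And>i j. rel i j \<Longrightarrow> rel' i j"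
  shows "supported B' rel' a"
  using assms unfolding supported_def by blast

lemma supported_munit: "p \<in> B \<Longrightarrow> q \<in> B \<Longrightarrow> rel (fst p) (fst q) \<Longrightarrow> supported B rel (munit p q)"
  by (auto simp: supported_def munit_def)

lemma supported_transp: "supported B rel (imat_transp a) \<longleftrightarrow> supported B (\<lambda>i j. rel j i) a"
  by (auto simp: supported_def imat_transp_def)

lemma supported_kmul:
  assumes "supported B rel a" "supported B rel' b" "\<And>i j k. rel i j \<Longrightarrow> rel' j k \<Longrightarrow> rel'' i k"
  shows "supported B rel'' (kmul B' a b)"
  unfolding supported_def
proof (intro allI impI)
  fix p q assume "kmul B' a b p q \<noteq> 0"
  then obtain u where "a p u * b u q \<noteq> 0" unfolding kmul_def by (meson sum.not_neutral_contains_not_neutral)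
  then have "a p u \<noteq> 0" "b u q \<noteq> 0" by auto
  then show "p \<in> B \<and> q \<in> B \<and> rel'' (fst p) (fst q)" using assms unfolding supported_def by blast
qed

lemma imat_eq_sum_munit:
  assumes "supported B rel r" "finite B"
  shows "r = (\<Sum>(p, q)\<in>{(p, q). p \<in> B \<and> q \<in> B \<and> rel (fst p) (fst q)}. (\<lambda>u v. r p q * munit p q u v))"
    (is "_ = (\<Sum>z\<in>?S. ?f z)")
proof (intro ext)
  fix u v
  have fin: "finite ?S" by (rule finite_subset[of _ "B \<times> B"]) (use assms in auto)
  have sum_app: "(\<Sum>z\<in>S. g z) u v = (\<Sum>z\<in>S. g z u v)" for S :: "'s set" and g :: "'s \<Rightarrow> 'a imat"
    by (induction S rule: infinite_finite_induct) auto
  have "(\<Sum>z\<in>?S. ?f z) u v = (\<Sum>z\<in>?S. if z = (u, v) then r u v else 0)"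
    unfolding sum_app by (rule sum.cong) (auto simp: munit_def split: if_splits)
  also have "\<dots> = (if (u, v) \<in> ?S then r u v else 0)" using fin by simp
  also have "\<dots> = r u v" using assms(1) unfolding supported_def by (cases u; cases v) auto
  finally show "r u v = (\<Sum>z\<in>?S. ?f z) u v" by simp
qed

definition commutator :: "(nat \<times> nat) set \<Rightarrow> 'k::field imat \<Rightarrow> 'k imat \<Rightarrow> 'k imat" where
  "commutator B a x = kmul B a x - kmul B x a"

lemma commutator_add: "commutator B (a + b) x = commutator B a x + commutator B b x"
  by (simp add: commutator_def kmul_add_left kmul_add_right algebra_simps)

lemma commutator_sum: "commutator B (\<Sum>i\<in>I. f i) x = (\<Sum>i\<in>I. commutator B (f i) x)"
  by (simp add: commutator_def kmul_sum_left kmul_sum_right sum_subtractf)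

lemma commutator_scale: "commutator B (\<lambda>p q. c * a p q) x = (\<lambda>p q. c * commutator B a x p q)"
  by (simp add: commutator_def kmul_def fun_eq_iff sum_distrib_left right_diff_distrib mult_ac)

lemma commutator_transp: "commutator B (imat_transp a) (imat_transp x) = imat_transp (- commutator B a x)"
  by (simp add: commutator_def kmul_transp) (simp add: imat_transp_def fun_eq_iff)

text \<open>The infinitesimal form of a dense orbit: the commutators of A with x are the tangent
  directions at x of the orbit under the units of A, and they fill R. Products run over B; the
  matrices live on C.\<close>

definition richardson :: "(nat \<times> nat) set \<Rightarrow> (nat \<times> nat) set \<Rightarrow> (nat \<Rightarrow> bool) \<Rightarrow> 'k::field imat \<Rightarrow> bool" where
  "richardson B C orient x \<longleftrightarrow> supported C (sreach orient) x \<and>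
     (\<forall>r. supported C (sreach orient) r \<longrightarrow> (\<exists>a. supported C (reach orient) a \<and> commutator B a x = r))"

text \<open>The commutator is linear in its first argument, so preimages of the matrix units, chosen
  one by one, combine to a preimage of r.\<close>

lemma commutators_onto_span:
  assumes "finite C" and sup: "supported C rel r"
    and E: "\<And>p q. p \<in> C \<Longrightarrow> q \<in> C \<Longrightarrow> rel (fst p) (fst q) \<Longrightarrow> \<exists>a. supported C rel' a \<and> commutator B a x = munit p q"
  shows "\<exists>a. supported C rel' a \<and> commutator B a x = r"
proof -
  let ?S = "{(p, q). p \<in> C \<and> q \<in> C \<and> rel (fst p) (fst q)}"
  define A where "A z = (SOME a. supported C rel' a \<and> commutator B a x = munit (fst z) (snd z))" for z
  have A: "supported C rel' (A z)" "commutator B (A z) x = munit (fst z) (snd z)" if "z \<in> ?S" for z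
  proof -
    have "\<exists>a. supported C rel' a \<and> commutator B a x = munit (fst z) (snd z)"
      by (rule E) (use that in auto)
    from someI_ex[OF this] show "supported C rel' (A z)" "commutator B (A z) x = munit (fst z) (snd z)"
      unfolding A_def by blast+
  qed
  let ?a = "\<Sum>z\<in>?S. (\<lambda>u v. r (fst z) (snd z) * A z u v)"
  have "supported C rel' ?a" by (intro supported_sum supported_scale) (use A in auto)
  moreover have "commutator B ?a x = (\<Sum>z\<in>?S. (\<lambda>u v. r (fst z) (snd z) * munit (fst z) (snd z) u v))"
    unfolding commutator_sum commutator_scale by (rule sum.cong) (use A in auto)
  moreover have "\<dots> = r"
    using imat_eq_sum_munit[OF sup assms(1)] unfolding case_prod_unfold by (rule sym)
  ultimately show ?thesis by (intro exI[of _ ?a] conjI) (simp_all only:)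
qed

text \<open>The index vectors with label \<open>h 0, \<dots>, h (D - 1)\<close> represent a basis of the cokernel of \<open>x\<close> on
  the span of the blocks \<open>i\<close> with a path from \<open>i\<close> to \<open>n\<close>; the centraliser of \<open>x\<close> realises
  every triangular matrix unit on it.\<close>
definition triangular_tops ::
  "(nat \<times> nat) set \<Rightarrow> (nat \<times> nat) set \<Rightarrow> nat \<Rightarrow> (nat \<Rightarrow> bool) \<Rightarrow> 'k::field imat \<Rightarrow> nat \<Rightarrow> (nat \<Rightarrow> nat \<times> nat) \<Rightarrow> bool"
  where
  "triangular_tops B C n orient x D h \<longleftrightarrow>
     inj_on h {..<D} \<and> (\<forall>l<D. h l \<in> C \<and> reach orient (fst (h l)) n) \<and>
     (\<forall>p\<in>C. reach orient (fst p) n \<longrightarrow> p \<in> h ` {..<D} \<or>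
        (\<exists>p'\<in>C. reach orient (fst p') n \<and> (\<forall>u. x u p' = (if u = p then 1 else 0)))) \<and>
     (\<forall>l m. l \<le> m \<and> m < D \<longrightarrow>
        (\<exists>a. supported C (reach orient) a \<and> kmul B a x = kmul B x a \<and>
             (\<forall>l'<D. \<forall>u. a u (h l') = (if l' = l \<and> u = h m then 1 else 0))))"

section \<open>Adding the vertex n + 1 along an arrow from n to n + 1\<close>

locale add_vertex =
  fixes d :: "nat \<Rightarrow> nat" and n N :: nat and orient :: "nat \<Rightarrow> bool" and x :: "'k::field imat"
    and D :: nat and h :: "nat \<Rightarrow> nat \<times> nat"
  assumes nN: "Suc n \<le> N" and orient_n: "orient n"
    and rich: "richardson (blocks d N) (blocks d n) orient x"
    and tops: "triangular_tops (blocks d N) (blocks d n) n orient x D h"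
begin

abbreviation "mul \<equiv> kmul (blocks d N)"
definition "dd = d (Suc n)"
text \<open>The new generators are matched with the old tops in order of their labels: the first
  min(dd, D) of them go to \<open>h 0\<close>, \<open>h 1\<close> and so on, the others to 0. The
  tops with label below \<open>dd\<close> thereby enter the image, and the new generators inherit
  their labels, which gives \<open>h'\<close>.\<close>

definition y :: "'k imat" where
  "y u v = (if fst v = Suc n \<and> snd v < dd \<and> snd v < D \<and> u = h (snd v) then 1 else 0)"
definition h' :: "nat \<Rightarrow> nat \<times> nat" where "h' l = (if l < dd then (Suc n, l) else h l)"
abbreviation "x' \<equiv> x + y"

lemma xs: "supported (blocks d n) (sreach orient) x" using rich by (simp add: richardson_def)

lemma sub: "blocks d n \<subseteq> blocks d N" using nN by (intro blocks_mono) simp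

lemma new_in: "l < dd \<Longrightarrow> (Suc n, l) \<in> blocks d N" "l < dd \<Longrightarrow> (Suc n, l) \<in> blocks d (Suc n)"
  using nN by (auto simp: blocks_def dd_def)

lemma new_notin [simp]: "(Suc n, l) \<notin> blocks d n" by (auto simp: blocks_def)

lemma in_old: "p \<in> blocks d n \<Longrightarrow> p \<in> blocks d N" "p \<in> blocks d n \<Longrightarrow> p \<in> blocks d (Suc n)"
  using sub by (auto simp: blocks_def)

lemma old_reach: "p \<in> blocks d n \<Longrightarrow> reach orient (fst p) (Suc n) \<longleftrightarrow> reach orient (fst p) n"
  by (rule reach_Suc[of orient n, OF orient_n]) (auto simp: blocks_def)

lemma hB: "l < D \<Longrightarrow> h l \<in> blocks d n" "l < D \<Longrightarrow> reach orient (fst (h l)) n"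
  using tops by (auto simp: triangular_tops_def)

lemma hne [simp]: "l < D \<Longrightarrow> h l \<noteq> (Suc n, m)" "l < D \<Longrightarrow> (Suc n, m) \<noteq> h l"
  using hB(1)[of l] new_notin by metis+

lemma hfst [simp]: "l < D \<Longrightarrow> fst (h l) \<noteq> Suc n"
  using hB(1)[of l] by (auto simp: blocks_def)

lemma hinj: "l < D \<Longrightarrow> m < D \<Longrightarrow> h l = h m \<Longrightarrow> l = m"
  using tops by (auto simp: triangular_tops_def inj_on_def)

lemma unitC: assumes "l \<le> m" "m < D"
  obtains a where "supported (blocks d n) (reach orient) a" "mul a x = mul x a"
    "\<And>l' u. l' < D \<Longrightarrow> a u (h l') = (if l' = l \<and> u = h m then 1 else 0)"
  using tops assms unfolding triangular_tops_def by metis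

lemma old_zero: "supported (blocks d n) rel a \<Longrightarrow> a (Suc n, l) v = 0"
  "supported (blocks d n) rel a \<Longrightarrow> a u (Suc n, l) = 0"
  unfolding supported_def by (metis new_notin)+

lemma y_new: "y (Suc n, l) v = 0"
  by (auto simp: y_def)

lemma mul_y: "mul a y = (\<lambda>u v. if fst v = Suc n \<and> snd v < dd \<and> snd v < D then a u (h (snd v)) else 0)"
proof (intro ext)
  fix u v
  show "mul a y u v = (if fst v = Suc n \<and> snd v < dd \<and> snd v < D then a u (h (snd v)) else 0)"
  proof (cases "fst v = Suc n \<and> snd v < dd \<and> snd v < D")
    case True
    then have "mul a y u v = (\<Sum>w\<in>blocks d N. if w = h (snd v) then a u w else 0)"
      unfolding kmul_def y_def by (intro sum.cong) auto
    then show ?thesis using True in_old(1)[OF hB(1)] by simp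
  next
    case False
    then show ?thesis by (auto simp: kmul_def y_def)
  qed
qed

text \<open>The nonzero columns of y belong to the new vertex, where the rows of a matrix on the old
  blocks vanish.\<close>

lemma y_mul: assumes "supported (blocks d n) rel a" shows "mul y a = 0"
proof -
  have "y u w * a w v = 0" for u w v
    using old_zero(1)[OF assms] by (cases w) (auto simp: y_def)
  then show ?thesis unfolding kmul_def by (intro ext) (simp only: sum.neutral_const zero_fun_apply)
qed

lemma unit_x': "l < dd \<Longrightarrow> mul (munit p (Suc n, l)) x' = 0"
  by (simp add: kmul_munit_left new_in fun_eq_iff old_zero[OF xs] y_new)

lemma x'_unit: "p \<in> blocks d N \<Longrightarrow> mul x' (munit p q) = (\<lambda>u v. if v = q then x u p + y u p else 0)"
  by (simp add: kmul_munit_right fun_eq_iff)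

lemma y_supp: "supported (blocks d (Suc n)) (sreach orient) y"
proof -
  have "(Suc n, l) \<in> blocks d (Suc n)" if "l < dd" for l using new_in that by simp
  moreover have "reach orient (fst (h l)) (Suc n)" if "l < D" for l
    using hB[OF that] old_reach by simp
  ultimately show ?thesis
    using in_old(2)[OF hB(1)] unfolding supported_def y_def
    by (metis (no_types, lifting) hfst prod.collapse)
qed

lemma old_supp: "supported (blocks d n) rel a \<Longrightarrow> supported (blocks d (Suc n)) rel a"
  by (rule supported_mono) (auto intro: in_old)

lemma x'_supp: "supported (blocks d (Suc n)) (sreach orient) x'"
  by (intro supported_add y_supp old_supp xs)

lemma new_unit_supp:
  assumes "p \<in> blocks d (Suc n)" "reach orient (fst p) (Suc n)" "l < dd"
  shows "supported (blocks d (Suc n)) (reach orient) (munit p (Suc n, l))"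
  by (rule supported_munit) (use assms new_in in auto)

text \<open>The shared case distinction of the extension lemmas. In the case \<open>im\<close>, p is
  hit by a single basis vector, so a matrix unit at p can be pulled back through x without
  correction terms.\<close>

lemma reach_new_cases:
  assumes "p \<in> blocks d (Suc n)" "reach orient (fst p) (Suc n)"
  obtains (new) l where "l < dd" "p = (Suc n, l)"
  | (top) k where "k < D" "p = h k"
  | (im) p' where "p \<in> blocks d n" "p' \<in> blocks d n" "reach orient (fst p') n" "\<And>u. x u p' = (if u = p then 1 else 0)"
proof -
  consider l where "l < dd" "p = (Suc n, l)" | "p \<in> blocks d n"
    using assms(1) by (auto simp: blocks_Suc dd_def)
  then show ?thesis
  proof cases
    case 1 then show ?thesis using that by blast
  next
    case 2
    then have "reach orient (fst p) n" using assms(2) old_reach by simp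
    then have "p \<in> h ` {..<D} \<or> (\<exists>p'\<in>blocks d n. reach orient (fst p') n \<and> (\<forall>u. x u p' = (if u = p then 1 else 0)))"
      using tops 2 unfolding triangular_tops_def by blast
    then show ?thesis using that 2 by blast
  qed
qed

text \<open>If x' sends the basis vector p' to p, then minus the unit at row p' has the required
  commutator, because x' has no nonzero rows at the new vertex. Only the tops \<open>h k\<close>
  with \<open>dd\<close> \<le> k are not hit. For these m < \<open>dd\<close> \<le> k, and the
  triangular condition supplies an element commuting with x that moves \<open>h m\<close>, the image
  of the new generator m, to \<open>h k\<close>.\<close>

lemma new_column_attained:
  assumes "p \<in> blocks d n" "reach orient (fst p) (Suc n)" "m < dd"
  shows "\<exists>a. supported (blocks d (Suc n)) (reach orient) a \<and> commutator (blocks d N) a x' = munit p (Suc n, m)"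
  using in_old(2)[OF assms(1)] assms(2)
proof (cases rule: reach_new_cases)
  case (new l)
  then show ?thesis using assms(1) by simp
next
  case (im p')
  let ?a = "\<lambda>u v. (-1) * munit p' (Suc n, m) u v :: 'k"
  have "supported (blocks d (Suc n)) (reach orient) ?a"
    by (intro supported_scale new_unit_supp) (use im assms in_old old_reach in auto)
  moreover have "y u p' = 0" for u using im(2) by (auto simp: y_def blocks_def)
  then have "commutator (blocks d N) (munit p' (Suc n, m)) x' = - munit p (Suc n, m)"
    unfolding commutator_def unit_x'[OF assms(3)] x'_unit[OF in_old(1)[OF im(2)]] im(4)
    by (auto simp: fun_eq_iff munit_def)
  then have "commutator (blocks d N) ?a x' = munit p (Suc n, m)"
    unfolding commutator_scale by (simp add: fun_eq_iff)
  ultimately show ?thesis by blast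
next
  case (top k)
  show ?thesis
  proof (cases "k < dd")
    case True
    let ?a = "\<lambda>u v. (-1) * munit (Suc n, k) (Suc n, m) u v :: 'k"
    have "supported (blocks d (Suc n)) (reach orient) ?a"
      by (intro supported_scale new_unit_supp) (use True assms new_in in auto)
    moreover have "commutator (blocks d N) (munit (Suc n, k) (Suc n, m)) x' = - munit p (Suc n, m)"
      unfolding commutator_def unit_x'[OF assms(3)] x'_unit[OF new_in(1)[OF True]]
      using True top by (auto simp: fun_eq_iff munit_def old_zero[OF xs] y_def)
    then have "commutator (blocks d N) ?a x' = munit p (Suc n, m)"
      unfolding commutator_scale by (simp add: fun_eq_iff)
    ultimately show ?thesis by blast
  next
    case False
    then have mk: "m \<le> k" "m < D" using assms(3) top by auto
    obtain a where a: "supported (blocks d n) (reach orient) a" "mul a x = mul x a"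
      "\<And>l' u. l' < D \<Longrightarrow> a u (h l') = (if l' = m \<and> u = h k then 1 else 0)"
      by (rule unitC[OF mk(1) top(1)]) blast
    have "commutator (blocks d N) a x' = mul a y"
      by (simp add: commutator_def kmul_add_left kmul_add_right a(2) y_mul[OF a(1)])
    also have "\<dots> = munit p (Suc n, m)"
      unfolding mul_y using a(3) assms(3) mk top by (auto simp: fun_eq_iff munit_def)
    finally show ?thesis using old_supp[OF a(1)] by blast
  qed
qed

text \<open>A solution a0 for the old blocks leaves the error a0 y, which is confined to the new
  columns and is repaired there. No further block occurs, since no path leads from the new vertex to
  an old one and R has no entries from a vertex to itself.\<close>

lemma extended_richardson: "richardson (blocks d N) (blocks d (Suc n)) orient x'"
  unfolding richardson_def
proof (intro conjI allI impI)
  show "supported (blocks d (Suc n)) (sreach orient) x'" by (rule x'_supp)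
  have col: "\<exists>a. supported (blocks d (Suc n)) (reach orient) a \<and> commutator (blocks d N) a x' = r"
    if r: "supported (blocks d (Suc n)) (sreach orient) r" and r0: "\<And>u v. fst v \<noteq> Suc n \<Longrightarrow> r u v = 0" for r
  proof (rule commutators_onto_span)
    show "supported (blocks d (Suc n)) (\<lambda>i j. j = Suc n \<and> sreach orient i j) r"
      using r r0 unfolding supported_def by (metis (no_types, lifting))
    fix p q :: "nat \<times> nat"
    assume *: "p \<in> blocks d (Suc n)" "q \<in> blocks d (Suc n)" "fst q = Suc n \<and> sreach orient (fst p) (fst q)"
    then obtain m where m: "q = (Suc n, m)" "m < dd" by (cases q) (auto simp: blocks_Suc blocks_def dd_def)
    have "p \<in> blocks d n" using * by (auto simp: blocks_Suc)
    then show "\<exists>a. supported (blocks d (Suc n)) (reach orient) a \<and> commutator (blocks d N) a x' = munit p q"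
      using new_column_attained * m by simp
  qed simp
  fix r :: "'k imat" assume r: "supported (blocks d (Suc n)) (sreach orient) r"
  define r0 where "r0 = (\<lambda>u v. if u \<in> blocks d n \<and> v \<in> blocks d n then r u v else 0)"
  have "supported (blocks d n) (sreach orient) r0" using r by (auto simp: supported_def r0_def)
  then obtain a0 where a0: "supported (blocks d n) (reach orient) a0" "commutator (blocks d N) a0 x = r0"
    using rich unfolding richardson_def by blast
  let ?r = "r - (r0 + mul a0 y)"
  have y_s: "supported (blocks d (Suc n)) (sreach orient) (mul a0 y)"
    by (rule supported_kmul[OF old_supp[OF a0(1)] y_supp]) (metis reach_trans reach_antisym)
  have "supported (blocks d (Suc n)) (sreach orient) ?r"
    by (intro supported_diff supported_add y_s r old_supp) fact
  moreover have "?r u v = 0" if "fst v \<noteq> Suc n" for u v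
  proof -
    \<comment> \<open>With the column v old, an entry outside the old square would have its row at
      the new vertex, hence a path from there back to an old vertex.\<close>
    have "r u v = r0 u v"
    proof (cases "u \<in> blocks d n \<and> v \<in> blocks d n")
      case False
      have "\<not> (u \<in> blocks d (Suc n) \<and> v \<in> blocks d (Suc n) \<and> reach orient (fst u) (fst v))"
        using False that not_reach_from_Suc[of orient n, OF orient_n] by (auto simp: blocks_Suc) (auto simp: blocks_def)
      then have "r u v = 0" using r unfolding supported_def by blast
      then show ?thesis using False by (auto simp: r0_def)
    qed (simp add: r0_def)
    then show ?thesis using that by (simp add: mul_y)
  qed
  ultimately obtain a1 where a1: "supported (blocks d (Suc n)) (reach orient) a1" "commutator (blocks d N) a1 x' = ?r"
    using col by blast
  have "commutator (blocks d N) a0 x' = r0 + mul a0 y"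
    using a0(2) by (simp add: commutator_def kmul_add_left kmul_add_right y_mul[OF a0(1)] algebra_simps)
  then have "commutator (blocks d N) (a0 + a1) x' = r"
    unfolding commutator_add a1(2) by simp
  then show "\<exists>a. supported (blocks d (Suc n)) (reach orient) a \<and> commutator (blocks d N) a x' = r"
    using supported_add[OF old_supp[OF a0(1)] a1(1)] by blast
qed

text \<open>Old centralising units are lifted to x'. The four cases are governed by whether the
  labels l and m now belong to new generators, and by whether x' kills the new generator m.\<close>

lemma extended_unit:
  assumes "l \<le> m" "m < max dd D"
  shows "\<exists>a. supported (blocks d (Suc n)) (reach orient) a \<and> mul a x' = mul x' a \<and>
       (\<forall>l'<max dd D. \<forall>u. a u (h' l') = (if l' = l \<and> u = h' m then 1 else 0))"
proof (cases "m < D")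
  case False
  then have m: "m < dd" "l < dd" using assms by auto
  \<comment> \<open>Since D \<le> m, x' kills the new generator m, and x' has no rows at the new
    vertex: both products with the bare unit are 0.\<close>
  let ?a = "munit (Suc n, m) (Suc n, l) :: 'k imat"
  have "supported (blocks d (Suc n)) (reach orient) ?a"
    by (intro new_unit_supp) (use m new_in in auto)
  moreover have "mul ?a x' = mul x' ?a"
    unfolding unit_x'[OF m(2)] x'_unit[OF new_in(1)[OF m(1)]]
    using False by (auto simp: fun_eq_iff old_zero[OF xs] y_def)
  moreover have "?a u (h' l') = (if l' = l \<and> u = h' m then 1 else 0)" if "l' < max dd D" for l' u
    using m that by (auto simp: munit_def h'_def)
  ultimately show ?thesis by blast
next
  case mD: True
  obtain a where a: "supported (blocks d n) (reach orient) a" "mul a x = mul x a"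
    "\<And>l' u. l' < D \<Longrightarrow> a u (h l') = (if l' = l \<and> u = h m then 1 else 0)"
    by (rule unitC[OF assms(1) mD]) blast
  note lin = kmul_add_left kmul_add_right y_mul[OF a(1)]
  consider "m < dd" | "l < dd" "dd \<le> m" | "dd \<le> l" by linarith
  then show ?thesis
  proof cases
    case 1
    then have l: "l < dd" "l < D" using assms mD by auto
    \<comment> \<open>\<open>a\<close> moves \<open>h l\<close> to \<open>h m\<close>, which are the
      images of the new generators l and m; the extra unit lifts this move to the
      generators.\<close>
    let ?a = "a + munit (Suc n, m) (Suc n, l)"
    have "supported (blocks d (Suc n)) (reach orient) ?a"
      by (intro supported_add old_supp a(1) new_unit_supp) (use l 1 new_in in auto)
    moreover have "mul a y = mul x' (munit (Suc n, m) (Suc n, l))"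
      unfolding x'_unit[OF new_in(1)[OF 1]] mul_y using l 1 mD a(3)
      by (auto simp: fun_eq_iff old_zero[OF xs] y_def)
    then have "mul ?a x' = mul x' ?a"
      unfolding kmul_add_left[of _ a] kmul_add_right[of _ _ a] unit_x'[OF l(1)] by (simp add: lin a(2))
    moreover have "?a u (h' l') = (if l' = l \<and> u = h' m then 1 else 0)" if "l' < max dd D" for l' u
      using l 1 mD that old_zero[OF a(1)] a(3) by (auto simp: munit_def h'_def)
    ultimately show ?thesis by blast
  next
    case 2
    then have l: "l < dd" "l < D" using assms mD by auto
    \<comment> \<open>The new generator l must go to \<open>h m\<close>. Commuting with x' then
      forces its image \<open>h l\<close> to go to x applied to \<open>h m\<close>, which is the
      effect of x a. Labels other than l stay killed because \<open>a\<close> already kills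
      them.\<close>
    let ?a = "mul x a + munit (h m) (Suc n, l)"
    have xa: "supported (blocks d n) (reach orient) (mul x a)"
      by (rule supported_kmul[OF xs a(1)]) (metis reach_trans)
    have "supported (blocks d (Suc n)) (reach orient) ?a"
      by (intro supported_add old_supp xa new_unit_supp) (use l hB[OF mD] in_old old_reach in auto)
    moreover have "mul (mul x a) y = mul x' (munit (h m) (Suc n, l))"
    proof -
      have "mul x (mul a y) = mul x (munit (h m) (Suc n, l))"
        by (rule arg_cong[of _ _ "mul x"]) (use l mD a(3) in \<open>auto simp: mul_y fun_eq_iff munit_def\<close>)
      moreover have "y u (h m) = 0" for u using mD by (simp add: y_def)
      then have "mul y (munit (h m) (Suc n, l)) = 0"
        by (simp add: kmul_munit_right in_old hB mD fun_eq_iff)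
      ultimately show ?thesis by (simp add: lin kmul_assoc)
    qed
    moreover have "mul (mul x a) x = mul x (mul x a)" by (simp add: kmul_assoc a(2))
    ultimately have "mul ?a x' = mul x' ?a"
      unfolding kmul_add_left[of _ "mul x a"] kmul_add_right[of _ _ "mul x a"] unit_x'[OF l(1)]
      by (simp add: kmul_add_left kmul_add_right y_mul[OF xa])
    moreover have "?a u (h' l') = (if l' = l \<and> u = h' m then 1 else 0)" if l': "l' < max dd D" for l' u
    proof (cases "l' < dd")
      case True
      then show ?thesis using 2 mD old_zero(2)[OF xa] by (auto simp: munit_def h'_def)
    next
      case False
      then have "a w (h l') = 0" for w using a(3) l' 2 by auto
      then have "mul x a u (h l') = 0" by (simp add: kmul_def)
      then show ?thesis using 2 l' False by (auto simp: munit_def h'_def)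
    qed
    ultimately show ?thesis using \<open>supported _ _ ?a\<close> by blast
  next
    case 3
    \<comment> \<open>The image of y is spanned by tops with labels below \<open>dd\<close> \<le> l,
      and \<open>a\<close> kills every top except \<open>h l\<close>.\<close>
    have "mul a y = 0"
      unfolding mul_y using 3 a(3) by (auto simp: fun_eq_iff)
    then have "mul a x' = mul x' a" by (simp add: lin a(2))
    moreover have "a u (h' l') = (if l' = l \<and> u = h' m then 1 else 0)" if "l' < max dd D" for l' u
      using 3 that assms old_zero[OF a(1)] a(3) by (auto simp: h'_def)
    ultimately show ?thesis using old_supp[OF a(1)] by blast
  qed
qed

text \<open>Labels below \<open>dd\<close> pass to the new generators and old tops with labels from
  \<open>dd\<close> on survive, so max(dd, D) labels remain in use.\<close>

lemma extended_tops: "triangular_tops (blocks d N) (blocks d (Suc n)) (Suc n) orient x' (max dd D) h'"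
  unfolding triangular_tops_def
proof (intro conjI ballI impI allI)
  show "inj_on h' {..<max dd D}"
    using hinj by (auto simp: inj_on_def h'_def)
  fix l assume l: "l < max dd D"
  show "h' l \<in> blocks d (Suc n)" "reach orient (fst (h' l)) (Suc n)"
    using l new_in hB in_old old_reach by (auto simp: h'_def)
next
  fix p assume "p \<in> blocks d (Suc n)" "reach orient (fst p) (Suc n)"
  then show "p \<in> h' ` {..<max dd D} \<or> (\<exists>p'\<in>blocks d (Suc n). reach orient (fst p') (Suc n) \<and>
      (\<forall>u. x' u p' = (if u = p then 1 else 0)))"
  proof (cases rule: reach_new_cases)
    case (new l)
    then have "p = h' l" "l < max dd D" by (auto simp: h'_def)
    then show ?thesis by blast
  next
    case (top k)
    show ?thesis
    proof (cases "k < dd")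
      case True
      have "x' u (Suc n, k) = (if u = p then 1 else 0)" for u
        using True top by (simp add: old_zero[OF xs] y_def)
      then show ?thesis using new_in(2)[OF True] by (metis fst_conv reach_refl)
    next
      case False
      then have "p = h' k" "k < max dd D" using top by (auto simp: h'_def)
      then show ?thesis by blast
    qed
  next
    case (im p')
    have "y u p' = 0" for u using im(2) by (auto simp: y_def blocks_def)
    then show ?thesis using im in_old old_reach by (metis add.right_neutral plus_fun_apply)
  qed
next
  fix l m assume "l \<le> m \<and> m < max dd D"
  then show "\<exists>a. supported (blocks d (Suc n)) (reach orient) a \<and> mul a x' = mul x' a \<and>
       (\<forall>l'<max dd D. \<forall>u. a u (h' l') = (if l' = l \<and> u = h' m then 1 else 0))"
    using extended_unit by simp
qed

text \<open>Transposing reverses the triangular order, which is undone by reversing the labelling of the last block.\<close>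
lemma extended_cotops:
  "triangular_tops (blocks d N) (blocks d (Suc n)) (Suc n) (\<lambda>k. \<not> orient k) (imat_transp x') dd (\<lambda>l. (Suc n, dd - 1 - l))"
  unfolding triangular_tops_def
proof (intro conjI ballI impI allI)
  show "inj_on (\<lambda>l. (Suc n, dd - 1 - l)) {..<dd}" by (auto simp: inj_on_def)
  fix l assume l: "l < dd"
  show "(Suc n, dd - 1 - l) \<in> blocks d (Suc n)"
    "reach (\<lambda>k. \<not> orient k) (fst (Suc n, dd - 1 - l)) (Suc n)"
    using l new_in by auto
next
  fix p assume p: "p \<in> blocks d (Suc n)" and "reach (\<lambda>k. \<not> orient k) (fst p) (Suc n)"
  \<comment> \<open>In the opposite orientation the last arrow leaves the vertex n + 1, so only the
    last block has a path to it.\<close>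
  then have "p \<notin> blocks d n"
    using not_reach_from_Suc[of orient n, OF orient_n] by (auto simp: blocks_def reach_opposite)
  then obtain l where "l < dd" "p = (Suc n, l)" using p by (auto simp: blocks_Suc dd_def)
  then have "p = (\<lambda>l. (Suc n, dd - 1 - l)) (dd - 1 - l)" "dd - 1 - l < dd" by auto
  then show "p \<in> (\<lambda>l. (Suc n, dd - 1 - l)) ` {..<dd} \<or>
     (\<exists>p'\<in>blocks d (Suc n). reach (\<lambda>k. \<not> orient k) (fst p') (Suc n) \<and> (\<forall>u. imat_transp x' u p' = (if u = p then 1 else 0)))"
    by blast
next
  fix l m assume lm: "l \<le> m \<and> m < dd"
  \<comment> \<open>The transpose turns the unit from label \<open>l1\<close> to label
    \<open>m1\<close> into one from \<open>m1\<close> to \<open>l1\<close>. In the reversed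
    labelling these are l and m.\<close>
  define l1 m1 where "l1 = dd - 1 - m" and "m1 = dd - 1 - l"
  have 1: "l1 \<le> m1" "m1 < dd" using lm by (auto simp: l1_def m1_def)
  obtain a where a: "supported (blocks d (Suc n)) (reach orient) a" "mul a x' = mul x' a"
     "\<And>l' u. l' < max dd D \<Longrightarrow> a u (h' l') = (if l' = l1 \<and> u = h' m1 then 1 else 0)"
    using extended_unit[of l1 m1] 1 by (metis less_max_iff_disj)
  have "supported (blocks d (Suc n)) (reach (\<lambda>k. \<not> orient k)) (imat_transp a)"
    using a(1) by (simp add: supported_transp reach_opposite[abs_def])
  moreover have "mul (imat_transp a) (imat_transp x') = mul (imat_transp x') (imat_transp a)"
    by (simp add: kmul_transp a(2))
  moreover have "imat_transp a u (Suc n, dd - 1 - l') = (if l' = l \<and> u = (Suc n, dd - 1 - m) then 1 else 0)"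
    if l': "l' < dd" for l' u
  proof (cases "a (Suc n, dd - 1 - l') u = 0")
    case True
    show ?thesis
    proof (rule ccontr)
      assume "\<not> ?thesis"
      then have "l' = l" "u = (Suc n, l1)" using True by (auto simp: imat_transp_def l1_def split: if_splits)
      moreover have "a (Suc n, m1) (h' l1) = 1" using a(3)[of l1 "(Suc n, m1)"] 1 by (simp add: h'_def)
      ultimately show False using True 1 by (simp add: m1_def h'_def)
    qed
  next
    case False
    \<comment> \<open>The unit condition describes columns of \<open>a\<close>, whereas the
      transpose asks about rows. A row at the last vertex has nonzero entries only in columns of the
      last block, all of which are known.\<close>
    then have "u \<in> blocks d (Suc n)" "reach orient (Suc n) (fst u)" using a(1) unfolding supported_def by fastforce+
    then obtain l2 where l2: "l2 < dd" "u = (Suc n, l2)"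
      using not_reach_from_Suc[of orient n, OF orient_n] by (cases u) (auto simp: dd_def blocks_def le_Suc_eq)
    then have "a (Suc n, dd - 1 - l') u = (if l2 = l1 \<and> dd - 1 - l' = m1 then 1 else 0)"
      using a(3)[of l2 "(Suc n, dd - 1 - l')"] 1 by (simp add: h'_def)
    then show ?thesis using l2 l' lm by (auto simp: imat_transp_def l1_def m1_def)
  qed
  ultimately show "\<exists>a. supported (blocks d (Suc n)) (reach (\<lambda>k. \<not> orient k)) a \<and>
        mul a (imat_transp x') = mul (imat_transp x') a \<and>
        (\<forall>l'<dd. \<forall>u. a u (Suc n, dd - 1 - l') = (if l' = l \<and> u = (Suc n, dd - 1 - m) then 1 else 0))"
    by blast
qed

end

text \<open>Transposition reverses products, so it changes the sign of a commutator; the equation is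
  therefore solved for minus the transpose of r.\<close>

lemma richardson_transp:
  assumes "richardson B C orient x" shows "richardson B C (\<lambda>k. \<not> orient k) (imat_transp x)"
  unfolding richardson_def
proof (intro conjI allI impI)
  show "supported C (sreach (\<lambda>k. \<not> orient k)) (imat_transp x)"
    using assms unfolding richardson_def supported_def imat_transp_def reach_opposite by metis
  fix r :: "'a imat" assume "supported C (sreach (\<lambda>k. \<not> orient k)) r"
  then have "supported C (sreach orient) (- imat_transp r)"
    unfolding supported_def imat_transp_def reach_opposite by (metis neg_equal_0_iff_equal uminus_apply)
  then obtain a where a: "supported C (reach orient) a" "commutator B a x = - imat_transp r"
    using assms unfolding richardson_def by blast
  have "commutator B (imat_transp a) (imat_transp x) = r"
    unfolding commutator_transp a(2) by (simp add: imat_transp_def)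
  moreover have "supported C (reach (\<lambda>k. \<not> orient k)) (imat_transp a)"
    using a(1) by (simp add: supported_transp reach_opposite[abs_def])
  ultimately show "\<exists>a. supported C (reach (\<lambda>k. \<not> orient k)) a \<and> commutator B a (imat_transp x) = r" by blast
qed

lemma imat_transp_involutive [simp]: "imat_transp (imat_transp x) = x" by (simp add: imat_transp_def)

text \<open>\<open>add_vertex\<close> handles only arrows from n to n + 1. For an arrow in the other
  direction the same step is run on the opposite quiver, hence the induction over all orientations.
  Tops of the transpose are carried along because they become the tops needed after such a
  turn.\<close>

lemma richardson_and_tops_exist:
  assumes "n \<le> N"
  shows "\<exists>(x :: 'k::field imat) D h D' h'. richardson (blocks d N) (blocks d n) orient x \<and>
     triangular_tops (blocks d N) (blocks d n) n orient x D h \<and>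
     triangular_tops (blocks d N) (blocks d n) n (\<lambda>k. \<not> orient k) (imat_transp x) D' h'"
  using assms
proof (induction n arbitrary: orient)
  case 0
  have [simp]: "blocks d 0 = {}" by (auto simp: blocks_def)
  have s0: "supported {} rel r \<longleftrightarrow> r = 0" for rel and r :: "'k imat"
    by (auto simp: supported_def fun_eq_iff)
  have "richardson (blocks d N) (blocks d 0) orient (0 :: 'k imat)"
    by (auto simp: richardson_def s0 commutator_def)
  moreover have "triangular_tops (blocks d N) (blocks d 0) 0 o2 x 0 h" for o2 h and x :: "'k imat"
    by (simp add: triangular_tops_def)
  ultimately show ?case by blast
next
  case (Suc n)
  have step: "\<exists>(x :: 'k imat) D h D' h'. richardson (blocks d N) (blocks d (Suc n)) o2 x \<and>
     triangular_tops (blocks d N) (blocks d (Suc n)) (Suc n) o2 x D h \<and>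
     triangular_tops (blocks d N) (blocks d (Suc n)) (Suc n) (\<lambda>k. \<not> o2 k) (imat_transp x) D' h'"
    if "o2 n" for o2
  proof -
    obtain x :: "'k imat" and D h where "richardson (blocks d N) (blocks d n) o2 x"
        "triangular_tops (blocks d N) (blocks d n) n o2 x D h"
      using Suc by (metis Suc_leD)
    then interpret add_vertex d n N o2 x D h
      using that Suc.prems by unfold_locales auto
    show ?thesis using extended_richardson extended_tops extended_cotops by blast
  qed
  show ?case
  proof (cases "orient n")
    case False
    then obtain x :: "'k imat" and D h D' h' where
      x: "richardson (blocks d N) (blocks d (Suc n)) (\<lambda>k. \<not> orient k) x"
      "triangular_tops (blocks d N) (blocks d (Suc n)) (Suc n) (\<lambda>k. \<not> orient k) x D h"
      "triangular_tops (blocks d N) (blocks d (Suc n)) (Suc n) orient (imat_transp x) D' h'"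
      using step[of "\<lambda>k. \<not> orient k"] by auto
    \<comment> \<open>Transposing back exchanges the two kinds of tops delivered by the step for the
      opposite quiver.\<close>
    have "richardson (blocks d N) (blocks d (Suc n)) orient (imat_transp x)"
      using richardson_transp[OF x(1)] by simp
    then show ?thesis using x(2,3) by (metis imat_transp_involutive)
  qed (use step in blast)
qed

theorem richardson_exists: "\<exists>x :: 'k::field imat. richardson (blocks d n) (blocks d n) orient x"
  using richardson_and_tops_exist[of n n d orient] by blast

section \<open>Exceptional modules and inner derivations\<close>

lemma msum_carrier [simp]: "msum r c S F \<in> carrier_mat r c"
  by (simp add: msum_def)

lemma msum_dim [simp]: "dim_row (msum r c S F) = r" "dim_col (msum r c S F) = c"
  by (simp_all add: msum_def)

lemma msum_cong: "(\<And>x. x \<in> S \<Longrightarrow> F x = G x) \<Longrightarrow> msum r c S F = msum r c S G"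
  by (auto simp: msum_def intro!: cong_mat sum.cong)

lemma mult_msum:
  fixes A :: "'k::field mat"
  assumes A: "A \<in> carrier_mat m r" and F: "\<And>x. x \<in> S \<Longrightarrow> F x \<in> carrier_mat r c"
  shows "A * msum r c S F = msum m c S (\<lambda>x. A * F x)"
proof (rule eq_matI)
  fix i j assume "i < dim_row (msum m c S (\<lambda>x. A * F x))" "j < dim_col (msum m c S (\<lambda>x. A * F x))"
  then have ij: "i < m" "j < c" by (auto simp: msum_def)
  have "(A * msum r c S F) $$ (i, j) = (\<Sum>k = 0..<r. \<Sum>x\<in>S. A $$ (i, k) * F x $$ (k, j))"
    using ij A by (simp add: msum_def scalar_prod_def sum_distrib_left)
  also have "\<dots> = (\<Sum>x\<in>S. \<Sum>k = 0..<r. A $$ (i, k) * F x $$ (k, j))" by (rule sum.swap)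
  also have "\<dots> = (\<Sum>x\<in>S. (A * F x) $$ (i, j))"
  proof (rule sum.cong[OF refl])
    fix x assume "x \<in> S"
    then show "(\<Sum>k = 0..<r. A $$ (i, k) * F x $$ (k, j)) = (A * F x) $$ (i, j)"
      using F[of x] A ij by (simp add: scalar_prod_def)
  qed
  finally show "(A * msum r c S F) $$ (i, j) = msum m c S (\<lambda>x. A * F x) $$ (i, j)"
    using ij by (simp add: msum_def)
qed (use A in \<open>auto simp: msum_def\<close>)

lemma msum_mult:
  fixes A :: "'k::field mat"
  assumes A: "A \<in> carrier_mat c m" and F: "\<And>x. x \<in> S \<Longrightarrow> F x \<in> carrier_mat r c"
  shows "msum r c S F * A = msum r m S (\<lambda>x. F x * A)"
proof (rule eq_matI)
  fix i j assume "i < dim_row (msum r m S (\<lambda>x. F x * A))" "j < dim_col (msum r m S (\<lambda>x. F x * A))"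
  then have ij: "i < r" "j < m" by (auto simp: msum_def)
  have "(msum r c S F * A) $$ (i, j) = (\<Sum>k = 0..<c. \<Sum>x\<in>S. F x $$ (i, k) * A $$ (k, j))"
    using ij A by (simp add: msum_def scalar_prod_def sum_distrib_right)
  also have "\<dots> = (\<Sum>x\<in>S. \<Sum>k = 0..<c. F x $$ (i, k) * A $$ (k, j))" by (rule sum.swap)
  also have "\<dots> = (\<Sum>x\<in>S. (F x * A) $$ (i, j))"
  proof (rule sum.cong[OF refl])
    fix x assume "x \<in> S"
    then show "(\<Sum>k = 0..<c. F x $$ (i, k) * A $$ (k, j)) = (F x * A) $$ (i, j)"
      using F[of x] A ij by (simp add: scalar_prod_def)
  qed
  finally show "(msum r c S F * A) $$ (i, j) = msum r m S (\<lambda>x. F x * A) $$ (i, j)"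
    using ij by (simp add: msum_def)
qed (use A in \<open>auto simp: msum_def\<close>)

lemma msum_add:
  fixes F G :: "'b \<Rightarrow> 'k::field mat"
  assumes "\<And>x. x \<in> S \<Longrightarrow> F x \<in> carrier_mat r c" "\<And>x. x \<in> S \<Longrightarrow> G x \<in> carrier_mat r c"
  shows "msum r c S (\<lambda>x. F x + G x) = msum r c S F + msum r c S G"
proof -
  have "(F x + G x) $$ (i, j) = F x $$ (i, j) + G x $$ (i, j)" if "x \<in> S" "i < r" "j < c" for x i j
    using assms(2)[OF that(1)] that by auto
  then show ?thesis by (intro eq_matI) (auto simp: msum_def sum.distrib[symmetric] intro!: sum.cong)
qed

lemma msum_diff:
  fixes F G :: "'b \<Rightarrow> 'k::field mat"
  assumes "\<And>x. x \<in> S \<Longrightarrow> F x \<in> carrier_mat r c" "\<And>x. x \<in> S \<Longrightarrow> G x \<in> carrier_mat r c"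
  shows "msum r c S (\<lambda>x. F x - G x) = msum r c S F - msum r c S G"
proof -
  have "(F x - G x) $$ (i, j) = F x $$ (i, j) - G x $$ (i, j)" if "x \<in> S" "i < r" "j < c" for x i j
    using assms(2)[OF that(1)] that by auto
  then show ?thesis by (intro eq_matI) (auto simp: msum_def sum_subtractf[symmetric] intro!: sum.cong)
qed

lemma msum_smult:
  fixes F :: "'b \<Rightarrow> 'k::field mat"
  assumes "\<And>x. x \<in> S \<Longrightarrow> F x \<in> carrier_mat r c"
  shows "msum r c S (\<lambda>x. t \<cdot>\<^sub>m F x) = t \<cdot>\<^sub>m msum r c S F"
proof -
  have "(t \<cdot>\<^sub>m F x) $$ (i, j) = t * F x $$ (i, j)" if "x \<in> S" "i < r" "j < c" for x i j
    using assms[OF that(1)] that by auto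
  then show ?thesis by (intro eq_matI) (auto simp: msum_def sum_distrib_left intro!: sum.cong)
qed

lemma msum_four_block:
  fixes A B C D :: "'b \<Rightarrow> 'k::field mat"
  assumes "\<And>x. x \<in> S \<Longrightarrow> A x \<in> carrier_mat r1 c1" "\<And>x. x \<in> S \<Longrightarrow> B x \<in> carrier_mat r1 c2"
    "\<And>x. x \<in> S \<Longrightarrow> C x \<in> carrier_mat r2 c1" "\<And>x. x \<in> S \<Longrightarrow> D x \<in> carrier_mat r2 c2"
  shows "msum (r1 + r2) (c1 + c2) S (\<lambda>x. four_block_mat (A x) (B x) (C x) (D x)) =
     four_block_mat (msum r1 c1 S A) (msum r1 c2 S B) (msum r2 c1 S C) (msum r2 c2 S D)"
proof -
  have "four_block_mat (A x) (B x) (C x) (D x) $$ (i, j) =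
     (if i < r1 then if j < c1 then A x $$ (i, j) else B x $$ (i, j - c1)
      else if j < c1 then C x $$ (i - r1, j) else D x $$ (i - r1, j - c1))"
    if "x \<in> S" "i < r1 + r2" "j < c1 + c2" for x i j
    using assms(1)[OF that(1)] assms(4)[OF that(1)] that by (subst index_mat_four_block) auto
  then show ?thesis by (intro eq_matI) (auto simp: msum_def intro!: sum.cong)
qed

text \<open>A four block matrix with empty lower blocks, so that the product rules for block
  matrices apply to two blocks side by side.\<close>

definition hcat :: "'k::field mat \<Rightarrow> 'k mat \<Rightarrow> 'k mat" where
  "hcat A B = four_block_mat A B (0\<^sub>m 0 (dim_col A)) (0\<^sub>m 0 (dim_col B))"

lemma four_block_no_cols:
  "A \<in> carrier_mat r c \<Longrightarrow> four_block_mat A (0\<^sub>m r 0) (0\<^sub>m 0 c) (0\<^sub>m 0 0) = A"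
  by (intro eq_matI) auto

lemma hcat_carrier [simp]: "A \<in> carrier_mat r c1 \<Longrightarrow> B \<in> carrier_mat r c2 \<Longrightarrow> hcat A B \<in> carrier_mat r (c1 + c2)"
  by (auto simp: hcat_def)

lemma append_rows_mult:
  fixes A B C :: "'k::field mat"
  assumes A: "A \<in> carrier_mat r1 c" and B: "B \<in> carrier_mat r2 c" and C: "C \<in> carrier_mat c m"
  shows "(A @\<^sub>r B) * C = (A * C) @\<^sub>r (B * C)"
proof -
  have "(A @\<^sub>r B) * C = four_block_mat A (0\<^sub>m r1 0) B (0\<^sub>m r2 0) * four_block_mat C (0\<^sub>m c 0) (0\<^sub>m 0 m) (0\<^sub>m 0 0)"
    using A B by (simp add: append_rows_def four_block_no_cols[OF C])
  also have "\<dots> = (A * C) @\<^sub>r (B * C)"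
    by (subst mult_four_block_mat[OF A _ B _ C]) (use A B C in \<open>auto simp: append_rows_def\<close>)
  finally show ?thesis .
qed

lemma four_block_append_rows:
  fixes A B C D X Y :: "'k::field mat"
  assumes "A \<in> carrier_mat r1 c1" "B \<in> carrier_mat r1 c2" "C \<in> carrier_mat r2 c1" "D \<in> carrier_mat r2 c2"
    "X \<in> carrier_mat c1 m" "Y \<in> carrier_mat c2 m"
  shows "four_block_mat A B C D * (X @\<^sub>r Y) = (A * X + B * Y) @\<^sub>r (C * X + D * Y)"
  unfolding append_rows_def
  by (subst mult_four_block_mat[OF assms(1-5) _ assms(6)]) (use assms in auto)

lemma hcat_four_block:
  fixes A B P Q R S :: "'k::field mat"
  assumes "A \<in> carrier_mat r c1" "B \<in> carrier_mat r c2"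
    "P \<in> carrier_mat c1 m1" "Q \<in> carrier_mat c1 m2" "R \<in> carrier_mat c2 m1" "S \<in> carrier_mat c2 m2"
  shows "hcat A B * four_block_mat P Q R S = hcat (A * P + B * R) (A * Q + B * S)"
  unfolding hcat_def
  by (subst mult_four_block_mat[OF assms(1,2) _ _ assms(3-6)]) (use assms in auto)

lemma mult_hcat:
  fixes A B C :: "'k::field mat"
  assumes A: "A \<in> carrier_mat c m1" and B: "B \<in> carrier_mat c m2" and C: "C \<in> carrier_mat r c"
  shows "C * hcat A B = hcat (C * A) (C * B)"
proof -
  have "C * hcat A B = four_block_mat C (0\<^sub>m r 0) (0\<^sub>m 0 c) (0\<^sub>m 0 0) * four_block_mat A B (0\<^sub>m 0 m1) (0\<^sub>m 0 m2)"
    using A B by (simp add: hcat_def four_block_no_cols[OF C])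
  also have "\<dots> = hcat (C * A) (C * B)"
    by (subst mult_four_block_mat[OF C _ _ _ A B]) (use A B C in \<open>auto simp: hcat_def\<close>)
  finally show ?thesis .
qed

lemma hcat_append_rows:
  fixes A B X Y :: "'k::field mat"
  assumes "A \<in> carrier_mat r c1" "B \<in> carrier_mat r c2" "X \<in> carrier_mat c1 m" "Y \<in> carrier_mat c2 m"
  shows "hcat A B * (X @\<^sub>r Y) = A * X + B * Y"
proof -
  have "hcat A B * (X @\<^sub>r Y) = four_block_mat (A * X + B * Y) (0\<^sub>m r 0) (0\<^sub>m 0 m) (0\<^sub>m 0 0)"
    unfolding hcat_def append_rows_def
    by (subst mult_four_block_mat[OF assms(1,2) _ _ assms(3) _ assms(4)]) (use assms in auto)
  also have "\<dots> = A * X + B * Y" by (rule four_block_no_cols) (use assms in auto)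
  finally show ?thesis .
qed

lemma hcat_mult_vec:
  fixes A B :: "'k::field mat"
  assumes "A \<in> carrier_mat r c1" "B \<in> carrier_mat r c2" "x \<in> carrier_vec c1" "y \<in> carrier_vec c2"
  shows "hcat A B *\<^sub>v (x @\<^sub>v y) = A *\<^sub>v x + B *\<^sub>v y"
  unfolding hcat_def
  by (subst four_block_mat_mult_vec[OF assms(1,2) _ _ assms(3,4)]) (use assms in auto)

lemma append_rows_eq:
  assumes "A \<in> carrier_mat r1 c" "B \<in> carrier_mat r2 c" "A' \<in> carrier_mat r1 c" "B' \<in> carrier_mat r2 c"
    "A @\<^sub>r B = A' @\<^sub>r B'"
  shows "A = A'" "B = B'"
proof -
  have 1: "(X @\<^sub>r Y) $$ (i, j) = (if i < r1 then X $$ (i, j) else Y $$ (i - r1, j))"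
    if "X \<in> carrier_mat r1 c" "Y \<in> carrier_mat r2 c" "i < r1 + r2" "j < c" for i j and X Y :: "'a mat"
    using that by (auto simp: append_rows_def)
  have eq: "(A @\<^sub>r B) $$ (i, j) = (A' @\<^sub>r B') $$ (i, j)" for i j using assms(5) by simp
  show "A = A'"
  proof (rule eq_matI)
    fix i j assume "i < dim_row A'" "j < dim_col A'"
    then show "A $$ (i, j) = A' $$ (i, j)"
      using eq[of i j] 1[OF assms(1,2), of i j] 1[OF assms(3,4), of i j] assms by auto
  qed (use assms in auto)
  show "B = B'"
  proof (rule eq_matI)
    fix i j assume "i < dim_row B'" "j < dim_col B'"
    then show "B $$ (i, j) = B' $$ (i, j)"
      using eq[of "i + r1" j] 1[OF assms(1,2), of "i + r1" j] 1[OF assms(3,4), of "i + r1" j] assms by auto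
  qed (use assms in auto)
qed

lemma append_rows_split:
  assumes "H \<in> carrier_mat (r1 + r2) c"
  obtains X Y where "X \<in> carrier_mat r1 c" "Y \<in> carrier_mat r2 c" "H = X @\<^sub>r Y"
proof
  let ?X = "mat r1 c (\<lambda>(i, j). H $$ (i, j))" and ?Y = "mat r2 c (\<lambda>(i, j). H $$ (i + r1, j))"
  show "?X \<in> carrier_mat r1 c" "?Y \<in> carrier_mat r2 c" by auto
  show "H = ?X @\<^sub>r ?Y"
    by (rule eq_matI) (use assms in \<open>auto simp: append_rows_def\<close>)
qed

section \<open>Self-extensions and derivations\<close>

definition is_krep :: "('v, 'a) quiver \<Rightarrow> ('v, 'a, 'k::field) drep \<Rightarrow> bool" where
  "is_krep Q M \<longleftrightarrow> (\<forall>a\<in>arrs Q. arr M a \<in> carrier_mat (dimv M (tgt Q a)) (dimv M (src Q a)))"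

definition is_khom :: "('v, 'a) quiver \<Rightarrow> ('v, 'a, 'k::field) drep \<Rightarrow> ('v, 'a, 'k) drep \<Rightarrow> ('v \<Rightarrow> 'k mat) \<Rightarrow> bool" where
  "is_khom Q M N f \<longleftrightarrow>
     (\<forall>v\<in>verts Q. f v \<in> carrier_mat (dimv N v) (dimv M v)) \<and>
     (\<forall>a\<in>arrs Q. f (tgt Q a) * arr M a = arr N a * f (src Q a))"

text \<open>\<open>is_Dmod\<close> with \<delta> in place of the starred arrows expresses that
  \<delta> is a derivation: the relations are linear and homogeneous in the starred arrows, so the
  off-diagonal part of a self-extension obeys the same equations as a module structure.\<close>

definition derivations_inner :: "('v, 'a) quiver \<Rightarrow> ('v, 'a, 'k::field) drep \<Rightarrow> bool" where
  "derivations_inner Q M \<longleftrightarrow> (\<forall>\<delta>. is_Dmod Q (M\<lparr>darr := \<delta>\<rparr>) \<longrightarrow>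
     (\<exists>f. is_khom Q M M f \<and>
        (\<forall>a\<in>arrs Q. f (src Q a) * darr M a - darr M a * f (tgt Q a) = \<delta> a)))"

lemma DmodD:
  assumes "is_Dmod Q M" "a \<in> arrs Q"
  shows "arr M a \<in> carrier_mat (dimv M (tgt Q a)) (dimv M (src Q a))"
    "darr M a \<in> carrier_mat (dimv M (src Q a)) (dimv M (tgt Q a))"
    "darr M a * arr M a = msum (dimv M (src Q a)) (dimv M (src Q a)) {g\<in>arrs Q. tgt Q g = src Q a} (\<lambda>g. arr M g * darr M g)"
    "b \<in> arrs Q \<Longrightarrow> a \<noteq> b \<Longrightarrow> tgt Q a = tgt Q b \<Longrightarrow> darr M b * arr M a = 0\<^sub>m (dimv M (src Q b)) (dimv M (src Q a))"
  using assms unfolding is_Dmod_def by blast+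

lemma Dmod_darrD:
  assumes "is_Dmod Q (M\<lparr>darr := \<delta>\<rparr>)" "a \<in> arrs Q"
  shows "arr M a \<in> carrier_mat (dimv M (tgt Q a)) (dimv M (src Q a))"
    "\<delta> a \<in> carrier_mat (dimv M (src Q a)) (dimv M (tgt Q a))"
    "\<delta> a * arr M a = msum (dimv M (src Q a)) (dimv M (src Q a)) {g\<in>arrs Q. tgt Q g = src Q a} (\<lambda>g. arr M g * \<delta> g)"
    "b \<in> arrs Q \<Longrightarrow> a \<noteq> b \<Longrightarrow> tgt Q a = tgt Q b \<Longrightarrow> \<delta> b * arr M a = 0\<^sub>m (dimv M (src Q b)) (dimv M (src Q a))"
  using DmodD[OF assms] by simp_all

lemma khomD:
  assumes "is_khom Q M N f"
  shows "v \<in> verts Q \<Longrightarrow> f v \<in> carrier_mat (dimv N v) (dimv M v)"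
    "a \<in> arrs Q \<Longrightarrow> f (tgt Q a) * arr M a = arr N a * f (src Q a)"
  using assms unfolding is_khom_def by blast+

lemma homD:
  assumes "is_hom Q M N f"
  shows "v \<in> verts Q \<Longrightarrow> f v \<in> carrier_mat (dimv N v) (dimv M v)"
    "a \<in> arrs Q \<Longrightarrow> f (tgt Q a) * arr M a = arr N a * f (src Q a)"
    "a \<in> arrs Q \<Longrightarrow> f (src Q a) * darr M a = darr N a * f (tgt Q a)"
  using assms unfolding is_hom_def by blast+

locale finite_quiver =
  fixes Q :: "('v, 'a) quiver"
  assumes fin_verts: "finite (verts Q)" and fin_arrs: "finite (arrs Q)"
    and src_in: "a \<in> arrs Q \<Longrightarrow> src Q a \<in> verts Q" and tgt_in: "a \<in> arrs Q \<Longrightarrow> tgt Q a \<in> verts Q"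
begin

text \<open>Over \<open>kQ\<close> this is the direct sum of two copies of M; the extension is
  carried entirely by the corner of the starred arrows.\<close>

definition self_ext :: "('v, 'a, 'k::field) drep \<Rightarrow> ('a \<Rightarrow> 'k mat) \<Rightarrow> ('v, 'a, 'k) drep" where
  "self_ext M \<delta> = \<lparr>dimv = (\<lambda>v. dimv M v + dimv M v),
     arr = (\<lambda>a. four_block_mat (arr M a) (0\<^sub>m (dimv M (tgt Q a)) (dimv M (src Q a)))
                  (0\<^sub>m (dimv M (tgt Q a)) (dimv M (src Q a))) (arr M a)),
     darr = (\<lambda>a. four_block_mat (darr M a) (\<delta> a) (0\<^sub>m (dimv M (src Q a)) (dimv M (tgt Q a))) (darr M a))\<rparr>"

text \<open>Computed in blocks, the diagonal of each relation is the relation for M and its upper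
  right corner is the relation for \<delta>.\<close>

lemma self_ext_Dmod:
  fixes M :: "('v, 'a, 'k::field) drep"
  assumes M: "is_Dmod Q M" and d: "is_Dmod Q (M\<lparr>darr := \<delta>\<rparr>)"
  shows "is_Dmod Q (self_ext M \<delta>)"
proof -
  let ?E = "self_ext M \<delta>"
  let ?n = "\<lambda>a. dimv M (src Q a)" and ?m = "\<lambda>a. dimv M (tgt Q a)"
  have car: "arr ?E a \<in> carrier_mat (dimv ?E (tgt Q a)) (dimv ?E (src Q a))"
     "darr ?E a \<in> carrier_mat (dimv ?E (src Q a)) (dimv ?E (tgt Q a))" if "a \<in> arrs Q" for a
    using DmodD[OF M that] Dmod_darrD[OF d that] by (auto simp: self_ext_def)
  have da: "darr ?E b * arr ?E a = four_block_mat (darr M b * arr M a) (\<delta> b * arr M a) (0\<^sub>m (?n b) (?n a)) (darr M b * arr M a)"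
    if "a \<in> arrs Q" "b \<in> arrs Q" "tgt Q a = tgt Q b" for a b
  proof -
    note c = DmodD(1,2)[OF M that(1)] DmodD(1,2)[OF M that(2)] Dmod_darrD(2)[OF d that(2)]
    show ?thesis unfolding self_ext_def using c that(3)
      by (simp, subst mult_four_block_mat[of _ "?n b" "?m b" _ "?m b" _ "?n b" _ _ "?n a" _ "?n a"]) auto
  qed
  have ad: "arr ?E a * darr ?E a = four_block_mat (arr M a * darr M a) (arr M a * \<delta> a) (0\<^sub>m (?m a) (?m a)) (arr M a * darr M a)"
    if "a \<in> arrs Q" for a
  proof -
    note c = DmodD(1,2)[OF M that] Dmod_darrD(2)[OF d that]
    show ?thesis unfolding self_ext_def using c
      by (simp, subst mult_four_block_mat[of _ "?m a" "?n a" _ "?n a" _ "?m a" _ _ "?m a" _ "?m a"]) auto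
  qed
  show ?thesis unfolding is_Dmod_def
  proof (intro conjI ballI impI)
    fix a assume a: "a \<in> arrs Q"
    let ?S = "{g \<in> arrs Q. tgt Q g = src Q a}"
    have c: "arr M g * darr M g \<in> carrier_mat (?n a) (?n a)" "arr M g * \<delta> g \<in> carrier_mat (?n a) (?n a)"
      if "g \<in> ?S" for g
    proof -
      from that have g: "g \<in> arrs Q" "tgt Q g = src Q a" by auto
      show "arr M g * darr M g \<in> carrier_mat (?n a) (?n a)" "arr M g * \<delta> g \<in> carrier_mat (?n a) (?n a)"
        using DmodD(1,2)[OF M g(1)] Dmod_darrD(2)[OF d g(1)] unfolding g(2) by auto
    qed
    have "msum (dimv ?E (src Q a)) (dimv ?E (src Q a)) ?S (\<lambda>g. arr ?E g * darr ?E g) =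
       msum (?n a + ?n a) (?n a + ?n a) ?S (\<lambda>g. four_block_mat (arr M g * darr M g) (arr M g * \<delta> g) (0\<^sub>m (?n a) (?n a)) (arr M g * darr M g))"
    proof -
      have "dimv ?E (src Q a) = ?n a + ?n a" by (simp add: self_ext_def)
      then show ?thesis by (simp only:) (rule msum_cong, use ad in auto)
    qed
    also have "\<dots> = four_block_mat (darr M a * arr M a) (\<delta> a * arr M a) (0\<^sub>m (?n a) (?n a)) (darr M a * arr M a)"
    proof (subst msum_four_block)
      have "msum (?n a) (?n a) ?S (\<lambda>g. 0\<^sub>m (?n a) (?n a)) = (0\<^sub>m (?n a) (?n a) :: 'k mat)"
        by (auto simp: msum_def)
      then show "four_block_mat (msum (?n a) (?n a) ?S (\<lambda>g. arr M g * darr M g)) (msum (?n a) (?n a) ?S (\<lambda>g. arr M g * \<delta> g))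
         (msum (?n a) (?n a) ?S (\<lambda>g. 0\<^sub>m (?n a) (?n a))) (msum (?n a) (?n a) ?S (\<lambda>g. arr M g * darr M g)) =
         four_block_mat (darr M a * arr M a) (\<delta> a * arr M a) (0\<^sub>m (?n a) (?n a)) (darr M a * arr M a)"
        using DmodD(3)[OF M a] Dmod_darrD(3)[OF d a] by simp
    qed (use c in auto)
    finally show "darr ?E a * arr ?E a = msum (dimv ?E (src Q a)) (dimv ?E (src Q a)) ?S (\<lambda>g. arr ?E g * darr ?E g)"
      using da[OF a a] by simp
  next
    fix a b assume ab: "a \<in> arrs Q" "b \<in> arrs Q" "a \<noteq> b \<and> tgt Q a = tgt Q b"
    then show "darr ?E b * arr ?E a = 0\<^sub>m (dimv ?E (src Q b)) (dimv ?E (src Q a))"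
      using da[of a b] DmodD(4)[OF M, of a b] Dmod_darrD(4)[OF d, of a b] by (simp add: self_ext_def)
  qed (use car in auto)
qed

lemma self_ext_exact:
  fixes M :: "('v, 'a, 'k::field) drep"
  assumes M: "is_Dmod Q M" and d: "is_Dmod Q (M\<lparr>darr := \<delta>\<rparr>)"
  shows "short_exact Q M (self_ext M \<delta>) M (\<lambda>v. 1\<^sub>m (dimv M v) @\<^sub>r 0\<^sub>m (dimv M v) (dimv M v))
     (\<lambda>v. hcat (0\<^sub>m (dimv M v) (dimv M v)) (1\<^sub>m (dimv M v)))"
    (is "short_exact _ _ ?E _ ?i ?p")
proof -
  have n: "dimv ?E v = dimv M v + dimv M v" for v by (simp add: self_ext_def)
  have i: "?i v *\<^sub>v x = x @\<^sub>v 0\<^sub>v (dimv M v)" if "x \<in> carrier_vec (dimv M v)" for v x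
    using that by (subst mat_mult_append[of _ "dimv M v" "dimv M v" _ "dimv M v"]) auto
  have p: "?p v *\<^sub>v (x @\<^sub>v y) = y" if "x \<in> carrier_vec (dimv M v)" "y \<in> carrier_vec (dimv M v)" for v x y
    using that by (subst hcat_mult_vec[of _ "dimv M v" "dimv M v" _ "dimv M v"]) auto
  show ?thesis
    unfolding short_exact_def
  proof (intro conjI ballI)
    show "is_hom Q M ?E ?i"
      unfolding is_hom_def
    proof (intro conjI ballI)
      fix a assume a: "a \<in> arrs Q"
      note c = DmodD(1,2)[OF M a] Dmod_darrD(2)[OF d a]
      show "?i (tgt Q a) * arr M a = arr ?E a * ?i (src Q a)"
        using c by (simp add: self_ext_def append_rows_mult[OF one_carrier_mat zero_carrier_mat c(1)] four_block_append_rows[OF c(1) zero_carrier_mat zero_carrier_mat c(1) one_carrier_mat zero_carrier_mat])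
      show "?i (src Q a) * darr M a = darr ?E a * ?i (tgt Q a)"
        using c by (simp add: self_ext_def append_rows_mult[OF one_carrier_mat zero_carrier_mat c(2)] four_block_append_rows[OF c(2) c(3) zero_carrier_mat c(2) one_carrier_mat zero_carrier_mat])
    qed (auto simp: self_ext_def)
    show "is_hom Q ?E M ?p"
      unfolding is_hom_def
    proof (intro conjI ballI)
      fix a assume a: "a \<in> arrs Q"
      note c = DmodD(1,2)[OF M a] Dmod_darrD(2)[OF d a]
      show "?p (tgt Q a) * arr ?E a = arr M a * ?p (src Q a)"
        using c by (simp add: self_ext_def mult_hcat[OF zero_carrier_mat one_carrier_mat c(1)] hcat_four_block[OF zero_carrier_mat one_carrier_mat c(1) zero_carrier_mat zero_carrier_mat c(1)])
      show "?p (src Q a) * darr ?E a = darr M a * ?p (tgt Q a)"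
        using c by (simp add: self_ext_def mult_hcat[OF zero_carrier_mat one_carrier_mat c(2)] hcat_four_block[OF zero_carrier_mat one_carrier_mat c(2) c(3) zero_carrier_mat c(2)])
    qed (auto simp: self_ext_def)
    fix v assume v: "v \<in> verts Q"
    let ?n = "dimv M v"
    have z: "0\<^sub>v (?n + ?n) = 0\<^sub>v ?n @\<^sub>v (0\<^sub>v ?n :: 'k vec)" by auto
    fix x :: "'k vec" assume x: "x \<in> carrier_vec ?n"
    show "?i v *\<^sub>v x = 0\<^sub>v (dimv ?E v) \<longrightarrow> x = 0\<^sub>v ?n"
      unfolding i[OF x] n z using x by (auto simp: append_vec_eq)
    show "\<exists>y\<in>carrier_vec (dimv ?E v). ?p v *\<^sub>v y = x"
      using p[of "0\<^sub>v ?n" v x] x n by (intro bexI[of _ "0\<^sub>v ?n @\<^sub>v x"]) auto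
  next
    fix v assume v: "v \<in> verts Q"
    let ?n = "dimv M v"
    fix y :: "'k vec" assume "y \<in> carrier_vec (dimv ?E v)"
    then have "y = vec_first y ?n @\<^sub>v vec_last y ?n" using n by (simp add: vec_first_last_append)
    then obtain y1 y2 where y: "y = y1 @\<^sub>v y2" "y1 \<in> carrier_vec ?n" "y2 \<in> carrier_vec ?n"
      by (metis vec_first_carrier vec_last_carrier)
    show "?p v *\<^sub>v y = 0\<^sub>v ?n \<longleftrightarrow> (\<exists>x\<in>carrier_vec ?n. y = ?i v *\<^sub>v x)"
    proof
      assume "?p v *\<^sub>v y = 0\<^sub>v ?n"
      then have "y = ?i v *\<^sub>v y1" using p y i by simp
      then show "\<exists>x\<in>carrier_vec ?n. y = ?i v *\<^sub>v x" using y by blast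
    next
      assume "\<exists>x\<in>carrier_vec ?n. y = ?i v *\<^sub>v x"
      then obtain x where "x \<in> carrier_vec ?n" "y = x @\<^sub>v 0\<^sub>v ?n" using i by auto
      then show "?p v *\<^sub>v y = 0\<^sub>v ?n" using p by simp
    qed
  qed
qed

text \<open>A section of the projection has the identity as its lower half. Its upper half is the
  endomorphism sought: the upper rows of the compatibility with a starred arrow say that \<delta> is
  the commutator.\<close>

lemma exceptional_imp_inner:
  fixes M :: "('v, 'a, 'k::field) drep"
  assumes M: "is_Dmod Q M" and ex: "exceptional Q M"
  shows "derivations_inner Q M"
  unfolding derivations_inner_def
proof (intro allI impI)
  fix \<delta> assume d: "is_Dmod Q (M\<lparr>darr := \<delta>\<rparr>)"
  let ?E = "self_ext M \<delta>"
  let ?n = "\<lambda>v. dimv M v"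
  obtain h where h: "is_hom Q M ?E h" "\<And>v. v \<in> verts Q \<Longrightarrow> hcat (0\<^sub>m (?n v) (?n v)) (1\<^sub>m (?n v)) * h v = 1\<^sub>m (?n v)"
    using ex self_ext_Dmod[OF M d] self_ext_exact[OF M d] unfolding exceptional_def by blast
  have "\<exists>X. X \<in> carrier_mat (?n v) (?n v) \<and> h v = X @\<^sub>r 1\<^sub>m (?n v)" if v: "v \<in> verts Q" for v
  proof -
    have "h v \<in> carrier_mat (?n v + ?n v) (?n v)" using homD(1)[OF h(1) v] by (simp add: self_ext_def)
    then obtain X Y where XY: "X \<in> carrier_mat (?n v) (?n v)" "Y \<in> carrier_mat (?n v) (?n v)" "h v = X @\<^sub>r Y"
      by (rule append_rows_split)
    have "Y = 1\<^sub>m (?n v)" using h(2)[OF v] XY by (simp add: hcat_append_rows[OF zero_carrier_mat one_carrier_mat XY(1,2)])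
    then show ?thesis using XY by blast
  qed
  then obtain f where f: "\<And>v. v \<in> verts Q \<Longrightarrow> f v \<in> carrier_mat (?n v) (?n v)"
    "\<And>v. v \<in> verts Q \<Longrightarrow> h v = f v @\<^sub>r 1\<^sub>m (?n v)" by metis
  have "f (tgt Q a) * arr M a = arr M a * f (src Q a) \<and> f (src Q a) * darr M a - darr M a * f (tgt Q a) = \<delta> a"
    if a: "a \<in> arrs Q" for a
  proof
    note c = DmodD(1,2)[OF M a] Dmod_darrD(2)[OF d a]
    note s = src_in[OF a] and t = tgt_in[OF a]
    have "f (tgt Q a) * arr M a @\<^sub>r 1\<^sub>m (?n (tgt Q a)) * arr M a
        = (arr M a * f (src Q a) + 0\<^sub>m (?n (tgt Q a)) (?n (src Q a)) * 1\<^sub>m (?n (src Q a)))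
          @\<^sub>r (0\<^sub>m (?n (tgt Q a)) (?n (src Q a)) * f (src Q a) + arr M a * 1\<^sub>m (?n (src Q a)))"
      using homD(2)[OF h(1) a] unfolding f(2)[OF s] f(2)[OF t] self_ext_def drep.simps
      by (subst (asm) append_rows_mult[OF f(1)[OF t] one_carrier_mat c(1)],
          subst (asm) four_block_append_rows[OF c(1) zero_carrier_mat zero_carrier_mat c(1) f(1)[OF s] one_carrier_mat]) simp_all
    then have "f (tgt Q a) * arr M a = arr M a * f (src Q a) + 0\<^sub>m (?n (tgt Q a)) (?n (src Q a)) * 1\<^sub>m (?n (src Q a))"
      by (rule append_rows_eq(1)[of _ "?n (tgt Q a)" "?n (src Q a)" _ "?n (tgt Q a)", rotated 4])
        (use f(1)[OF s] f(1)[OF t] c in auto)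
    then show "f (tgt Q a) * arr M a = arr M a * f (src Q a)"
      using f(1)[OF s] c by simp
    have "f (src Q a) * darr M a @\<^sub>r 1\<^sub>m (?n (src Q a)) * darr M a
        = (darr M a * f (tgt Q a) + \<delta> a * 1\<^sub>m (?n (tgt Q a)))
          @\<^sub>r (0\<^sub>m (?n (src Q a)) (?n (tgt Q a)) * f (tgt Q a) + darr M a * 1\<^sub>m (?n (tgt Q a)))"
      using homD(3)[OF h(1) a] unfolding f(2)[OF s] f(2)[OF t] self_ext_def drep.simps
      by (subst (asm) append_rows_mult[OF f(1)[OF s] one_carrier_mat c(2)],
          subst (asm) four_block_append_rows[OF c(2) c(3) zero_carrier_mat c(2) f(1)[OF t] one_carrier_mat]) simp_all
    then have "f (src Q a) * darr M a = darr M a * f (tgt Q a) + \<delta> a * 1\<^sub>m (?n (tgt Q a))"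
      by (rule append_rows_eq(1)[of _ "?n (src Q a)" "?n (tgt Q a)" _ "?n (src Q a)", rotated 4])
        (use f(1)[OF s] f(1)[OF t] c in auto)
    then have "f (src Q a) * darr M a = darr M a * f (tgt Q a) + \<delta> a"
      using c by simp
    then show "f (src Q a) * darr M a - darr M a * f (tgt Q a) = \<delta> a"
      using f(1)[OF t] c by (intro eq_matI) auto
  qed
  then show "\<exists>f. is_khom Q M M f \<and> (\<forall>a\<in>arrs Q. f (src Q a) * darr M a - darr M a * f (tgt Q a) = \<delta> a)"
    using f(1) unfolding is_khom_def by blast
qed

end

section \<open>Path bases and the projectivity of delta-filtered modules over
  \<open>kQ\<close>\<close>

definition is_basis :: "nat \<Rightarrow> 'b set \<Rightarrow> ('b \<Rightarrow> 'k::field vec) \<Rightarrow> bool" where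
  "is_basis n S b \<longleftrightarrow> finite S \<and> (\<forall>z\<in>S. b z \<in> carrier_vec n) \<and>
     (\<forall>c. lincomb n S c b = 0\<^sub>v n \<longrightarrow> (\<forall>z\<in>S. c z = 0)) \<and>
     (\<forall>w\<in>carrier_vec n. \<exists>c. lincomb n S c b = w)"

lemma lincomb_index: "i < n \<Longrightarrow> lincomb n S c b $ i = (\<Sum>z\<in>S. c z * b z $ i)"
  by (simp add: lincomb_def)

lemma mult_lincomb:
  fixes H :: "'k::field mat"
  assumes H: "H \<in> carrier_mat m n" and b: "\<And>z. z \<in> S \<Longrightarrow> b z \<in> carrier_vec n"
  shows "H *\<^sub>v lincomb n S c b = lincomb m S c (\<lambda>z. H *\<^sub>v b z)"
proof (rule eq_vecI)
  fix i assume "i < dim_vec (lincomb m S c (\<lambda>z. H *\<^sub>v b z))"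
  then have i: "i < m" by (simp add: lincomb_def)
  have "(H *\<^sub>v lincomb n S c b) $ i = (\<Sum>k = 0..<n. \<Sum>z\<in>S. H $$ (i, k) * (c z * b z $ k))"
    using H i by (simp add: lincomb_def scalar_prod_def sum_distrib_left)
  also have "\<dots> = (\<Sum>z\<in>S. \<Sum>k = 0..<n. H $$ (i, k) * (c z * b z $ k))" by (rule sum.swap)
  also have "\<dots> = (\<Sum>z\<in>S. c z * (H *\<^sub>v b z) $ i)"
  proof (rule sum.cong[OF refl])
    fix z assume "z \<in> S"
    then show "(\<Sum>k = 0..<n. H $$ (i, k) * (c z * b z $ k)) = c z * (H *\<^sub>v b z) $ i"
      using H i b[of z] by (simp add: scalar_prod_def sum_distrib_left mult_ac)
  qed
  finally show "(H *\<^sub>v lincomb n S c b) $ i = lincomb m S c (\<lambda>z. H *\<^sub>v b z) $ i"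
    using i by (simp add: lincomb_def)
qed (use H in \<open>simp add: lincomb_def\<close>)

lemma basis_matrix_unique:
  fixes H :: "'k::field mat"
  assumes H: "H \<in> carrier_mat m n" "H' \<in> carrier_mat m n" and b: "is_basis n S b"
    and eq: "\<And>z. z \<in> S \<Longrightarrow> H *\<^sub>v b z = H' *\<^sub>v b z"
  shows "H = H'"
proof (rule eq_matI)
  fix i j assume "i < dim_row H'" "j < dim_col H'"
  then have ij: "i < m" "j < n" using H by auto
  obtain c where c: "lincomb n S c b = unit_vec n j" using b unfolding is_basis_def by (metis unit_vec_carrier)
  have "H *\<^sub>v lincomb n S c b = H' *\<^sub>v lincomb n S c b"
  proof -
    have bc: "b z \<in> carrier_vec n" if "z \<in> S" for z using b that by (simp add: is_basis_def)
    have "lincomb m S c (\<lambda>z. H *\<^sub>v b z) = lincomb m S c (\<lambda>z. H' *\<^sub>v b z)"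
      using eq by (simp add: lincomb_def)
    then show ?thesis using mult_lincomb[OF H(1) bc, where c = c] mult_lincomb[OF H(2) bc, where c = c] by simp
  qed
  then have "(H *\<^sub>v unit_vec n j) $ i = (H' *\<^sub>v unit_vec n j) $ i" by (simp add: c)
  then show "H $$ (i, j) = H' $$ (i, j)" using ij H by simp
qed (use H in auto)

text \<open>H is built from expansions of the unit vectors in the family b, with b replaced by c.
  Linear independence ensures that the expansion of \<open>b z0\<close> obtained in this way is the
  trivial one.\<close>

lemma basis_matrix_exists:
  fixes c :: "'b \<Rightarrow> 'k::field vec"
  assumes b: "is_basis n S b" and c: "\<And>z. z \<in> S \<Longrightarrow> c z \<in> carrier_vec m"
  shows "\<exists>H\<in>carrier_mat m n. \<forall>z\<in>S. H *\<^sub>v b z = c z"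
proof -
  have "\<exists>k. lincomb n S k b = unit_vec n i" for i
    using b unfolding is_basis_def by (metis unit_vec_carrier)
  then obtain K where K: "\<And>i. lincomb n S (K i) b = unit_vec n i" by metis
  define H where "H = mat m n (\<lambda>(r, i). \<Sum>z\<in>S. K i z * c z $ r)"
  have "H *\<^sub>v b z0 = c z0" if z0: "z0 \<in> S" for z0
  proof -
    \<comment> \<open>The coefficients of \<open>b z0\<close> after expanding it in unit vectors and
      these in the family b.\<close>
    define k where "k z = (\<Sum>i = 0..<n. b z0 $ i * K i z)" for z
    have bc: "b z0 \<in> carrier_vec n" using b z0 by (simp add: is_basis_def)
    have fin: "finite S" using b by (simp add: is_basis_def)
    have "lincomb n S (\<lambda>z. k z - (if z = z0 then 1 else 0)) b = 0\<^sub>v n"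
    proof (rule eq_vecI)
      fix r assume "r < dim_vec (0\<^sub>v n :: 'k vec)"
      then have r: "r < n" by simp
      have "(\<Sum>z\<in>S. k z * b z $ r) = (\<Sum>i = 0..<n. \<Sum>z\<in>S. b z0 $ i * K i z * b z $ r)"
        unfolding k_def sum_distrib_right by (rule sum.swap)
      also have "\<dots> = (\<Sum>i = 0..<n. b z0 $ i * unit_vec n i $ r)"
        using r by (auto simp: K[symmetric] lincomb_index sum_distrib_left mult.assoc intro!: sum.cong)
      also have "\<dots> = (\<Sum>i = 0..<n. if i = r then b z0 $ i else 0)"
        using r by (intro sum.cong) auto
      also have "\<dots> = b z0 $ r" using r by simp
      finally have "(\<Sum>z\<in>S. k z * b z $ r) = b z0 $ r" .
      moreover have "(\<Sum>z\<in>S. (if z = z0 then 1 else 0) * b z $ r) = (\<Sum>z\<in>S. if z = z0 then b z $ r else 0)"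
        by (intro sum.cong) auto
      ultimately show "lincomb n S (\<lambda>z. k z - (if z = z0 then 1 else 0)) b $ r = 0\<^sub>v n $ r"
        using r fin z0 by (simp add: lincomb_index left_diff_distrib sum_subtractf)
    qed (simp add: lincomb_def)
    then have k: "k z = (if z = z0 then 1 else 0)" if "z \<in> S" for z
      using b that unfolding is_basis_def by fastforce
    show ?thesis
    proof (rule eq_vecI)
      fix r assume "r < dim_vec (c z0)"
      then have r: "r < m" using c[OF z0] by simp
      have "(H *\<^sub>v b z0) $ r = (\<Sum>i = 0..<n. \<Sum>z\<in>S. K i z * c z $ r * b z0 $ i)"
        using r bc by (simp add: H_def scalar_prod_def sum_distrib_right)
      also have "\<dots> = (\<Sum>z\<in>S. \<Sum>i = 0..<n. K i z * c z $ r * b z0 $ i)" by (rule sum.swap)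
      also have "\<dots> = (\<Sum>z\<in>S. k z * c z $ r)"
        unfolding k_def sum_distrib_right by (intro sum.cong refl) (simp add: mult_ac)
      also have "\<dots> = (\<Sum>z\<in>S. if z = z0 then c z $ r else 0)"
        using k by (intro sum.cong) auto
      also have "\<dots> = c z0 $ r" using fin z0 by simp
      finally show "(H *\<^sub>v b z0) $ r = c z0 $ r" .
    qed (use c[OF z0] in \<open>simp add: H_def\<close>)
  qed
  then show ?thesis by (intro bexI[of _ H]) (auto simp: H_def)
qed

lemma is_path_snoc: "is_path Q j p (src Q a) \<Longrightarrow> a \<in> arrs Q \<Longrightarrow> is_path Q j (p @ [a]) (tgt Q a)"
  by (induction Q j p "src Q a" rule: is_path.induct) auto

lemma path_act_append: "path_act M (p @ q) x = path_act M q (path_act M p x)"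
  by (induction M p x rule: path_act.induct) auto

definition path_gens :: "('v, 'a) quiver \<Rightarrow> ('v \<Rightarrow> nat) \<Rightarrow> 'v \<Rightarrow> ('v \<times> nat \<times> 'a list) set" where
  "path_gens Q d v = {(j, l, p). j \<in> verts Q \<and> l < d j \<and> is_path Q j p v}"

definition path_vec :: "('v, 'a, 'k::field) drep \<Rightarrow> ('v \<Rightarrow> nat \<Rightarrow> 'k vec) \<Rightarrow> 'v \<times> nat \<times> 'a list \<Rightarrow> 'k vec" where
  "path_vec M x = (\<lambda>(j, l, p). path_act M p (x j l))"

context finite_quiver
begin

lemma path_act_carrier:
  assumes "is_krep Q M"
  shows "is_path Q j p v \<Longrightarrow> x \<in> carrier_vec (dimv M j) \<Longrightarrow> path_act M p x \<in> carrier_vec (dimv M v)"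
proof (induction p arbitrary: j x)
  case (Cons a p)
  then have "arr M a *\<^sub>v x \<in> carrier_vec (dimv M (tgt Q a))"
    using assms unfolding is_krep_def by (auto intro: mult_mat_vec_carrier)
  then show ?case using Cons by auto
qed auto

lemma khom_path_act:
  assumes f: "is_khom Q M N f" and M: "is_krep Q M" and N: "is_krep Q N"
  shows "is_path Q j p v \<Longrightarrow> j \<in> verts Q \<Longrightarrow> x \<in> carrier_vec (dimv M j) \<Longrightarrow>
     f v *\<^sub>v path_act M p x = path_act N p (f j *\<^sub>v x)"
proof (induction p arbitrary: j x)
  case (Cons a p)
  then have a: "a \<in> arrs Q" "src Q a = j" by auto
  have c: "arr M a \<in> carrier_mat (dimv M (tgt Q a)) (dimv M j)" "arr N a \<in> carrier_mat (dimv N (tgt Q a)) (dimv N j)"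
    using M N a unfolding is_krep_def by auto
  note ft = khomD(1)[OF f tgt_in[OF a(1)]] and fs = khomD(1)[OF f Cons.prems(2)]
  have "f v *\<^sub>v path_act M (a # p) x = path_act N p (f (tgt Q a) *\<^sub>v (arr M a *\<^sub>v x))"
    using Cons a c tgt_in[OF a(1)] by (auto intro: mult_mat_vec_carrier)
  also have "f (tgt Q a) *\<^sub>v (arr M a *\<^sub>v x) = (f (tgt Q a) * arr M a) *\<^sub>v x"
    using ft c Cons.prems(3) by (simp add: assoc_mult_mat_vec)
  also have "\<dots> = (arr N a * f j) *\<^sub>v x" using khomD(2)[OF f a(1)] a(2) by simp
  also have "\<dots> = arr N a *\<^sub>v (f j *\<^sub>v x)"
    using fs c Cons.prems(3) by (simp add: assoc_mult_mat_vec)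
  finally show ?case by simp
qed auto

lemma Dmod_krep: "is_Dmod Q M \<Longrightarrow> is_krep Q M"
  unfolding is_Dmod_def is_krep_def by blast

lemma delta_dimE:
  assumes "delta_dim Q M d" and M: "is_krep Q M"
  obtains x where "\<And>j l. j \<in> verts Q \<Longrightarrow> l < d j \<Longrightarrow> x j l \<in> carrier_vec (dimv M j)"
    "\<And>v. v \<in> verts Q \<Longrightarrow> is_basis (dimv M v) (path_gens Q d v) (path_vec M x)"
proof -
  obtain x where x: "\<forall>j\<in>verts Q. \<forall>l<d j. x j l \<in> carrier_vec (dimv M j)"
    and b: "\<forall>v\<in>verts Q. finite (path_gens Q d v)
            \<and> (\<forall>c. lincomb (dimv M v) (path_gens Q d v) c (path_vec M x) = 0\<^sub>v (dimv M v) \<longrightarrow> (\<forall>z\<in>path_gens Q d v. c z = 0))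
            \<and> (\<forall>w\<in>carrier_vec (dimv M v). \<exists>c. lincomb (dimv M v) (path_gens Q d v) c (path_vec M x) = w)"
    using assms(1) unfolding delta_dim_def Let_def path_gens_def[symmetric] path_vec_def[symmetric] by blast
  have "path_vec M x z \<in> carrier_vec (dimv M v)" if "z \<in> path_gens Q d v" for v z
    using that x path_act_carrier[OF M] by (auto simp: path_gens_def path_vec_def)
  then show ?thesis using that x b unfolding is_basis_def by blast
qed

text \<open>The universal property of a sum of modules \<Delta>(j). Images of generators determine
  the images of the path basis, and compatibility with an arrow can be checked there, because
  appending the arrow to a path gives again a path.\<close>

lemma khom_extend:
  fixes M N :: "('v, 'a, 'k::field) drep"
  assumes M: "is_krep Q M" and N: "is_krep Q N"
    and x: "\<And>j l. j \<in> verts Q \<Longrightarrow> l < d j \<Longrightarrow> x j l \<in> carrier_vec (dimv M j)"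
    and b: "\<And>v. v \<in> verts Q \<Longrightarrow> is_basis (dimv M v) (path_gens Q d v) (path_vec M x)"
    and y: "\<And>j l. j \<in> verts Q \<Longrightarrow> l < d j \<Longrightarrow> y j l \<in> carrier_vec (dimv N j)"
  obtains f where "is_khom Q M N f"
    "\<And>v z. v \<in> verts Q \<Longrightarrow> z \<in> path_gens Q d v \<Longrightarrow> f v *\<^sub>v path_vec M x z = path_vec N y z"
proof -
  have "\<forall>v\<in>verts Q. \<exists>H. H \<in> carrier_mat (dimv N v) (dimv M v) \<and> (\<forall>z\<in>path_gens Q d v. H *\<^sub>v path_vec M x z = path_vec N y z)"
  proof
    fix v assume v: "v \<in> verts Q"
    have "path_vec N y z \<in> carrier_vec (dimv N v)" if "z \<in> path_gens Q d v" for z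
      using that y path_act_carrier[OF N] by (auto simp: path_gens_def path_vec_def)
    then show "\<exists>H. H \<in> carrier_mat (dimv N v) (dimv M v) \<and> (\<forall>z\<in>path_gens Q d v. H *\<^sub>v path_vec M x z = path_vec N y z)"
      using basis_matrix_exists[OF b[OF v], of "path_vec N y" "dimv N v"] by blast
  qed
  then obtain f where f: "\<And>v. v \<in> verts Q \<Longrightarrow> f v \<in> carrier_mat (dimv N v) (dimv M v)"
     "\<And>v z. v \<in> verts Q \<Longrightarrow> z \<in> path_gens Q d v \<Longrightarrow> f v *\<^sub>v path_vec M x z = path_vec N y z"
    by (auto dest!: bchoice)
  have "f (tgt Q a) * arr M a = arr N a * f (src Q a)" if a: "a \<in> arrs Q" for a
  proof (rule basis_matrix_unique[OF _ _ b[OF src_in[OF a]]])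
    note s = src_in[OF a] and t = tgt_in[OF a]
    have c: "arr M a \<in> carrier_mat (dimv M (tgt Q a)) (dimv M (src Q a))" "arr N a \<in> carrier_mat (dimv N (tgt Q a)) (dimv N (src Q a))"
      using M N a unfolding is_krep_def by auto
    show "f (tgt Q a) * arr M a \<in> carrier_mat (dimv N (tgt Q a)) (dimv M (src Q a))"
      "arr N a * f (src Q a) \<in> carrier_mat (dimv N (tgt Q a)) (dimv M (src Q a))"
      using f(1)[OF s] f(1)[OF t] c by auto
    fix z assume z: "z \<in> path_gens Q d (src Q a)"
    obtain j l p where jlp: "z = (j, l, p)" by (cases z)
    have z': "(j, l, p @ [a]) \<in> path_gens Q d (tgt Q a)"
      using z a is_path_snoc by (auto simp: path_gens_def jlp)
    have pv: "path_vec K w (j, l, p @ [a]) = arr K a *\<^sub>v path_vec K w z" for K :: "('v, 'a, 'k) drep" and w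
      by (simp add: path_vec_def path_act_append jlp)
    have xc: "path_vec M x z \<in> carrier_vec (dimv M (src Q a))" using b[OF s] z by (simp add: is_basis_def)
    have "(f (tgt Q a) * arr M a) *\<^sub>v path_vec M x z = f (tgt Q a) *\<^sub>v path_vec M x (j, l, p @ [a])"
      using f(1)[OF t] c xc by (simp add: pv assoc_mult_mat_vec)
    also have "\<dots> = arr N a *\<^sub>v (f (src Q a) *\<^sub>v path_vec M x z)"
      using f(2)[OF t z'] f(2)[OF s z] by (simp add: pv)
    also have "\<dots> = (arr N a * f (src Q a)) *\<^sub>v path_vec M x z"
      using f(1)[OF s] c xc by (simp add: assoc_mult_mat_vec)
    finally show "(f (tgt Q a) * arr M a) *\<^sub>v path_vec M x z = (arr N a * f (src Q a)) *\<^sub>v path_vec M x z" .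
  qed
  then show ?thesis using that f unfolding is_khom_def by blast
qed

text \<open>Generators are sent to generators in both directions, so both composites fix a path
  basis.\<close>

lemma delta_dim_khom_iso:
  fixes M N :: "('v, 'a, 'k::field) drep"
  assumes M: "is_krep Q M" "delta_dim Q M d" and N: "is_krep Q N" "delta_dim Q N d"
  obtains f g where "is_khom Q M N f" "is_khom Q N M g"
    "\<And>v. v \<in> verts Q \<Longrightarrow> g v * f v = 1\<^sub>m (dimv M v)" "\<And>v. v \<in> verts Q \<Longrightarrow> f v * g v = 1\<^sub>m (dimv N v)"
proof -
  obtain x where x: "\<And>j l. j \<in> verts Q \<Longrightarrow> l < d j \<Longrightarrow> x j l \<in> carrier_vec (dimv M j)"
    "\<And>v. v \<in> verts Q \<Longrightarrow> is_basis (dimv M v) (path_gens Q d v) (path_vec M x)"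
    by (rule delta_dimE[OF M(2,1)]) blast
  obtain y where y: "\<And>j l. j \<in> verts Q \<Longrightarrow> l < d j \<Longrightarrow> y j l \<in> carrier_vec (dimv N j)"
    "\<And>v. v \<in> verts Q \<Longrightarrow> is_basis (dimv N v) (path_gens Q d v) (path_vec N y)"
    by (rule delta_dimE[OF N(2,1)]) blast
  obtain f where f: "is_khom Q M N f"
    "\<And>v z. v \<in> verts Q \<Longrightarrow> z \<in> path_gens Q d v \<Longrightarrow> f v *\<^sub>v path_vec M x z = path_vec N y z"
    by (rule khom_extend[OF M(1) N(1) x y(1)]) blast+
  obtain g where g: "is_khom Q N M g"
    "\<And>v z. v \<in> verts Q \<Longrightarrow> z \<in> path_gens Q d v \<Longrightarrow> g v *\<^sub>v path_vec N y z = path_vec M x z"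
    by (rule khom_extend[OF N(1) M(1) y x(1)]) blast+
  have "g v * f v = 1\<^sub>m (dimv M v)" if v: "v \<in> verts Q" for v
  proof (rule basis_matrix_unique[OF _ _ x(2)[OF v]])
    show "g v * f v \<in> carrier_mat (dimv M v) (dimv M v)" using khomD(1)[OF f(1) v] khomD(1)[OF g(1) v] by auto
    fix z assume z: "z \<in> path_gens Q d v"
    then have c: "path_vec M x z \<in> carrier_vec (dimv M v)" using x(2)[OF v] by (simp add: is_basis_def)
    show "(g v * f v) *\<^sub>v path_vec M x z = 1\<^sub>m (dimv M v) *\<^sub>v path_vec M x z"
      using assoc_mult_mat_vec[OF khomD(1)[OF g(1) v] khomD(1)[OF f(1) v] c] f(2)[OF v z] g(2)[OF v z] c by simp
  qed auto
  moreover have "f v * g v = 1\<^sub>m (dimv N v)" if v: "v \<in> verts Q" for v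
  proof (rule basis_matrix_unique[OF _ _ y(2)[OF v]])
    show "f v * g v \<in> carrier_mat (dimv N v) (dimv N v)" using khomD(1)[OF f(1) v] khomD(1)[OF g(1) v] by auto
    fix z assume z: "z \<in> path_gens Q d v"
    then have c: "path_vec N y z \<in> carrier_vec (dimv N v)" using y(2)[OF v] by (simp add: is_basis_def)
    show "(f v * g v) *\<^sub>v path_vec N y z = 1\<^sub>m (dimv N v) *\<^sub>v path_vec N y z"
      using assoc_mult_mat_vec[OF khomD(1)[OF f(1) v] khomD(1)[OF g(1) v] c] f(2)[OF v z] g(2)[OF v z] c by simp
  qed auto
  ultimately show ?thesis using that f(1) g(1) by blast
qed

text \<open>Projectivity: the generators are lifted through g, and the lifts extend to a morphism h.
  The composite with g agrees with the identity on the path basis.\<close>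

lemma khom_split:
  fixes M E :: "('v, 'a, 'k::field) drep"
  assumes M: "is_krep Q M" "delta_dim Q M d" and E: "is_krep Q E" and g: "is_khom Q E M g"
    and surj: "\<And>v y. v \<in> verts Q \<Longrightarrow> y \<in> carrier_vec (dimv M v) \<Longrightarrow> \<exists>x\<in>carrier_vec (dimv E v). g v *\<^sub>v x = y"
  shows "\<exists>h. is_khom Q M E h \<and> (\<forall>v\<in>verts Q. g v * h v = 1\<^sub>m (dimv M v))"
proof -
  obtain x where x: "\<And>j l. j \<in> verts Q \<Longrightarrow> l < d j \<Longrightarrow> x j l \<in> carrier_vec (dimv M j)"
    "\<And>v. v \<in> verts Q \<Longrightarrow> is_basis (dimv M v) (path_gens Q d v) (path_vec M x)"
    by (rule delta_dimE[OF M(2,1)]) blast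
  define y where "y j l = (SOME w. w \<in> carrier_vec (dimv E j) \<and> g j *\<^sub>v w = x j l)" for j l
  have y: "y j l \<in> carrier_vec (dimv E j) \<and> g j *\<^sub>v y j l = x j l" if "j \<in> verts Q" "l < d j" for j l
    unfolding y_def by (rule someI_ex) (use surj[OF that(1) x(1)[OF that]] in blast)
  obtain h where h: "is_khom Q M E h"
    "\<And>v z. v \<in> verts Q \<Longrightarrow> z \<in> path_gens Q d v \<Longrightarrow> h v *\<^sub>v path_vec M x z = path_vec E y z"
    by (rule khom_extend[OF M(1) E x, of y]) (use y in blast)+
  have "g v * h v = 1\<^sub>m (dimv M v)" if v: "v \<in> verts Q" for v
  proof (rule basis_matrix_unique[OF _ _ x(2)[OF v]])
    show "g v * h v \<in> carrier_mat (dimv M v) (dimv M v)" using khomD(1)[OF h(1) v] khomD(1)[OF g(1) v] by auto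
    fix z assume z: "z \<in> path_gens Q d v"
    then obtain j l p where jlp: "z = (j, l, p)" "j \<in> verts Q" "l < d j" "is_path Q j p v"
      by (auto simp: path_gens_def)
    have c: "path_vec M x z \<in> carrier_vec (dimv M v)" using x(2)[OF v] z by (simp add: is_basis_def)
    have "g v *\<^sub>v path_vec E y z = path_vec M x z"
      using khom_path_act[OF g E M(1) jlp(4,2), of "y j l"] y[OF jlp(2,3)] by (simp add: path_vec_def jlp(1))
    then show "(g v * h v) *\<^sub>v path_vec M x z = 1\<^sub>m (dimv M v) *\<^sub>v path_vec M x z"
      using assoc_mult_mat_vec[OF khomD(1)[OF g(1) v] khomD(1)[OF h(1) v] c] h(2)[OF v z] c by simp
  qed auto
  then show ?thesis using h(1) by blast
qed

end

lemma mat_cancel_left: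
  fixes F :: "'k::field mat"
  assumes F: "F \<in> carrier_mat m n" and inj: "\<And>x. x \<in> carrier_vec n \<Longrightarrow> F *\<^sub>v x = 0\<^sub>v m \<Longrightarrow> x = 0\<^sub>v n"
    and X: "X \<in> carrier_mat n k" and Y: "Y \<in> carrier_mat n k" and eq: "F * X = F * Y"
  shows "X = Y"
proof (rule mat_col_eqI)
  fix j assume "j < dim_col Y"
  then have j: "j < k" using Y by simp
  have c: "col X j \<in> carrier_vec n" "col Y j \<in> carrier_vec n" using X Y by auto
  have "F *\<^sub>v col X j = F *\<^sub>v col Y j"
    using arg_cong[OF eq, of "\<lambda>A. col A j"] col_mult2[OF F X j] col_mult2[OF F Y j] by simp
  then have "F *\<^sub>v (col X j - col Y j) = 0\<^sub>v m"
    using mult_minus_distrib_mat_vec[OF F c] F c by auto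
  then have 0: "col X j - col Y j = 0\<^sub>v n" using inj c by auto
  show "col X j = col Y j"
  proof (rule eq_vecI)
    fix i assume "i < dim_vec (col Y j)"
    then have "i < n" using Y by simp
    then show "col X j $ i = col Y j $ i" using arg_cong[OF 0, of "\<lambda>v. v $ i"] X Y j by simp
  qed (use X Y in auto)
qed (use X Y in auto)

lemma mat_diff_exchange:
  fixes A B C D :: "'k::field mat"
  assumes "A \<in> carrier_mat m n" "B \<in> carrier_mat m n" "C \<in> carrier_mat m n" "D \<in> carrier_mat m n"
    and eq: "B - D = A - C"
  shows "A - B = C - D"
proof (rule eq_matI)
  fix i j assume "i < dim_row (C - D)" "j < dim_col (C - D)"
  then have "i < m" "j < n" using assms by auto
  then show "(A - B) $$ (i, j) = (C - D) $$ (i, j)"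
    using arg_cong[OF eq, of "\<lambda>X. X $$ (i, j)"] assms(1-4) by (simp add: algebra_simps)
qed (use assms in auto)

lemma mat_factor:
  fixes F :: "'k::field mat"
  assumes F: "F \<in> carrier_mat m n" and X: "X \<in> carrier_mat m k"
    and ex: "\<And>j. j < k \<Longrightarrow> \<exists>x\<in>carrier_vec n. col X j = F *\<^sub>v x"
  shows "\<exists>D\<in>carrier_mat n k. F * D = X"
proof -
  have "\<forall>j\<in>{..<k}. \<exists>x. x \<in> carrier_vec n \<and> col X j = F *\<^sub>v x" using ex by blast
  from bchoice[OF this] obtain w where w: "\<And>j. j < k \<Longrightarrow> w j \<in> carrier_vec n \<and> col X j = F *\<^sub>v w j" by auto
  define D where "D = mat n k (\<lambda>(i, j). w j $ i)"
  have D: "D \<in> carrier_mat n k" by (simp add: D_def)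
  have "F * D = X"
  proof (rule mat_col_eqI)
    fix j assume "j < dim_col X"
    then have j: "j < k" using X by simp
    have "col D j = w j" using w[OF j] j by (auto simp: D_def intro!: eq_vecI)
    then show "col (F * D) j = col X j" using col_mult2[OF F D j] w[OF j] by simp
  qed (use F X D in auto)
  then show ?thesis using D by blast
qed

section \<open>From inner derivations to vanishing extensions; transport along isomorphisms\<close>

context finite_quiver
begin

text \<open>Projectivity gives a section h over \<open>kQ\<close>. Its defect \<epsilon> against the
  starred arrows is killed by g, hence equals f \<delta> for a unique family \<delta>, which turns
  out to be a derivation of M. If u realises \<delta> as a commutator, then h - f u also commutes
  with the starred arrows, and it is still a section because g f = 0.\<close>

lemma inner_imp_exceptional:
  fixes M :: "('v, 'a, 'k::field) drep"
  assumes M: "is_Dmod Q M" "delta_dim Q M d" and inner: "derivations_inner Q M"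
  shows "exceptional Q M"
  unfolding exceptional_def
proof (intro allI impI)
  fix E f g assume "is_Dmod Q E \<and> short_exact Q M E M f g"
  then have E: "is_Dmod Q E" and f: "is_hom Q M E f" and g: "is_hom Q E M g"
    and inj: "\<And>v x. v \<in> verts Q \<Longrightarrow> x \<in> carrier_vec (dimv M v) \<Longrightarrow> f v *\<^sub>v x = 0\<^sub>v (dimv E v) \<Longrightarrow> x = 0\<^sub>v (dimv M v)"
    and surj: "\<And>v y. v \<in> verts Q \<Longrightarrow> y \<in> carrier_vec (dimv M v) \<Longrightarrow> \<exists>x\<in>carrier_vec (dimv E v). g v *\<^sub>v x = y"
    and exact: "\<And>v y. v \<in> verts Q \<Longrightarrow> y \<in> carrier_vec (dimv E v) \<Longrightarrow>
            g v *\<^sub>v y = 0\<^sub>v (dimv M v) \<longleftrightarrow> (\<exists>x\<in>carrier_vec (dimv M v). y = f v *\<^sub>v x)"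
    unfolding short_exact_def by blast+
  note ME = DmodD(1,2)[OF M(1)] DmodD(1,2)[OF E]
  have gk: "is_khom Q E M g" using g unfolding is_hom_def is_khom_def by blast
  obtain h where h: "is_khom Q M E h" "\<And>v. v \<in> verts Q \<Longrightarrow> g v * h v = 1\<^sub>m (dimv M v)"
    using khom_split[OF Dmod_krep[OF M(1)] M(2) Dmod_krep[OF E] gk surj] by blast
  have gf: "g v * f v = 0\<^sub>m (dimv M v) (dimv M v)" if v: "v \<in> verts Q" for v
  proof (rule mat_col_eqI)
    note c = homD(1)[OF f v] homD(1)[OF g v]
    fix j assume "j < dim_col (0\<^sub>m (dimv M v) (dimv M v) :: 'k mat)"
    then have j: "j < dimv M v" by simp
    have u: "f v *\<^sub>v unit_vec (dimv M v) j \<in> carrier_vec (dimv E v)"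
      using c by (auto intro: mult_mat_vec_carrier)
    have "g v *\<^sub>v (f v *\<^sub>v unit_vec (dimv M v) j) = 0\<^sub>v (dimv M v)"
      using exact[OF v u] by (metis unit_vec_carrier)
    moreover have "f v *\<^sub>v unit_vec (dimv M v) j = col (f v) j"
      using c(1) j by (intro eq_vecI) auto
    ultimately show "col (g v * f v) j = col (0\<^sub>m (dimv M v) (dimv M v)) j"
      using col_mult2[OF c(2,1) j] j by simp
  qed (use homD(1)[OF f v] homD(1)[OF g v] in auto)
  define \<epsilon> where "\<epsilon> a = h (src Q a) * darr M a - darr E a * h (tgt Q a)" for a
  have e: "\<epsilon> a \<in> carrier_mat (dimv E (src Q a)) (dimv M (tgt Q a))" if a: "a \<in> arrs Q" for a
    using ME[OF a] khomD(1)[OF h(1) src_in[OF a]] khomD(1)[OF h(1) tgt_in[OF a]] by (auto simp: \<epsilon>_def)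
  have "\<exists>\<delta>. \<delta> \<in> carrier_mat (dimv M (src Q a)) (dimv M (tgt Q a)) \<and> f (src Q a) * \<delta> = \<epsilon> a"
    if a: "a \<in> arrs Q" for a
  proof -
    note s = src_in[OF a] and t = tgt_in[OF a]
    note c = ME[OF a] khomD(1)[OF h(1) s] khomD(1)[OF h(1) t] homD(1)[OF g s] homD(1)[OF g t]
    have 1: "g (src Q a) * (h (src Q a) * darr M a) = darr M a"
      using assoc_mult_mat[OF c(7,5,2)] h(2)[OF s] c(2) by simp
    have "g (src Q a) * (darr E a * h (tgt Q a)) = (darr M a * g (tgt Q a)) * h (tgt Q a)"
      using assoc_mult_mat[OF c(7,4,6)] homD(3)[OF g a] by simp
    also have "\<dots> = darr M a" using assoc_mult_mat[OF c(2,8,6)] h(2)[OF t] c(2) by simp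
    finally have 2: "g (src Q a) * (darr E a * h (tgt Q a)) = darr M a" .
    have "g (src Q a) * \<epsilon> a = 0\<^sub>m (dimv M (src Q a)) (dimv M (tgt Q a))"
      unfolding \<epsilon>_def using mult_minus_distrib_mat[OF c(7) mult_carrier_mat[OF c(5,2)] mult_carrier_mat[OF c(4,6)]] 1 2 c(2)
      by simp
    then have "g (src Q a) *\<^sub>v col (\<epsilon> a) j = 0\<^sub>v (dimv M (src Q a))" if "j < dimv M (tgt Q a)" for j
      using col_mult2[OF c(7) e[OF a] that] that by simp
    then have "\<exists>x\<in>carrier_vec (dimv M (src Q a)). col (\<epsilon> a) j = f (src Q a) *\<^sub>v x" if "j < dimv M (tgt Q a)" for j
      using exact[OF s, of "col (\<epsilon> a) j"] e[OF a] that by auto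
    then show ?thesis using mat_factor[OF homD(1)[OF f s] e[OF a]] by blast
  qed
  then have "\<forall>a\<in>arrs Q. \<exists>\<delta>. \<delta> \<in> carrier_mat (dimv M (src Q a)) (dimv M (tgt Q a)) \<and> f (src Q a) * \<delta> = \<epsilon> a"
    by blast
  from bchoice[OF this] obtain \<delta> where d: "\<And>a. a \<in> arrs Q \<Longrightarrow> \<delta> a \<in> carrier_mat (dimv M (src Q a)) (dimv M (tgt Q a))"
    "\<And>a. a \<in> arrs Q \<Longrightarrow> f (src Q a) * \<delta> a = \<epsilon> a" by blast
  \<comment> \<open>Moving h past the unstarred arrow leaves only composites to which the relations
    of M and of E apply.\<close>
  have ea: "\<epsilon> b * arr M a = h (src Q b) * (darr M b * arr M a) - (darr E b * arr E a) * h (src Q a)"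
    if a: "a \<in> arrs Q" and b: "b \<in> arrs Q" and ab: "tgt Q b = tgt Q a" for a b
  proof -
    note ca = ME[OF a] khomD(1)[OF h(1) src_in[OF a]] khomD(1)[OF h(1) tgt_in[OF a]]
    note cb = ME[OF b, unfolded ab] khomD(1)[OF h(1) src_in[OF b]]
    have "\<epsilon> b * arr M a = h (src Q b) * darr M b * arr M a - darr E b * h (tgt Q a) * arr M a"
      unfolding \<epsilon>_def ab
      by (rule minus_mult_distrib_mat[OF mult_carrier_mat[OF cb(5,2)] mult_carrier_mat[OF cb(4) ca(6)] ca(1)])
    also have "h (src Q b) * darr M b * arr M a = h (src Q b) * (darr M b * arr M a)"
      by (rule assoc_mult_mat[OF cb(5,2) ca(1)])
    also have "darr E b * h (tgt Q a) * arr M a = darr E b * (h (tgt Q a) * arr M a)"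
      by (rule assoc_mult_mat[OF cb(4) ca(6,1)])
    also have "\<dots> = darr E b * arr E a * h (src Q a)"
      unfolding khomD(2)[OF h(1) a] by (rule assoc_mult_mat[OF cb(4) ca(3,5), symmetric])
    finally show ?thesis .
  qed
  have "is_Dmod Q (M\<lparr>darr := \<delta>\<rparr>)"
    unfolding is_Dmod_def
  proof (intro conjI ballI impI)
    fix a assume a: "a \<in> arrs Q"
    show "arr (M\<lparr>darr := \<delta>\<rparr>) a \<in> carrier_mat (dimv (M\<lparr>darr := \<delta>\<rparr>) (tgt Q a)) (dimv (M\<lparr>darr := \<delta>\<rparr>) (src Q a))"
      "darr (M\<lparr>darr := \<delta>\<rparr>) a \<in> carrier_mat (dimv (M\<lparr>darr := \<delta>\<rparr>) (src Q a)) (dimv (M\<lparr>darr := \<delta>\<rparr>) (tgt Q a))"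
      using ME(1)[OF a] d(1)[OF a] by auto
    note s = src_in[OF a] and t = tgt_in[OF a]
    let ?S = "{g \<in> arrs Q. tgt Q g = src Q a}"
    let ?n = "dimv M (src Q a)" and ?e = "dimv E (src Q a)"
    note c = ME[OF a] khomD(1)[OF h(1) s] homD(1)[OF f s]
    have gc: "arr M b * darr M b \<in> carrier_mat ?n ?n" "arr E b * darr E b \<in> carrier_mat ?e ?e"
       "arr M b * \<delta> b \<in> carrier_mat ?n ?n"
       "h (src Q a) * (arr M b * darr M b) \<in> carrier_mat ?e ?n" "arr E b * darr E b * h (src Q a) \<in> carrier_mat ?e ?n"
       "h (src Q a) * (arr M b * darr M b) - arr E b * darr E b * h (src Q a) = f (src Q a) * (arr M b * \<delta> b)"
      if "b \<in> ?S" for b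
    proof -
      from that have b: "b \<in> arrs Q" and ba: "tgt Q b = src Q a" by auto
      note cb = ME[OF b, unfolded ba] khomD(1)[OF h(1) src_in[OF b]] homD(1)[OF f src_in[OF b]] d(1)[OF b, unfolded ba]
      show 1: "arr M b * darr M b \<in> carrier_mat ?n ?n" "arr E b * darr E b \<in> carrier_mat ?e ?e"
       "arr M b * \<delta> b \<in> carrier_mat ?n ?n"
        using mult_carrier_mat[OF cb(1,2)] mult_carrier_mat[OF cb(3,4)] mult_carrier_mat[OF cb(1,7)] by auto
      show "h (src Q a) * (arr M b * darr M b) \<in> carrier_mat ?e ?n" "arr E b * darr E b * h (src Q a) \<in> carrier_mat ?e ?n"
        using mult_carrier_mat[OF c(5) 1(1)] mult_carrier_mat[OF 1(2) c(5)] by auto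
      have "h (src Q a) * (arr M b * darr M b) = h (src Q a) * arr M b * darr M b"
        by (rule assoc_mult_mat[OF c(5) cb(1,2), symmetric])
      also have "\<dots> = arr E b * (h (src Q b) * darr M b)"
        using khomD(2)[OF h(1) b] assoc_mult_mat[OF cb(3,5,2)] by (simp add: ba)
      finally have 2: "h (src Q a) * (arr M b * darr M b) = arr E b * (h (src Q b) * darr M b)" .
      have 3: "arr E b * darr E b * h (src Q a) = arr E b * (darr E b * h (src Q a))"
        by (rule assoc_mult_mat[OF cb(3,4) c(5)])
      have "h (src Q a) * (arr M b * darr M b) - arr E b * darr E b * h (src Q a) = arr E b * \<epsilon> b"
        unfolding 2 3 \<epsilon>_def ba
        by (rule mult_minus_distrib_mat[OF cb(3) mult_carrier_mat[OF cb(5,2)] mult_carrier_mat[OF cb(4) c(5)], symmetric])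
      also have "\<dots> = arr E b * f (src Q b) * \<delta> b"
        unfolding d(2)[OF b, symmetric] by (rule assoc_mult_mat[OF cb(3,6,7), symmetric])
      also have "\<dots> = f (src Q a) * arr M b * \<delta> b" using homD(2)[OF f b] by (simp add: ba)
      also have "\<dots> = f (src Q a) * (arr M b * \<delta> b)" by (rule assoc_mult_mat[OF c(6) cb(1,7)])
      finally show "h (src Q a) * (arr M b * darr M b) - arr E b * darr E b * h (src Q a) = f (src Q a) * (arr M b * \<delta> b)" .
    qed
    have 1: "h (src Q a) * msum ?n ?n ?S (\<lambda>b. arr M b * darr M b) = msum ?e ?n ?S (\<lambda>b. h (src Q a) * (arr M b * darr M b))"
      by (rule mult_msum[OF c(5)]) (use gc in blast)
    have 2: "msum ?e ?e ?S (\<lambda>b. arr E b * darr E b) * h (src Q a) = msum ?e ?n ?S (\<lambda>b. arr E b * darr E b * h (src Q a))"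
      by (rule msum_mult[OF c(5)]) (use gc in blast)
    \<comment> \<open>The relation for \<delta> is derived after composing with f, where it becomes
      a statement about h, M and E; injectivity of f then cancels it.\<close>
    have "f (src Q a) * (\<delta> a * arr M a) = \<epsilon> a * arr M a"
      using assoc_mult_mat[OF c(6) d(1)[OF a] c(1)] d(2)[OF a] by simp
    also have "\<dots> = h (src Q a) * msum ?n ?n ?S (\<lambda>b. arr M b * darr M b) - msum ?e ?e ?S (\<lambda>b. arr E b * darr E b) * h (src Q a)"
      using ea[OF a a refl] DmodD(3)[OF M(1) a] DmodD(3)[OF E a] by simp
    also have "\<dots> = msum ?e ?n ?S (\<lambda>b. h (src Q a) * (arr M b * darr M b)) - msum ?e ?n ?S (\<lambda>b. arr E b * darr E b * h (src Q a))"
      unfolding 1 2 ..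
    also have "\<dots> = msum ?e ?n ?S (\<lambda>b. h (src Q a) * (arr M b * darr M b) - arr E b * darr E b * h (src Q a))"
      by (rule msum_diff[symmetric]) (use gc in blast)+
    also have "\<dots> = msum ?e ?n ?S (\<lambda>b. f (src Q a) * (arr M b * \<delta> b))"
      by (rule msum_cong) (use gc in blast)
    also have "\<dots> = f (src Q a) * msum ?n ?n ?S (\<lambda>b. arr M b * \<delta> b)"
      by (rule mult_msum[OF c(6), symmetric]) (use gc in blast)
    finally have eq: "f (src Q a) * (\<delta> a * arr M a) = f (src Q a) * msum ?n ?n ?S (\<lambda>b. arr M b * \<delta> b)" .
    have "\<delta> a * arr M a = msum ?n ?n ?S (\<lambda>b. arr M b * \<delta> b)"
      by (rule mat_cancel_left[OF c(6) _ mult_carrier_mat[OF d(1)[OF a] c(1)] msum_carrier eq]) (rule inj[OF s])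
    then show "darr (M\<lparr>darr := \<delta>\<rparr>) a * arr (M\<lparr>darr := \<delta>\<rparr>) a =
        msum (dimv (M\<lparr>darr := \<delta>\<rparr>) (src Q a)) (dimv (M\<lparr>darr := \<delta>\<rparr>) (src Q a)) ?S (\<lambda>b. arr (M\<lparr>darr := \<delta>\<rparr>) b * darr (M\<lparr>darr := \<delta>\<rparr>) b)"
      by simp
  next
    fix a b assume a: "a \<in> arrs Q" and b: "b \<in> arrs Q" and ab: "a \<noteq> b \<and> tgt Q a = tgt Q b"
    then have ba: "tgt Q b = tgt Q a" by simp
    note s = src_in[OF b]
    note c = ME(1)[OF a] d(1)[OF b, unfolded ba] homD(1)[OF f s] khomD(1)[OF h(1) s] khomD(1)[OF h(1) src_in[OF a]]
    have "f (src Q b) * (\<delta> b * arr M a) = \<epsilon> b * arr M a"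
      using assoc_mult_mat[OF c(3,2,1)] d(2)[OF b] by simp
    also have "\<dots> = f (src Q b) * 0\<^sub>m (dimv M (src Q b)) (dimv M (src Q a))"
      using ea[OF a b ba] DmodD(4)[OF M(1) a b] DmodD(4)[OF E a b] ab c by simp
    finally have eq: "f (src Q b) * (\<delta> b * arr M a) = f (src Q b) * 0\<^sub>m (dimv M (src Q b)) (dimv M (src Q a))" .
    have "\<delta> b * arr M a = 0\<^sub>m (dimv M (src Q b)) (dimv M (src Q a))"
      by (rule mat_cancel_left[OF c(3) _ mult_carrier_mat[OF c(2,1)] zero_carrier_mat eq]) (rule inj[OF s])
    then show "darr (M\<lparr>darr := \<delta>\<rparr>) b * arr (M\<lparr>darr := \<delta>\<rparr>) a = 0\<^sub>m (dimv (M\<lparr>darr := \<delta>\<rparr>) (src Q b)) (dimv (M\<lparr>darr := \<delta>\<rparr>) (src Q a))"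
      by simp
  qed
  then obtain u where u: "is_khom Q M M u" "\<And>a. a \<in> arrs Q \<Longrightarrow> u (src Q a) * darr M a - darr M a * u (tgt Q a) = \<delta> a"
    using inner unfolding derivations_inner_def by blast
  let ?h = "\<lambda>v. h v - f v * u v"
  have "g v * ?h v = 1\<^sub>m (dimv M v)" if v: "v \<in> verts Q" for v
  proof -
    note c = homD(1)[OF g v] khomD(1)[OF h(1) v] homD(1)[OF f v] khomD(1)[OF u(1) v]
    have "g v * ?h v = g v * h v - g v * (f v * u v)"
      by (rule mult_minus_distrib_mat[OF c(1,2) mult_carrier_mat[OF c(3,4)]])
    also have "g v * (f v * u v) = 0\<^sub>m (dimv M v) (dimv M v)"
      using assoc_mult_mat[OF c(1,3,4)] gf[OF v] c(4) by simp
    finally show ?thesis using h(2)[OF v] by auto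
  qed
  moreover have "is_hom Q M E ?h"
    unfolding is_hom_def
  proof (intro conjI ballI)
    fix v assume v: "v \<in> verts Q"
    show "?h v \<in> carrier_mat (dimv E v) (dimv M v)"
      using khomD(1)[OF h(1) v] homD(1)[OF f v] khomD(1)[OF u(1) v] by auto
  next
    fix a assume a: "a \<in> arrs Q"
    note s = src_in[OF a] and t = tgt_in[OF a]
    note c = ME[OF a]
    note hs = khomD(1)[OF h(1) s] and ht = khomD(1)[OF h(1) t] and fs = homD(1)[OF f s] and ft = homD(1)[OF f t]
      and us = khomD(1)[OF u(1) s] and ut = khomD(1)[OF u(1) t]
    have "f (tgt Q a) * u (tgt Q a) * arr M a = f (tgt Q a) * (arr M a * u (src Q a))"
      using assoc_mult_mat[OF ft ut c(1)] khomD(2)[OF u(1) a] by simp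
    also have "\<dots> = arr E a * (f (src Q a) * u (src Q a))"
      using assoc_mult_mat[OF ft c(1) us] assoc_mult_mat[OF c(3) fs us] homD(2)[OF f a] by simp
    finally show "?h (tgt Q a) * arr M a = arr E a * ?h (src Q a)"
      using minus_mult_distrib_mat[OF ht mult_carrier_mat[OF ft ut] c(1)]
        mult_minus_distrib_mat[OF c(3) hs mult_carrier_mat[OF fs us]] khomD(2)[OF h(1) a] by simp
    have 1: "f (src Q a) * u (src Q a) * darr M a - darr E a * (f (tgt Q a) * u (tgt Q a)) = h (src Q a) * darr M a - darr E a * h (tgt Q a)"
    proof -
      have "darr E a * (f (tgt Q a) * u (tgt Q a)) = f (src Q a) * (darr M a * u (tgt Q a))"
        using assoc_mult_mat[OF c(4) ft ut] assoc_mult_mat[OF fs c(2) ut] homD(3)[OF f a] by simp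
      then have "f (src Q a) * u (src Q a) * darr M a - darr E a * (f (tgt Q a) * u (tgt Q a)) =
          f (src Q a) * (u (src Q a) * darr M a - darr M a * u (tgt Q a))"
        using assoc_mult_mat[OF fs us c(2)] mult_minus_distrib_mat[OF fs mult_carrier_mat[OF us c(2)] mult_carrier_mat[OF c(2) ut]]
        by simp
      then show ?thesis using u(2)[OF a] d(2)[OF a] by (simp add: \<epsilon>_def)
    qed
    let ?A = "h (src Q a) * darr M a" and ?B = "f (src Q a) * u (src Q a) * darr M a"
    let ?C = "darr E a * h (tgt Q a)" and ?D = "darr E a * (f (tgt Q a) * u (tgt Q a))"
    have ABCD: "?A \<in> carrier_mat (dimv E (src Q a)) (dimv M (tgt Q a))" "?B \<in> carrier_mat (dimv E (src Q a)) (dimv M (tgt Q a))"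
      "?C \<in> carrier_mat (dimv E (src Q a)) (dimv M (tgt Q a))" "?D \<in> carrier_mat (dimv E (src Q a)) (dimv M (tgt Q a))"
      using hs ht fs ft us ut c by auto
    have "?A - ?B = ?C - ?D" by (rule mat_diff_exchange[OF ABCD 1])
    then show "?h (src Q a) * darr M a = darr E a * ?h (tgt Q a)"
      using minus_mult_distrib_mat[OF hs mult_carrier_mat[OF fs us] c(2)]
        mult_minus_distrib_mat[OF c(4) ht mult_carrier_mat[OF ft ut]] by simp
  qed
  ultimately show "\<exists>h. is_hom Q M E h \<and> (\<forall>v\<in>verts Q. g v * h v = 1\<^sub>m (dimv M v))" by blast
qed

lemma hom_comp:
  fixes L M N :: "('v, 'a, 'k::field) drep"
  assumes L: "is_Dmod Q L" and M: "is_Dmod Q M" and N: "is_Dmod Q N" and f: "is_hom Q L M f" and g: "is_hom Q M N g"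
  shows "is_hom Q L N (\<lambda>v. g v * f v)"
  unfolding is_hom_def
proof (intro conjI ballI)
  fix v assume v: "v \<in> verts Q"
  show "g v * f v \<in> carrier_mat (dimv N v) (dimv L v)" using homD(1)[OF f v] homD(1)[OF g v] by auto
next
  fix a assume a: "a \<in> arrs Q"
  note s = src_in[OF a] and t = tgt_in[OF a]
  note fs = homD(1)[OF f s] and ft = homD(1)[OF f t] and gs = homD(1)[OF g s] and gt = homD(1)[OF g t]
  note l = DmodD(1,2)[OF L a] and m = DmodD(1,2)[OF M a] and n = DmodD(1,2)[OF N a]
  show "g (tgt Q a) * f (tgt Q a) * arr L a = arr N a * (g (src Q a) * f (src Q a))"
    using assoc_mult_mat[OF gt ft l(1)] assoc_mult_mat[OF gt m(1) fs] assoc_mult_mat[OF n(1) gs fs]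
      homD(2)[OF f a] homD(2)[OF g a] by simp
  show "g (src Q a) * f (src Q a) * darr L a = darr N a * (g (tgt Q a) * f (tgt Q a))"
    using assoc_mult_mat[OF gs fs l(2)] assoc_mult_mat[OF gs m(2) ft] assoc_mult_mat[OF n(2) gt ft]
      homD(3)[OF f a] homD(3)[OF g a] by simp
qed

lemma iso_sym: "iso_Dmod Q M N \<Longrightarrow> iso_Dmod Q N M"
  unfolding iso_Dmod_def by blast

lemma mat_inverse_comp:
  fixes F G F' G' :: "'k::field mat"
  assumes "F \<in> carrier_mat m l" "G \<in> carrier_mat n m" "F' \<in> carrier_mat l m" "G' \<in> carrier_mat m n"
    "F' * F = 1\<^sub>m l" "G' * G = 1\<^sub>m m"
  shows "(F' * G') * (G * F) = 1\<^sub>m l"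
proof -
  have "(F' * G') * (G * F) = F' * (G' * (G * F))"
    by (rule assoc_mult_mat[OF assms(3,4) mult_carrier_mat[OF assms(2,1)]])
  also have "G' * (G * F) = (G' * G) * F" by (rule assoc_mult_mat[OF assms(4,2,1), symmetric])
  finally show ?thesis using assms by simp
qed

lemma iso_trans:
  fixes L M N :: "('v, 'a, 'k::field) drep"
  assumes D: "is_Dmod Q L" "is_Dmod Q M" "is_Dmod Q N" and "iso_Dmod Q L M" "iso_Dmod Q M N"
  shows "iso_Dmod Q L N"
proof -
  obtain f f' where f: "is_hom Q L M f" "is_hom Q M L f'"
    "\<And>v. v \<in> verts Q \<Longrightarrow> f' v * f v = 1\<^sub>m (dimv L v) \<and> f v * f' v = 1\<^sub>m (dimv M v)"
    using assms(4) unfolding iso_Dmod_def by blast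
  obtain g g' where g: "is_hom Q M N g" "is_hom Q N M g'"
    "\<And>v. v \<in> verts Q \<Longrightarrow> g' v * g v = 1\<^sub>m (dimv M v) \<and> g v * g' v = 1\<^sub>m (dimv N v)"
    using assms(5) unfolding iso_Dmod_def by blast
  have "(f' v * g' v) * (g v * f v) = 1\<^sub>m (dimv L v) \<and> (g v * f v) * (f' v * g' v) = 1\<^sub>m (dimv N v)"
    if v: "v \<in> verts Q" for v
    using mat_inverse_comp[OF homD(1)[OF f(1) v] homD(1)[OF g(1) v] homD(1)[OF f(2) v] homD(1)[OF g(2) v]]
      mat_inverse_comp[OF homD(1)[OF g(2) v] homD(1)[OF f(2) v] homD(1)[OF g(1) v] homD(1)[OF f(1) v]]
      f(3)[OF v] g(3)[OF v] by blast
  then show ?thesis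
    unfolding iso_Dmod_def
    using hom_comp[OF D f(1) g(1)] hom_comp[OF D(3,2,1) g(2) f(2)] by blast
qed

text \<open>An extension of N by N becomes one of M by M with the same middle term, on composing its
  two maps with the isomorphism and its inverse.\<close>

lemma exceptional_iso:
  fixes M N :: "('v, 'a, 'k::field) drep"
  assumes M: "is_Dmod Q M" and N: "is_Dmod Q N" and iso: "iso_Dmod Q M N" and ex: "exceptional Q M"
  shows "exceptional Q N"
  unfolding exceptional_def
proof (intro allI impI)
  fix E f g assume "is_Dmod Q E \<and> short_exact Q N E N f g"
  then have E: "is_Dmod Q E" and f: "is_hom Q N E f" and g: "is_hom Q E N g"
    and inj: "\<And>v x. v \<in> verts Q \<Longrightarrow> x \<in> carrier_vec (dimv N v) \<Longrightarrow> f v *\<^sub>v x = 0\<^sub>v (dimv E v) \<Longrightarrow> x = 0\<^sub>v (dimv N v)"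
    and surj: "\<And>v y. v \<in> verts Q \<Longrightarrow> y \<in> carrier_vec (dimv N v) \<Longrightarrow> \<exists>x\<in>carrier_vec (dimv E v). g v *\<^sub>v x = y"
    and exact: "\<And>v y. v \<in> verts Q \<Longrightarrow> y \<in> carrier_vec (dimv E v) \<Longrightarrow>
            g v *\<^sub>v y = 0\<^sub>v (dimv N v) \<longleftrightarrow> (\<exists>x\<in>carrier_vec (dimv N v). y = f v *\<^sub>v x)"
    unfolding short_exact_def by blast+
  obtain p q where p: "is_hom Q M N p" and q: "is_hom Q N M q"
    and pq: "\<And>v. v \<in> verts Q \<Longrightarrow> q v * p v = 1\<^sub>m (dimv M v)" "\<And>v. v \<in> verts Q \<Longrightarrow> p v * q v = 1\<^sub>m (dimv N v)"
    using iso unfolding iso_Dmod_def by blast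
  have "short_exact Q M E M (\<lambda>v. f v * p v) (\<lambda>v. q v * g v)"
    unfolding short_exact_def
  proof (intro conjI ballI)
    show "is_hom Q M E (\<lambda>v. f v * p v)" by (rule hom_comp[OF M N E p f])
    show "is_hom Q E M (\<lambda>v. q v * g v)" by (rule hom_comp[OF E N M g q])
    fix v assume v: "v \<in> verts Q"
    note c = homD(1)[OF f v] homD(1)[OF g v] homD(1)[OF p v] homD(1)[OF q v]
    have qp: "q v *\<^sub>v (p v *\<^sub>v x) = x" if "x \<in> carrier_vec (dimv M v)" for x
      using assoc_mult_mat_vec[OF c(4,3) that] pq(1)[OF v] that by simp
    have pq': "p v *\<^sub>v (q v *\<^sub>v x) = x" if "x \<in> carrier_vec (dimv N v)" for x
      using assoc_mult_mat_vec[OF c(3,4) that] pq(2)[OF v] that by simp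
    have q0: "q v *\<^sub>v 0\<^sub>v (dimv N v) = 0\<^sub>v (dimv M v)" using c(4) by auto
    have p0: "p v *\<^sub>v 0\<^sub>v (dimv M v) = 0\<^sub>v (dimv N v)" using c(3) by auto
    show "(f v * p v) *\<^sub>v x = 0\<^sub>v (dimv E v) \<longrightarrow> x = 0\<^sub>v (dimv M v)" if x: "x \<in> carrier_vec (dimv M v)" for x
      using assoc_mult_mat_vec[OF c(1,3) x] inj[OF v mult_mat_vec_carrier[OF c(3) x]] qp[OF x] q0 by auto
    show "\<exists>x\<in>carrier_vec (dimv E v). (q v * g v) *\<^sub>v x = y" if y: "y \<in> carrier_vec (dimv M v)" for y
      using surj[OF v mult_mat_vec_carrier[OF c(3) y]] assoc_mult_mat_vec[OF c(4,2)] qp[OF y] by metis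
    fix y :: "'k vec" assume y: "y \<in> carrier_vec (dimv E v)"
    have gy: "g v *\<^sub>v y \<in> carrier_vec (dimv N v)" using c(2) y by (auto intro: mult_mat_vec_carrier)
    have "(q v * g v) *\<^sub>v y = 0\<^sub>v (dimv M v) \<longleftrightarrow> g v *\<^sub>v y = 0\<^sub>v (dimv N v)"
      using assoc_mult_mat_vec[OF c(4,2) y] pq'[OF gy] p0 q0 by auto
    also have "\<dots> \<longleftrightarrow> (\<exists>x\<in>carrier_vec (dimv N v). y = f v *\<^sub>v x)" by (rule exact[OF v y])
    also have "\<dots> \<longleftrightarrow> (\<exists>x\<in>carrier_vec (dimv M v). y = (f v * p v) *\<^sub>v x)"
    proof
      assume "\<exists>x\<in>carrier_vec (dimv N v). y = f v *\<^sub>v x"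
      then obtain x where x: "x \<in> carrier_vec (dimv N v)" "y = f v *\<^sub>v x" by blast
      have "q v *\<^sub>v x \<in> carrier_vec (dimv M v)" using c(4) x by (auto intro: mult_mat_vec_carrier)
      then show "\<exists>x\<in>carrier_vec (dimv M v). y = (f v * p v) *\<^sub>v x"
        using assoc_mult_mat_vec[OF c(1,3)] pq'[OF x(1)] x(2) by metis
    next
      assume "\<exists>x\<in>carrier_vec (dimv M v). y = (f v * p v) *\<^sub>v x"
      then obtain x where x: "x \<in> carrier_vec (dimv M v)" "y = (f v * p v) *\<^sub>v x" by blast
      then show "\<exists>x\<in>carrier_vec (dimv N v). y = f v *\<^sub>v x"
        using assoc_mult_mat_vec[OF c(1,3) x(1)] mult_mat_vec_carrier[OF c(3) x(1)] by metis
    qed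
    finally show "(q v * g v) *\<^sub>v y = 0\<^sub>v (dimv M v) \<longleftrightarrow> (\<exists>x\<in>carrier_vec (dimv M v). y = (f v * p v) *\<^sub>v x)" .
  qed
  then obtain h where h: "is_hom Q M E h" "\<And>v. v \<in> verts Q \<Longrightarrow> (q v * g v) * h v = 1\<^sub>m (dimv M v)"
    using ex E unfolding exceptional_def by blast
  have "g v * (h v * q v) = 1\<^sub>m (dimv N v)" if v: "v \<in> verts Q" for v
  proof -
    note c = homD(1)[OF g v] homD(1)[OF h(1) v] homD(1)[OF p v] homD(1)[OF q v]
    \<comment> \<open>Since q g h = 1, multiplication by p gives g h = p; therefore h q is a section
      of g.\<close>
    have "g v * h v = p v * q v * (g v * h v)" using pq(2)[OF v] left_mult_one_mat[OF mult_carrier_mat[OF c(1,2)]] by simp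
    also have "\<dots> = p v * (q v * (g v * h v))" by (rule assoc_mult_mat[OF c(3,4) mult_carrier_mat[OF c(1,2)]])
    also have "q v * (g v * h v) = 1\<^sub>m (dimv M v)" using assoc_mult_mat[OF c(4,1,2)] h(2)[OF v] by simp
    finally have "g v * h v = p v" using c(3) by simp
    then show ?thesis using assoc_mult_mat[OF c(1,2,4)] pq(2)[OF v] by simp
  qed
  then show "\<exists>h. is_hom Q N E h \<and> (\<forall>v\<in>verts Q. g v * h v = 1\<^sub>m (dimv N v))"
    using hom_comp[OF N M E q h(1)] by blast
qed

lemma hom_inverse:
  fixes M N :: "('v, 'a, 'k::field) drep"
  assumes M: "is_Dmod Q M" and N: "is_Dmod Q N" and f: "is_hom Q M N f"
    and g: "\<And>v. v \<in> verts Q \<Longrightarrow> g v \<in> carrier_mat (dimv M v) (dimv N v)"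
      "\<And>v. v \<in> verts Q \<Longrightarrow> g v * f v = 1\<^sub>m (dimv M v)" "\<And>v. v \<in> verts Q \<Longrightarrow> f v * g v = 1\<^sub>m (dimv N v)"
  shows "iso_Dmod Q M N"
proof -
  have inv: "g v * Y = X * g w"
    if v: "v \<in> verts Q" "w \<in> verts Q" and X: "X \<in> carrier_mat (dimv M v) (dimv M w)" and Y: "Y \<in> carrier_mat (dimv N v) (dimv N w)"
      and eq: "f v * X = Y * f w" for v w X Y
  proof -
    note c = homD(1)[OF f v(1)] homD(1)[OF f v(2)] g(1)[OF v(1)] g(1)[OF v(2)]
    have "g v * Y = g v * (Y * (f w * g w))" using g(3)[OF v(2)] Y by simp
    also have "Y * (f w * g w) = (f v * X) * g w" using assoc_mult_mat[OF Y c(2,4)] eq by simp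
    also have "\<dots> = f v * (X * g w)" by (rule assoc_mult_mat[OF c(1) X c(4)])
    also have "g v * \<dots> = g v * f v * (X * g w)" by (rule assoc_mult_mat[OF c(3,1) mult_carrier_mat[OF X c(4)], symmetric])
    also have "\<dots> = X * g w" using g(2)[OF v(1)] left_mult_one_mat[OF mult_carrier_mat[OF X c(4)]] by simp
    finally show ?thesis .
  qed
  have "is_hom Q N M g"
    unfolding is_hom_def
    using g(1) inv src_in tgt_in DmodD(1,2)[OF M] DmodD(1,2)[OF N] homD(2,3)[OF f] by metis
  then show ?thesis unfolding iso_Dmod_def using f g by blast
qed

end

section \<open>Uniqueness by generic deformation\<close>

definition polyfun :: "('k::field \<Rightarrow> 'k) \<Rightarrow> bool" where
  "polyfun f \<longleftrightarrow> (\<exists>p. \<forall>t. f t = poly p t)"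

lemma polyfun_const [simp]: "polyfun (\<lambda>t. c)"
  unfolding polyfun_def by (rule exI[of _ "[:c:]"]) simp

lemma polyfun_id [simp]: "polyfun (\<lambda>t. t)"
  unfolding polyfun_def by (rule exI[of _ "[:0, 1:]"]) simp

lemma polyfun_add: "polyfun f \<Longrightarrow> polyfun g \<Longrightarrow> polyfun (\<lambda>t. f t + g t)"
  unfolding polyfun_def by (metis poly_add)

lemma polyfun_diff: "polyfun f \<Longrightarrow> polyfun g \<Longrightarrow> polyfun (\<lambda>t. f t - g t)"
  unfolding polyfun_def by (metis poly_diff)

lemma polyfun_mult: "polyfun f \<Longrightarrow> polyfun g \<Longrightarrow> polyfun (\<lambda>t. f t * g t)"
  unfolding polyfun_def by (metis poly_mult)

lemma polyfun_sum: "(\<And>i. i \<in> I \<Longrightarrow> polyfun (f i)) \<Longrightarrow> polyfun (\<lambda>t. \<Sum>i\<in>I. f i t)"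
  by (induction I rule: infinite_finite_induct) (auto intro: polyfun_add)

lemma polyfun_prod: "(\<And>i. i \<in> I \<Longrightarrow> polyfun (f i)) \<Longrightarrow> polyfun (\<lambda>t. \<Prod>i\<in>I. f i t)"
  by (induction I rule: infinite_finite_induct) (auto intro: polyfun_mult)

lemma polyfun_det:
  assumes A: "\<And>t. A t \<in> carrier_mat n n" and p: "\<And>i j. i < n \<Longrightarrow> j < n \<Longrightarrow> polyfun (\<lambda>t. A t $$ (i, j))"
  shows "polyfun (\<lambda>t. det (A t))"
proof -
  have "polyfun (\<lambda>t. signof q * (\<Prod>i = 0..<n. A t $$ (i, q i)))" if "q permutes {0..<n}" for q
    by (intro polyfun_mult polyfun_prod polyfun_const p) (use permutes_in_image[OF that] in auto)
  then show ?thesis unfolding det_def'[OF A] by (intro polyfun_sum) auto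
qed

lemma polyfun_adj_mat:
  assumes A: "\<And>t. A t \<in> carrier_mat n n" and p: "\<And>i j. i < n \<Longrightarrow> j < n \<Longrightarrow> polyfun (\<lambda>t. A t $$ (i, j))"
    and ij: "i < n" "j < n"
  shows "polyfun (\<lambda>t. adj_mat (A t) $$ (i, j))"
proof -
  have "polyfun (\<lambda>t. det (mat_delete (A t) j i))"
  proof (rule polyfun_det[of _ "n - 1"])
    fix t show "mat_delete (A t) j i \<in> carrier_mat (n - 1) (n - 1)" using A[of t] by (rule mat_delete_carrier)
  next
    fix k l assume kl: "k < n - 1" "l < n - 1"
    have "mat_delete (A t) j i $$ (k, l) = A t $$ (if k < j then k else Suc k, if l < i then l else Suc l)" for t
      using A[of t] kl by (auto simp: mat_delete_def)
    then show "polyfun (\<lambda>t. mat_delete (A t) j i $$ (k, l))" using p kl by simp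
  qed
  moreover have "adj_mat (A t) $$ (i, j) = (- 1) ^ (j + i) * det (mat_delete (A t) j i)" for t
    using A[of t] ij by (simp add: adj_mat_def cofactor_def)
  ultimately show ?thesis by (auto intro: polyfun_mult)
qed

text \<open>Induction on the finite set \<open>I\<close> of coordinates: a vector not vanishing at the new coordinate
  serves as pivot.\<close>
lemma finite_span:
  fixes W :: "('i \<Rightarrow> 'k::field) set"
  assumes "finite I" and W: "\<And>f g c. f \<in> W \<Longrightarrow> g \<in> W \<Longrightarrow> (\<lambda>x. f x - c * g x) \<in> W"
  shows "\<exists>(k::nat) w. (\<forall>i<k. w i \<in> W) \<and> (\<forall>f\<in>W. \<exists>c. \<forall>x\<in>I. f x = (\<Sum>i<k. c i * w i x))"
  using assms
proof (induction I arbitrary: W rule: finite_induct)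
  case empty
  then show ?case by (intro exI[of _ 0]) auto
next
  case (insert x0 I)
  show ?case
  proof (cases "\<forall>f\<in>W. f x0 = 0")
    case True
    obtain k :: nat and w where w: "\<forall>i<k. w i \<in> W" "\<forall>f\<in>W. \<exists>c. \<forall>x\<in>I. f x = (\<Sum>i<k. c i * w i x)"
      using insert.IH[OF insert.prems] by blast
    have "\<exists>c. \<forall>x\<in>insert x0 I. f x = (\<Sum>i<k. c i * w i x)" if f: "f \<in> W" for f
    proof -
      obtain c where "\<forall>x\<in>I. f x = (\<Sum>i<k. c i * w i x)" using w f by blast
      moreover have "(\<Sum>i<k. c i * w i x0) = 0" using True w(1) by (intro sum.neutral) auto
      ultimately show ?thesis using True f by (intro exI[of _ c]) auto
    qed
    then show ?thesis using w(1) by blast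
  next
    case False
    then obtain f0 where f0: "f0 \<in> W" "f0 x0 \<noteq> 0" by blast
    let ?W = "{f \<in> W. f x0 = 0}"
    have "\<exists>(k::nat) w. (\<forall>i<k. w i \<in> ?W) \<and> (\<forall>f\<in>?W. \<exists>c. \<forall>x\<in>I. f x = (\<Sum>i<k. c i * w i x))"
      by (rule insert.IH) (auto intro: insert.prems)
    then obtain k :: nat and w where w: "\<And>i. i < k \<Longrightarrow> w i \<in> ?W" "\<And>f. f \<in> ?W \<Longrightarrow> \<exists>c. \<forall>x\<in>I. f x = (\<Sum>i<k. c i * w i x)"
      by blast
    define w' where "w' = w(k := f0)"
    have "\<exists>c. \<forall>x\<in>insert x0 I. f x = (\<Sum>i<Suc k. c i * w' i x)" if f: "f \<in> W" for f
    proof -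
      define a where "a = f x0 / f0 x0"
      have "(\<lambda>x. f x - a * f0 x) \<in> ?W" using insert.prems[OF f f0(1), of a] f0 by (simp add: a_def)
      from w(2)[OF this] obtain c where c: "\<forall>x\<in>I. f x - a * f0 x = (\<Sum>i<k. c i * w i x)" by blast
      have "f x = (\<Sum>i<Suc k. (c(k := a)) i * w' i x)" if x: "x \<in> insert x0 I" for x
      proof -
        have "(\<Sum>i<Suc k. (c(k := a)) i * w' i x) = (\<Sum>i<k. c i * w i x) + a * f0 x"
          by (simp add: w'_def)
        moreover have "(\<Sum>i<k. c i * w i x0) = 0" using w(1) by simp
        ultimately show ?thesis using c x f0 by (auto simp: a_def algebra_simps)
      qed
      then show ?thesis by blast
    qed
    moreover have "\<forall>i<Suc k. w' i \<in> W" using w(1) f0 by (auto simp: w'_def less_Suc_eq)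
    ultimately show ?thesis by blast
  qed
qed

section \<open>The linear space of derivations and the deformation along a line\<close>

context finite_quiver
begin

text \<open>Both relations are linear and homogeneous in the starred arrows. With t = -1 this also
  provides the direction of the line joining two module structures.\<close>

lemma Dmod_darr_lincomb:
  fixes M :: "('v, 'a, 'k::field) drep"
  assumes d: "is_Dmod Q (M\<lparr>darr := \<delta>\<rparr>)" and e: "is_Dmod Q (M\<lparr>darr := \<eta>\<rparr>)"
  shows "is_Dmod Q (M\<lparr>darr := \<lambda>a. \<delta> a + t \<cdot>\<^sub>m \<eta> a\<rparr>)"
proof -
  have rel: "(\<delta> b + t \<cdot>\<^sub>m \<eta> b) * arr M a = \<delta> b * arr M a + t \<cdot>\<^sub>m (\<eta> b * arr M a)"
    if "a \<in> arrs Q" "b \<in> arrs Q" and ba: "tgt Q b = tgt Q a" for a b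
  proof -
    note c = Dmod_darrD(1)[OF d that(1)] Dmod_darrD(2)[OF d that(2), unfolded ba] Dmod_darrD(2)[OF e that(2), unfolded ba]
    show ?thesis
      using add_mult_distrib_mat[OF c(2) smult_carrier_mat[OF c(3), of t] c(1)] mult_smult_assoc_mat[OF c(3,1), of t] by simp
  qed
  show ?thesis unfolding is_Dmod_def
  proof (intro conjI ballI impI)
    fix a assume a: "a \<in> arrs Q"
    let ?M = "M\<lparr>darr := \<lambda>a. \<delta> a + t \<cdot>\<^sub>m \<eta> a\<rparr>"
    show "arr ?M a \<in> carrier_mat (dimv ?M (tgt Q a)) (dimv ?M (src Q a))"
      "darr ?M a \<in> carrier_mat (dimv ?M (src Q a)) (dimv ?M (tgt Q a))"
      using Dmod_darrD(1,2)[OF d a] Dmod_darrD(2)[OF e a] by auto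
    let ?S = "{g \<in> arrs Q. tgt Q g = src Q a}" and ?n = "dimv M (src Q a)"
    have g: "arr M g * \<delta> g \<in> carrier_mat ?n ?n" "arr M g * \<eta> g \<in> carrier_mat ?n ?n"
      "arr M g * (\<delta> g + t \<cdot>\<^sub>m \<eta> g) = arr M g * \<delta> g + t \<cdot>\<^sub>m (arr M g * \<eta> g)" if "g \<in> ?S" for g
    proof -
      from that have b: "g \<in> arrs Q" and ba: "tgt Q g = src Q a" by auto
      note c = Dmod_darrD(1,2)[OF d b, unfolded ba] Dmod_darrD(2)[OF e b, unfolded ba]
      show "arr M g * \<delta> g \<in> carrier_mat ?n ?n" "arr M g * \<eta> g \<in> carrier_mat ?n ?n"
        using c by auto
      show "arr M g * (\<delta> g + t \<cdot>\<^sub>m \<eta> g) = arr M g * \<delta> g + t \<cdot>\<^sub>m (arr M g * \<eta> g)"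
        using mult_add_distrib_mat[OF c(1,2) smult_carrier_mat[OF c(3), of t]] mult_smult_distrib[OF c(1,3), of t] by simp
    qed
    have "msum ?n ?n ?S (\<lambda>g. arr M g * (\<delta> g + t \<cdot>\<^sub>m \<eta> g)) = msum ?n ?n ?S (\<lambda>g. arr M g * \<delta> g + t \<cdot>\<^sub>m (arr M g * \<eta> g))"
      by (rule msum_cong) (use g in blast)
    also have "\<dots> = msum ?n ?n ?S (\<lambda>g. arr M g * \<delta> g) + msum ?n ?n ?S (\<lambda>g. t \<cdot>\<^sub>m (arr M g * \<eta> g))"
      by (rule msum_add) (use g in auto)
    also have "msum ?n ?n ?S (\<lambda>g. t \<cdot>\<^sub>m (arr M g * \<eta> g)) = t \<cdot>\<^sub>m msum ?n ?n ?S (\<lambda>g. arr M g * \<eta> g)"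
      by (rule msum_smult) (use g in blast)
    finally show "darr ?M a * arr ?M a = msum (dimv ?M (src Q a)) (dimv ?M (src Q a)) ?S (\<lambda>g. arr ?M g * darr ?M g)"
      using rel[OF a a refl] Dmod_darrD(3)[OF d a] Dmod_darrD(3)[OF e a] by simp
  next
    fix a b assume a: "a \<in> arrs Q" and b: "b \<in> arrs Q" and ab: "a \<noteq> b \<and> tgt Q a = tgt Q b"
    then show "darr (M\<lparr>darr := \<lambda>a. \<delta> a + t \<cdot>\<^sub>m \<eta> a\<rparr>) b * arr (M\<lparr>darr := \<lambda>a. \<delta> a + t \<cdot>\<^sub>m \<eta> a\<rparr>) a =
        0\<^sub>m (dimv (M\<lparr>darr := \<lambda>a. \<delta> a + t \<cdot>\<^sub>m \<eta> a\<rparr>) (src Q b)) (dimv (M\<lparr>darr := \<lambda>a. \<delta> a + t \<cdot>\<^sub>m \<eta> a\<rparr>) (src Q a))"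
      using rel[OF a b] Dmod_darrD(4)[OF d a b] Dmod_darrD(4)[OF e a b] by simp
  qed
qed

text \<open>An endomorphism over \<open>kQ\<close> can be moved past the arrows in every relation.
  This closes the linear system of the deformation: the products of \<zeta> with endomorphisms
  expand again in a fixed finite set of derivations.\<close>

lemma derivation_mult_endo:
  fixes M :: "('v, 'a, 'k::field) drep"
  assumes z: "is_Dmod Q (M\<lparr>darr := \<zeta>\<rparr>)" and u: "is_khom Q M M u"
  shows "is_Dmod Q (M\<lparr>darr := \<lambda>a. \<zeta> a * u (tgt Q a)\<rparr>)"
proof -
  let ?M = "M\<lparr>darr := \<lambda>a. \<zeta> a * u (tgt Q a)\<rparr>"
  have rel: "\<zeta> b * u (tgt Q b) * arr M a = \<zeta> b * arr M a * u (src Q a)"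
    if a: "a \<in> arrs Q" and b: "b \<in> arrs Q" and ba: "tgt Q b = tgt Q a" for a b
  proof -
    note c = Dmod_darrD(1)[OF z a] Dmod_darrD(2)[OF z b, unfolded ba] khomD(1)[OF u tgt_in[OF a]] khomD(1)[OF u src_in[OF a]]
    show ?thesis unfolding ba using assoc_mult_mat[OF c(2,3,1)] assoc_mult_mat[OF c(2,1,4)] khomD(2)[OF u a] by simp
  qed
  show ?thesis unfolding is_Dmod_def
  proof (intro conjI ballI impI)
    fix a assume a: "a \<in> arrs Q"
    show "arr ?M a \<in> carrier_mat (dimv ?M (tgt Q a)) (dimv ?M (src Q a))"
      "darr ?M a \<in> carrier_mat (dimv ?M (src Q a)) (dimv ?M (tgt Q a))"
      using Dmod_darrD(1,2)[OF z a] khomD(1)[OF u tgt_in[OF a]] by auto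
    let ?S = "{g \<in> arrs Q. tgt Q g = src Q a}" and ?n = "dimv M (src Q a)"
    have g: "arr M g * \<zeta> g \<in> carrier_mat ?n ?n"
      "arr M g * \<zeta> g * u (src Q a) = arr M g * (\<zeta> g * u (tgt Q g))" if "g \<in> ?S" for g
    proof -
      from that have b: "g \<in> arrs Q" and ba: "tgt Q g = src Q a" by auto
      note c = Dmod_darrD(1,2)[OF z b, unfolded ba]
      show "arr M g * \<zeta> g \<in> carrier_mat ?n ?n" using c by auto
      show "arr M g * \<zeta> g * u (src Q a) = arr M g * (\<zeta> g * u (tgt Q g))"
        unfolding ba by (rule assoc_mult_mat[OF c khomD(1)[OF u src_in[OF a]]])
    qed
    have "msum ?n ?n ?S (\<lambda>g. arr M g * \<zeta> g) * u (src Q a) = msum ?n ?n ?S (\<lambda>g. arr M g * \<zeta> g * u (src Q a))"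
      by (rule msum_mult[OF khomD(1)[OF u src_in[OF a]]]) (use g in blast)
    also have "\<dots> = msum ?n ?n ?S (\<lambda>g. arr M g * (\<zeta> g * u (tgt Q g)))"
      by (rule msum_cong) (use g in blast)
    finally show "darr ?M a * arr ?M a = msum (dimv ?M (src Q a)) (dimv ?M (src Q a)) ?S (\<lambda>g. arr ?M g * darr ?M g)"
      using rel[OF a a refl] Dmod_darrD(3)[OF z a] by simp
  next
    fix a b assume a: "a \<in> arrs Q" and b: "b \<in> arrs Q" and ab: "a \<noteq> b \<and> tgt Q a = tgt Q b"
    then show "darr ?M b * arr ?M a = 0\<^sub>m (dimv ?M (src Q b)) (dimv ?M (src Q a))"
      using rel[OF a b] Dmod_darrD(4)[OF z a b] khomD(1)[OF u src_in[OF a]] by simp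
  qed
qed

text \<open>\<open>finite_span\<close> needs functions on a finite set, here all matrix entries
  within range; the bounds on p and q mark where the entries carry information.\<close>

lemma derivations_span:
  fixes M :: "('v, 'a, 'k::field) drep"
  shows "\<exists>(k::nat) r. (\<forall>i<k. is_Dmod Q (M\<lparr>darr := r i\<rparr>)) \<and>
     (\<forall>\<delta>. is_Dmod Q (M\<lparr>darr := \<delta>\<rparr>) \<longrightarrow> (\<exists>c. \<forall>a\<in>arrs Q. \<forall>p<dimv M (src Q a). \<forall>q<dimv M (tgt Q a).
         \<delta> a $$ (p, q) = (\<Sum>i<k. c i * r i a $$ (p, q))))"
proof -
  let ?I = "SIGMA a:arrs Q. {..<dimv M (src Q a)} \<times> {..<dimv M (tgt Q a)}"
  \<comment> \<open>A relation instead of a function: f agrees with the entries of \<delta> within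
    range and is arbitrary elsewhere, so the set of all such f is closed under the operation
    required by \<open>finite_span\<close>.\<close>
  define D where "D \<delta> f \<longleftrightarrow> is_Dmod Q (M\<lparr>darr := \<delta>\<rparr>) \<and>
     (\<forall>a\<in>arrs Q. \<forall>p<dimv M (src Q a). \<forall>q<dimv M (tgt Q a). f (a, p, q) = \<delta> a $$ (p, q))" for \<delta> and f :: "'a \<times> nat \<times> nat \<Rightarrow> 'k"
  have D1: "is_Dmod Q (M\<lparr>darr := \<delta>\<rparr>)"
    and D2: "a \<in> arrs Q \<Longrightarrow> p < dimv M (src Q a) \<Longrightarrow> q < dimv M (tgt Q a) \<Longrightarrow> f (a, p, q) = \<delta> a $$ (p, q)"
    if "D \<delta> f" for \<delta> f a p q
    using that by (auto simp: D_def)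
  let ?W = "{f. \<exists>\<delta>. D \<delta> f}"
  have fin: "finite ?I" using fin_arrs by auto
  have W: "(\<lambda>x. f x - c * g x) \<in> ?W" if fg: "f \<in> ?W" "g \<in> ?W" for f g c
  proof -
    obtain \<delta> where d: "D \<delta> f" using fg(1) by blast
    obtain \<eta> where e: "D \<eta> g" using fg(2) by blast
    have "D (\<lambda>a. \<delta> a + (- c) \<cdot>\<^sub>m \<eta> a) (\<lambda>x. f x - c * g x)"
      unfolding D_def
    proof (intro conjI ballI allI impI)
      show "is_Dmod Q (M\<lparr>darr := \<lambda>a. \<delta> a + (- c) \<cdot>\<^sub>m \<eta> a\<rparr>)"
        by (rule Dmod_darr_lincomb[OF D1[OF d] D1[OF e]])
      fix a p q assume a: "a \<in> arrs Q" "p < dimv M (src Q a)" "q < dimv M (tgt Q a)"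
      show "f (a, p, q) - c * g (a, p, q) = (\<delta> a + (- c) \<cdot>\<^sub>m \<eta> a) $$ (p, q)"
        using Dmod_darrD(2)[OF D1[OF e] a(1)] a D2[OF d a] D2[OF e a] by simp
    qed
    then show ?thesis by blast
  qed
  obtain k :: nat and w where
    w: "\<forall>i<k. w i \<in> ?W" "\<forall>f\<in>?W. \<exists>c. \<forall>x\<in>?I. f x = (\<Sum>i<k. c i * w i x)"
    using finite_span[OF fin W] by blast
  have "\<forall>i\<in>{..<k}. \<exists>\<delta>. D \<delta> (w i)" using w(1) by blast
  from bchoice[OF this] obtain r where r: "\<And>i. i < k \<Longrightarrow> D (r i) (w i)" by blast
  have "\<exists>c. \<forall>a\<in>arrs Q. \<forall>p<dimv M (src Q a). \<forall>q<dimv M (tgt Q a). \<delta> a $$ (p, q) = (\<Sum>i<k. c i * r i a $$ (p, q))"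
    if d: "is_Dmod Q (M\<lparr>darr := \<delta>\<rparr>)" for \<delta>
  proof -
    have "D \<delta> (\<lambda>(a, p, q). \<delta> a $$ (p, q))" using d by (simp add: D_def)
    then obtain c where c: "\<forall>x\<in>?I. (\<lambda>(a, p, q). \<delta> a $$ (p, q)) x = (\<Sum>i<k. c i * w i x)" using w(2) by blast
    have "\<delta> a $$ (p, q) = (\<Sum>i<k. c i * r i a $$ (p, q))"
      if a: "a \<in> arrs Q" "p < dimv M (src Q a)" "q < dimv M (tgt Q a)" for a p q
    proof -
      have "(a, p, q) \<in> ?I" using a by auto
      from c[rule_format, OF this] have "\<delta> a $$ (p, q) = (\<Sum>i<k. c i * w i (a, p, q))" by simp
      also have "\<dots> = (\<Sum>i<k. c i * r i a $$ (p, q))"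
        by (intro sum.cong refl) (simp add: D2[OF r a])
      finally show ?thesis .
    qed
    then show ?thesis by blast
  qed
  then show ?thesis using r D1 by (intro exI[of _ k] exI[of _ r]) blast
qed

end

text \<open>The ansatz for the deformed identity at one vertex: c is the common denominator from
  Cramer's rule and the z i are the coefficients of fixed endomorphisms S i.\<close>

definition affine_mat :: "nat \<Rightarrow> 'k::field \<Rightarrow> nat \<Rightarrow> (nat \<Rightarrow> 'k) \<Rightarrow> (nat \<Rightarrow> 'k mat) \<Rightarrow> 'k mat" where
  "affine_mat n c k z S = c \<cdot>\<^sub>m 1\<^sub>m n + msum n n {..<k} (\<lambda>i. z i \<cdot>\<^sub>m S i)"

lemma affine_mat_carrier [simp]: "affine_mat n c k z S \<in> carrier_mat n n"
  by (simp add: affine_mat_def)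

lemma affine_mat_index:
  assumes "\<And>i. i < k \<Longrightarrow> S i \<in> carrier_mat n n" "p < n" "q < n"
  shows "affine_mat n c k z S $$ (p, q) = c * (if p = q then 1 else 0) + (\<Sum>i<k. z i * S i $$ (p, q))"
proof -
  have "(z i \<cdot>\<^sub>m S i) $$ (p, q) = z i * S i $$ (p, q)" if "i < k" for i
    using assms(1)[OF that] assms(2,3) by auto
  then show ?thesis using assms(2,3) by (simp add: affine_mat_def msum_def)
qed

lemma affine_mat_mult_index:
  fixes X :: "'k::field mat"
  assumes S: "\<And>i. i < k \<Longrightarrow> S i \<in> carrier_mat n n" and X: "X \<in> carrier_mat n m" and pq: "p < n" "q < m"
  shows "(affine_mat n c k z S * X) $$ (p, q) = c * X $$ (p, q) + (\<Sum>i<k. z i * (S i * X) $$ (p, q))"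
proof -
  have 1: "msum n n {..<k} (\<lambda>i. z i \<cdot>\<^sub>m S i) * X = msum n m {..<k} (\<lambda>i. z i \<cdot>\<^sub>m S i * X)"
    by (rule msum_mult[OF X]) (use S in auto)
  have 2: "msum n m {..<k} (\<lambda>i. z i \<cdot>\<^sub>m S i * X) $$ (p, q) = (\<Sum>i<k. z i * (S i * X) $$ (p, q))"
  proof -
    have "(z i \<cdot>\<^sub>m S i * X) $$ (p, q) = z i * (S i * X) $$ (p, q)" if i: "i < k" for i
      using mult_smult_assoc_mat[OF S[OF i] X, of "z i"] S[OF i] X pq by simp
    then show ?thesis using pq by (simp add: msum_def)
  qed
  have "affine_mat n c k z S * X = c \<cdot>\<^sub>m 1\<^sub>m n * X + msum n n {..<k} (\<lambda>i. z i \<cdot>\<^sub>m S i) * X"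
    unfolding affine_mat_def by (rule add_mult_distrib_mat[OF _ _ X]) auto
  moreover have "c \<cdot>\<^sub>m 1\<^sub>m n * X = c \<cdot>\<^sub>m X" using mult_smult_assoc_mat[OF one_carrier_mat X] X by simp
  ultimately show ?thesis using 1 2 X pq by simp
qed

lemma mult_affine_mat_index:
  fixes X :: "'k::field mat"
  assumes S: "\<And>i. i < k \<Longrightarrow> S i \<in> carrier_mat n n" and X: "X \<in> carrier_mat m n" and pq: "p < m" "q < n"
  shows "(X * affine_mat n c k z S) $$ (p, q) = c * X $$ (p, q) + (\<Sum>i<k. z i * (X * S i) $$ (p, q))"
proof -
  have 1: "X * msum n n {..<k} (\<lambda>i. z i \<cdot>\<^sub>m S i) = msum m n {..<k} (\<lambda>i. X * (z i \<cdot>\<^sub>m S i))"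
    by (rule mult_msum[OF X]) (use S in auto)
  have 2: "msum m n {..<k} (\<lambda>i. X * (z i \<cdot>\<^sub>m S i)) $$ (p, q) = (\<Sum>i<k. z i * (X * S i) $$ (p, q))"
  proof -
    have "(X * (z i \<cdot>\<^sub>m S i)) $$ (p, q) = z i * (X * S i) $$ (p, q)" if i: "i < k" for i
      using mult_smult_distrib[OF X S[OF i], of "z i"] S[OF i] X pq by simp
    then show ?thesis using pq by (simp add: msum_def)
  qed
  have "X * affine_mat n c k z S = X * (c \<cdot>\<^sub>m 1\<^sub>m n) + X * msum n n {..<k} (\<lambda>i. z i \<cdot>\<^sub>m S i)"
    unfolding affine_mat_def by (rule mult_add_distrib_mat[OF X]) auto
  moreover have "X * (c \<cdot>\<^sub>m 1\<^sub>m n) = c \<cdot>\<^sub>m X" using mult_smult_distrib[OF X one_carrier_mat] X by simp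
  ultimately show ?thesis using 1 2 X pq by simp
qed

text \<open>Cramer's rule for \<open>(1 - t C\<^sup>T) z = t u\<close>, with denominators cleared.\<close>
lemma cramer_polyfun:
  fixes C :: "nat \<Rightarrow> nat \<Rightarrow> 'k::field" and u :: "nat \<Rightarrow> 'k"
  obtains c z where "polyfun c" "\<And>i. i < k \<Longrightarrow> polyfun (\<lambda>t. z t i)" "c 0 = 1" "\<And>i. z 0 i = 0"
    "\<And>t j. j < k \<Longrightarrow> z t j = c t * t * u j + t * (\<Sum>i<k. C i j * z t i)"
proof -
  define B where "B t = mat k k (\<lambda>(j, i). (if j = i then 1 else 0) - t * C i j)" for t
  have Bc: "B t \<in> carrier_mat k k" for t by (simp add: B_def)
  have Bp: "polyfun (\<lambda>t. B t $$ (i, j))" if "i < k" "j < k" for i j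
  proof -
    have "B t $$ (i, j) = (if i = j then 1 else 0) - t * C j i" for t using that by (simp add: B_def)
    then show ?thesis by (simp only:) (intro polyfun_diff polyfun_mult polyfun_const polyfun_id)
  qed
  \<comment> \<open>The determinant and the adjugate replace the inverse, so both c and z are
    polynomial in t and the equation holds also where the system is singular.\<close>
  define c where "c t = det (B t)" for t
  define z where "z t j = (\<Sum>i<k. adj_mat (B t) $$ (j, i) * (t * u i))" for t j
  have "polyfun c" unfolding c_def[abs_def] by (rule polyfun_det[OF Bc Bp])
  moreover have "polyfun (\<lambda>t. z t j)" if "j < k" for j
    unfolding z_def by (intro polyfun_sum polyfun_mult polyfun_adj_mat[OF Bc Bp]) (use that in auto)
  moreover have "B 0 = 1\<^sub>m k" by (auto simp: B_def)
  then have "c 0 = 1" by (simp add: c_def)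
  moreover have "z 0 i = 0" for i by (simp add: z_def)
  moreover have "z t j = c t * t * u j + t * (\<Sum>i<k. C i j * z t i)" if j: "j < k" for t j
  proof -
    note a = adj_mat[OF Bc[of t]]
    have "(B t * adj_mat (B t)) $$ (j, i) = c t * (if j = i then 1 else 0)" if "i < k" for i
      unfolding a(2) using j that by (simp add: c_def)
    moreover have "(B t * adj_mat (B t)) $$ (j, i) = (\<Sum>l<k. B t $$ (j, l) * adj_mat (B t) $$ (l, i))" if "i < k" for i
      using Bc[of t] a(1) j that by (simp add: scalar_prod_def lessThan_atLeast0)
    ultimately have BA: "(\<Sum>l<k. B t $$ (j, l) * adj_mat (B t) $$ (l, i)) = c t * (if j = i then 1 else 0)" if "i < k" for i
      using that by simp
    have "(\<Sum>l<k. B t $$ (j, l) * z t l) = (\<Sum>l<k. \<Sum>i<k. B t $$ (j, l) * adj_mat (B t) $$ (l, i) * (t * u i))"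
      by (simp add: z_def sum_distrib_left mult.assoc)
    also have "\<dots> = (\<Sum>i<k. (\<Sum>l<k. B t $$ (j, l) * adj_mat (B t) $$ (l, i)) * (t * u i))"
      unfolding sum_distrib_right by (rule sum.swap)
    also have "\<dots> = (\<Sum>i<k. if i = j then c t * t * u j else 0)"
      by (intro sum.cong refl) (simp add: BA)
    also have "\<dots> = c t * t * u j" using j by simp
    finally have 1: "(\<Sum>l<k. B t $$ (j, l) * z t l) = c t * t * u j" .
    have "(\<Sum>l<k. B t $$ (j, l) * z t l) = (\<Sum>l<k. (if l = j then z t l else 0) - t * (C l j * z t l))"
      using j by (intro sum.cong refl) (auto simp: B_def algebra_simps)
    also have "\<dots> = z t j - t * (\<Sum>i<k. C i j * z t i)"
      using j by (simp add: sum_subtractf sum_distrib_left)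
    finally show ?thesis using 1 by (simp add: algebra_simps)
  qed
  ultimately show ?thesis using that by blast
qed

lemma det_nonzero_inverse:
  fixes A :: "'k::field mat"
  assumes A: "A \<in> carrier_mat n n" and "det A \<noteq> 0"
  shows "\<exists>B\<in>carrier_mat n n. B * A = 1\<^sub>m n \<and> A * B = 1\<^sub>m n"
proof -
  note a = adj_mat[OF A]
  let ?B = "inverse (det A) \<cdot>\<^sub>m adj_mat A"
  have "?B * A = inverse (det A) \<cdot>\<^sub>m (det A \<cdot>\<^sub>m 1\<^sub>m n)" using mult_smult_assoc_mat[OF a(1) A] a(3) by simp
  moreover have "A * ?B = inverse (det A) \<cdot>\<^sub>m (det A \<cdot>\<^sub>m 1\<^sub>m n)" using mult_smult_distrib[OF A a(1)] a(2) by simp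
  moreover have "inverse (det A) \<cdot>\<^sub>m (det A \<cdot>\<^sub>m 1\<^sub>m n) = 1\<^sub>m n" using assms(2) by (intro eq_matI) auto
  ultimately show ?thesis using a(1) by (intro bexI[of _ ?B]) auto
qed

context finite_quiver
begin

text \<open>Near \<open>t = 0\<close> the identity deforms to a morphism \<open>F t\<close> from \<open>M\<close> to the deformed module,
  with entries polynomial in \<open>t\<close>.\<close>
lemma generic_deformation_iso:
  fixes M :: "('v, 'a, 'k::field) drep"
  assumes M: "is_Dmod Q M" and inner: "derivations_inner Q M" and zeta: "is_Dmod Q (M\<lparr>darr := \<zeta>\<rparr>)"
  shows "\<exists>P. poly P 0 \<noteq> 0 \<and> (\<forall>t. poly P t \<noteq> 0 \<longrightarrow> iso_Dmod Q M (M\<lparr>darr := \<lambda>a. darr M a + t \<cdot>\<^sub>m \<zeta> a\<rparr>))"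
proof -
  obtain k :: nat and r where r: "\<And>i. i < k \<Longrightarrow> is_Dmod Q (M\<lparr>darr := r i\<rparr>)"
    and span: "\<And>\<delta>. is_Dmod Q (M\<lparr>darr := \<delta>\<rparr>) \<Longrightarrow> \<exists>c. \<forall>a\<in>arrs Q. \<forall>p<dimv M (src Q a). \<forall>q<dimv M (tgt Q a).
         \<delta> a $$ (p, q) = (\<Sum>i<k. c i * r i a $$ (p, q))"
    using derivations_span[of M] by blast
  have "\<forall>i\<in>{..<k}. \<exists>f. is_khom Q M M f \<and> (\<forall>a\<in>arrs Q. f (src Q a) * darr M a - darr M a * f (tgt Q a) = r i a)"
    using inner r unfolding derivations_inner_def by blast
  from bchoice[OF this] obtain s where s: "\<And>i. i < k \<Longrightarrow> is_khom Q M M (s i)"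
    and sr: "\<And>i a. i < k \<Longrightarrow> a \<in> arrs Q \<Longrightarrow> s i (src Q a) * darr M a - darr M a * s i (tgt Q a) = r i a" by blast
  obtain u where u: "\<And>a p q. a \<in> arrs Q \<Longrightarrow> p < dimv M (src Q a) \<Longrightarrow> q < dimv M (tgt Q a) \<Longrightarrow> \<zeta> a $$ (p, q) = (\<Sum>j<k. u j * r j a $$ (p, q))"
    using span[OF zeta] by blast
  have "\<forall>i\<in>{..<k}. \<exists>c. \<forall>a\<in>arrs Q. \<forall>p<dimv M (src Q a). \<forall>q<dimv M (tgt Q a).
         (\<zeta> a * s i (tgt Q a)) $$ (p, q) = (\<Sum>j<k. c j * r j a $$ (p, q))"
    using span[OF derivation_mult_endo[OF zeta s]] by blast
  from bchoice[OF this] obtain C where C: "\<And>i a p q. i < k \<Longrightarrow> a \<in> arrs Q \<Longrightarrow> p < dimv M (src Q a) \<Longrightarrow> q < dimv M (tgt Q a) \<Longrightarrow>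
         (\<zeta> a * s i (tgt Q a)) $$ (p, q) = (\<Sum>j<k. C i j * r j a $$ (p, q))" by blast
  \<comment> \<open>For F = c + (sum of z i s i), the commutator of F with the starred arrows is the
    sum of z j r j, and it has to equal t \<zeta> F. Expanding \<zeta> and the products \<zeta> s i
    in the r j and comparing coefficients gives this system; c = 1 and z = 0 at t = 0 make F the
    identity there.\<close>
  obtain c z where c: "polyfun c" "c 0 = 1" and z: "\<And>i. i < k \<Longrightarrow> polyfun (\<lambda>t. z t i)" "\<And>i. z 0 i = 0"
    and eqz: "\<And>t j. j < k \<Longrightarrow> z t j = c t * t * u j + t * (\<Sum>i<k. C i j * z t i)"
    by (rule cramer_polyfun[of k u C]) blast
  define F where "F t v = affine_mat (dimv M v) (c t) k (z t) (\<lambda>i. s i v)" for t v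
  have sc: "s i v \<in> carrier_mat (dimv M v) (dimv M v)" if "i < k" "v \<in> verts Q" for i v
    using khomD(1)[OF s that(2)] that by blast
  have Fc: "F t v \<in> carrier_mat (dimv M v) (dimv M v)" for t v by (simp add: F_def)
  have F_mult: "(F t v * X) $$ (p, q) = c t * X $$ (p, q) + (\<Sum>i<k. z t i * (s i v * X) $$ (p, q))"
    if "v \<in> verts Q" "X \<in> carrier_mat (dimv M v) m" "p < dimv M v" "q < m" for t v X m p q
    unfolding F_def by (rule affine_mat_mult_index[OF sc[OF _ that(1)] that(2-4)])
  have mult_F: "(X * F t v) $$ (p, q) = c t * X $$ (p, q) + (\<Sum>i<k. z t i * (X * s i v) $$ (p, q))"
    if "v \<in> verts Q" "X \<in> carrier_mat m (dimv M v)" "p < m" "q < dimv M v" for t v X m p q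
    unfolding F_def by (rule mult_affine_mat_index[OF sc[OF _ that(1)] that(2-4)])
  have "polyfun (\<lambda>t. det (F t v))" if v: "v \<in> verts Q" for v
  proof (rule polyfun_det[OF Fc])
    fix p q assume pq: "p < dimv M v" "q < dimv M v"
    have "F t v $$ (p, q) = c t * (if p = q then 1 else 0) + (\<Sum>i<k. z t i * s i v $$ (p, q))" for t
      unfolding F_def by (rule affine_mat_index[OF sc[OF _ v] pq])
    then show "polyfun (\<lambda>t. F t v $$ (p, q))"
      using c z by (auto intro!: polyfun_add polyfun_mult polyfun_sum)
  qed
  then have "polyfun (\<lambda>t. \<Prod>v\<in>verts Q. det (F t v))" by (rule polyfun_prod)
  \<comment> \<open>One polynomial controls invertibility at all vertices simultaneously; at t = 0
    every factor is the determinant of an identity matrix.\<close>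
  then obtain P where P: "\<And>t. (\<Prod>v\<in>verts Q. det (F t v)) = poly P t" unfolding polyfun_def by blast
  have "F 0 v = 1\<^sub>m (dimv M v)" if v: "v \<in> verts Q" for v
  proof (rule eq_matI)
    fix p q assume "p < dim_row (1\<^sub>m (dimv M v) :: 'k mat)" "q < dim_col (1\<^sub>m (dimv M v) :: 'k mat)"
    then show "F 0 v $$ (p, q) = 1\<^sub>m (dimv M v) $$ (p, q)"
      unfolding F_def by (subst affine_mat_index[OF sc[OF _ v]]) (auto simp: c z)
  qed (use Fc in auto)
  then have "poly P 0 = 1" unfolding P[symmetric] by simp
  moreover have "iso_Dmod Q M (M\<lparr>darr := \<lambda>a. darr M a + t \<cdot>\<^sub>m \<zeta> a\<rparr>)" if t: "poly P t \<noteq> 0" for t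
  proof -
    let ?N = "M\<lparr>darr := \<lambda>a. darr M a + t \<cdot>\<^sub>m \<zeta> a\<rparr>"
    have MM: "is_Dmod Q (M\<lparr>darr := darr M\<rparr>)" using M by simp
    have N: "is_Dmod Q ?N" by (rule Dmod_darr_lincomb[OF MM zeta])
    have "is_hom Q M ?N (F t)"
      unfolding is_hom_def
    proof (intro conjI ballI)
      fix v show "F t v \<in> carrier_mat (dimv ?N v) (dimv M v)" using Fc by simp
    next
      fix a assume a: "a \<in> arrs Q"
      let ?s = "src Q a" and ?t = "tgt Q a"
      note cc = DmodD(1,2)[OF M a] Dmod_darrD(2)[OF zeta a]
      note st = sc[OF _ tgt_in[OF a]]
      have "F t ?t * arr M a = arr M a * F t ?s"
      proof (rule eq_matI)
        fix p q assume "p < dim_row (arr M a * F t ?s)" "q < dim_col (arr M a * F t ?s)"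
        then have pq: "p < dimv M ?t" "q < dimv M ?s" using cc Fc[of t ?s] by auto
        show "(F t ?t * arr M a) $$ (p, q) = (arr M a * F t ?s) $$ (p, q)"
          unfolding F_mult[OF tgt_in[OF a] cc(1) pq] mult_F[OF src_in[OF a] cc(1) pq]
          using khomD(2)[OF s a] by simp
      qed (use cc Fc[of t ?s] Fc[of t ?t] in auto)
      then show "F t ?t * arr M a = arr ?N a * F t ?s" by simp
      have "F t ?s * darr M a = (darr M a + t \<cdot>\<^sub>m \<zeta> a) * F t ?t"
      proof (rule eq_matI)
        fix p q assume "p < dim_row ((darr M a + t \<cdot>\<^sub>m \<zeta> a) * F t ?t)" "q < dim_col ((darr M a + t \<cdot>\<^sub>m \<zeta> a) * F t ?t)"
        then have pq: "p < dimv M ?s" "q < dimv M ?t" using cc Fc[of t ?t] by auto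
        let ?r = "\<lambda>i. r i a $$ (p, q)" and ?ds = "\<lambda>i. (darr M a * s i ?t) $$ (p, q)"
        have "(s i ?s * darr M a) $$ (p, q) = ?ds i + ?r i" if i: "i < k" for i
          unfolding sr[OF i a, symmetric] using cc st[OF i] pq by simp
        then have L: "(F t ?s * darr M a) $$ (p, q) = c t * darr M a $$ (p, q) + (\<Sum>i<k. z t i * (?ds i + ?r i))"
          unfolding F_mult[OF src_in[OF a] cc(2) pq] by simp
        have tm: "t \<cdot>\<^sub>m \<zeta> a \<in> carrier_mat (dimv M ?s) (dimv M ?t)" using cc by simp
        have "((darr M a + t \<cdot>\<^sub>m \<zeta> a) * F t ?t) $$ (p, q) = (darr M a * F t ?t) $$ (p, q) + t * (\<zeta> a * F t ?t) $$ (p, q)"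
          unfolding add_mult_distrib_mat[OF cc(2) tm Fc] mult_smult_assoc_mat[OF cc(3) Fc]
          using pq cc(3) Fc[of t ?t] by simp
        also have "\<dots> = c t * darr M a $$ (p, q) + (\<Sum>i<k. z t i * ?ds i)
            + t * (c t * (\<Sum>j<k. u j * ?r j) + (\<Sum>i<k. z t i * (\<Sum>j<k. C i j * ?r j)))"
          unfolding mult_F[OF tgt_in[OF a] cc(2) pq] mult_F[OF tgt_in[OF a] cc(3) pq]
          using u[OF a pq] C[OF _ a pq] by simp
        \<comment> \<open>This is the linear system for z, multiplied by the entries of r j and
          summed over j.\<close>
        also have "t * (c t * (\<Sum>j<k. u j * ?r j) + (\<Sum>i<k. z t i * (\<Sum>j<k. C i j * ?r j))) = (\<Sum>j<k. z t j * ?r j)"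
        proof -
          have "(\<Sum>j<k. z t j * ?r j) = (\<Sum>j<k. c t * t * u j * ?r j) + (\<Sum>j<k. \<Sum>i<k. t * (z t i * (C i j * ?r j)))"
            unfolding sum.distrib[symmetric]
          proof (intro sum.cong refl)
            fix j assume "j \<in> {..<k}"
            then have "z t j = c t * t * u j + t * (\<Sum>i<k. C i j * z t i)" using eqz by simp
            then have "z t j * ?r j = c t * t * u j * ?r j + t * (\<Sum>i<k. C i j * z t i) * ?r j"
              by (metis distrib_right)
            also have "t * (\<Sum>i<k. C i j * z t i) * ?r j = (\<Sum>i<k. t * (z t i * (C i j * ?r j)))"
              by (simp add: sum_distrib_left sum_distrib_right mult_ac)
            finally show "z t j * ?r j = c t * t * u j * ?r j + (\<Sum>i<k. t * (z t i * (C i j * ?r j)))" .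
          qed
          also have "(\<Sum>j<k. \<Sum>i<k. t * (z t i * (C i j * ?r j))) = (\<Sum>i<k. \<Sum>j<k. t * (z t i * (C i j * ?r j)))"
            by (rule sum.swap)
          finally show ?thesis by (simp add: sum_distrib_left distrib_left mult_ac)
        qed
        finally show "(F t ?s * darr M a) $$ (p, q) = ((darr M a + t \<cdot>\<^sub>m \<zeta> a) * F t ?t) $$ (p, q)"
          unfolding L by (simp add: distrib_left sum.distrib)
      qed (use cc Fc[of t ?s] Fc[of t ?t] in auto)
      then show "F t ?s * darr M a = darr ?N a * F t ?t" by simp
    qed
    moreover have "det (F t v) \<noteq> 0" if "v \<in> verts Q" for v
      using t P[of t, symmetric] fin_verts that by auto
    then have "\<forall>v\<in>verts Q. \<exists>B. B \<in> carrier_mat (dimv M v) (dimv M v) \<and> B * F t v = 1\<^sub>m (dimv M v) \<and> F t v * B = 1\<^sub>m (dimv M v)"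
      using det_nonzero_inverse[OF Fc] by blast
    from bchoice[OF this] obtain g where g: "\<And>v. v \<in> verts Q \<Longrightarrow> g v \<in> carrier_mat (dimv M v) (dimv M v)"
      "\<And>v. v \<in> verts Q \<Longrightarrow> g v * F t v = 1\<^sub>m (dimv M v)" "\<And>v. v \<in> verts Q \<Longrightarrow> F t v * g v = 1\<^sub>m (dimv M v)" by blast
    ultimately show ?thesis by (intro hom_inverse[OF M N, of "F t" g]) (use g in auto)
  qed
  ultimately show ?thesis by (intro exI[of _ P]) auto
qed

text \<open>The two parametrisations of the line used below are known to agree only on the arrows of
  Q, where the matrices have the right sizes.\<close>

lemma iso_darr_cong:
  fixes M N :: "('v, 'a, 'k::field) drep"
  assumes "\<And>a. a \<in> arrs Q \<Longrightarrow> \<eta> a = \<delta> a" "iso_Dmod Q M (N\<lparr>darr := \<delta>\<rparr>)"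
  shows "iso_Dmod Q M (N\<lparr>darr := \<eta>\<rparr>)"
  using assms unfolding iso_Dmod_def is_hom_def by simp

lemma exceptional_same_arr_iso:
  fixes M :: "('v, 'a, 'k::field_char_0) drep"
  assumes M: "is_Dmod Q M" and N: "is_Dmod Q (M\<lparr>darr := \<eta>\<rparr>)"
    and ex: "exceptional Q M" "exceptional Q (M\<lparr>darr := \<eta>\<rparr>)"
  shows "iso_Dmod Q M (M\<lparr>darr := \<eta>\<rparr>)"
proof -
  let ?N = "M\<lparr>darr := \<eta>\<rparr>"
  let ?z = "\<lambda>a. \<eta> a + (- 1) \<cdot>\<^sub>m darr M a" and ?z' = "\<lambda>a. darr M a + (- 1) \<cdot>\<^sub>m \<eta> a"
  have MM: "is_Dmod Q (M\<lparr>darr := darr M\<rparr>)" using M by simp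
  have z: "is_Dmod Q (M\<lparr>darr := ?z\<rparr>)" by (rule Dmod_darr_lincomb[OF N MM])
  have z': "is_Dmod Q (M\<lparr>darr := ?z'\<rparr>)" by (rule Dmod_darr_lincomb[OF MM N])
  then have z'': "is_Dmod Q (?N\<lparr>darr := ?z'\<rparr>)" by simp
  obtain P where P: "poly P 0 \<noteq> 0" "\<And>t. poly P t \<noteq> 0 \<Longrightarrow> iso_Dmod Q M (M\<lparr>darr := \<lambda>a. darr M a + t \<cdot>\<^sub>m ?z a\<rparr>)"
    using generic_deformation_iso[OF M exceptional_imp_inner[OF M ex(1)] z] by blast
  obtain P' where P': "poly P' 0 \<noteq> 0" "\<And>t. poly P' t \<noteq> 0 \<Longrightarrow> iso_Dmod Q ?N (?N\<lparr>darr := \<lambda>a. darr ?N a + t \<cdot>\<^sub>m ?z' a\<rparr>)"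
    using generic_deformation_iso[OF N exceptional_imp_inner[OF N ex(2)] z''] by blast
  \<comment> \<open>Seen from the other end, the line has parameter 1 - t, so both families of
    isomorphisms are available where P at t and P' at 1 - t are nonzero. The second factor is not
    the zero polynomial because its value at 1 is P' at 0. An infinite field contains a t that
    avoids the finitely many roots.\<close>
  let ?R = "P * pcompose P' [:1, - 1:]"
  have "P \<noteq> 0" using P(1) by auto
  moreover have "pcompose P' [:1, - 1:] \<noteq> 0"
  proof
    assume "pcompose P' [:1, - 1:] = 0"
    then have "poly (pcompose P' [:1, - 1:]) 1 = 0" by simp
    then show False using P'(1) by (simp add: poly_pcompose)
  qed
  ultimately have "finite {t. poly ?R t = 0}" by (intro poly_roots_finite) simp
  then obtain t where t: "poly ?R t \<noteq> 0" using infinite_UNIV_char_0[where 'a = 'k] by (metis (mono_tags, lifting) UNIV_eq_I mem_Collect_eq)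
  have 1: "iso_Dmod Q M (M\<lparr>darr := \<lambda>a. darr M a + t \<cdot>\<^sub>m ?z a\<rparr>)"
    by (rule P(2)) (use t in auto)
  have "iso_Dmod Q ?N (?N\<lparr>darr := \<lambda>a. darr ?N a + (1 - t) \<cdot>\<^sub>m ?z' a\<rparr>)"
    by (rule P'(2)) (use t in \<open>auto simp: poly_pcompose\<close>)
  then have 2: "iso_Dmod Q ?N (M\<lparr>darr := \<lambda>a. \<eta> a + (1 - t) \<cdot>\<^sub>m ?z' a\<rparr>)" by simp
  have eq: "darr M a + t \<cdot>\<^sub>m ?z a = \<eta> a + (1 - t) \<cdot>\<^sub>m ?z' a" if a: "a \<in> arrs Q" for a
    using DmodD(2)[OF M a] Dmod_darrD(2)[OF N a] by (intro eq_matI) (auto simp: algebra_simps)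
  have 3: "iso_Dmod Q ?N (M\<lparr>darr := \<lambda>a. darr M a + t \<cdot>\<^sub>m ?z a\<rparr>)"
    by (rule iso_darr_cong[OF eq 2])
  have "is_Dmod Q (M\<lparr>darr := \<lambda>a. darr M a + t \<cdot>\<^sub>m ?z a\<rparr>)" by (rule Dmod_darr_lincomb[OF MM z])
  from iso_trans[OF M this N 1 iso_sym[OF 3]] show ?thesis .
qed

text \<open>Equal delta-dimension vectors make M and N isomorphic over \<open>kQ\<close>.
  Transporting the starred arrows of N along this isomorphism gives a copy of N with the same
  unstarred arrows as M, and the two lie on a common line of module structures.\<close>

theorem exceptional_unique:
  fixes M N :: "('v, 'a, 'k::field_char_0) drep"
  assumes M: "is_Dmod Q M" "exceptional Q M" "delta_dim Q M d"
    and N: "is_Dmod Q N" "exceptional Q N" "delta_dim Q N d"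
  shows "iso_Dmod Q M N"
proof -
  obtain f g where f: "is_khom Q M N f" and g: "is_khom Q N M g"
    and gf: "\<And>v. v \<in> verts Q \<Longrightarrow> g v * f v = 1\<^sub>m (dimv M v)" and fg: "\<And>v. v \<in> verts Q \<Longrightarrow> f v * g v = 1\<^sub>m (dimv N v)"
    by (rule delta_dim_khom_iso[OF Dmod_krep[OF M(1)] M(3) Dmod_krep[OF N(1)] N(3)]) blast
  define \<eta> where "\<eta> a = g (src Q a) * (darr N a * f (tgt Q a))" for a
  let ?N = "M\<lparr>darr := \<eta>\<rparr>"
  have \<eta>c: "\<eta> a \<in> carrier_mat (dimv M (src Q a)) (dimv M (tgt Q a))" if a: "a \<in> arrs Q" for a
    using khomD(1)[OF g src_in[OF a]] DmodD(2)[OF N(1) a] khomD(1)[OF f tgt_in[OF a]] by (auto simp: \<eta>_def)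
  have rel: "\<eta> b * arr M a = g (src Q b) * (darr N b * arr N a) * f (src Q a)"
    if a: "a \<in> arrs Q" and b: "b \<in> arrs Q" and ba: "tgt Q b = tgt Q a" for a b
  proof -
    note c = khomD(1)[OF g src_in[OF b]] DmodD(2)[OF N(1) b, unfolded ba] khomD(1)[OF f tgt_in[OF a]] DmodD(1)[OF M(1) a]
      DmodD(1)[OF N(1) a] khomD(1)[OF f src_in[OF a]]
    have "\<eta> b * arr M a = g (src Q b) * (darr N b * f (tgt Q a) * arr M a)"
      unfolding \<eta>_def ba by (rule assoc_mult_mat[OF c(1) mult_carrier_mat[OF c(2,3)] c(4)])
    also have "darr N b * f (tgt Q a) * arr M a = darr N b * arr N a * f (src Q a)"
      using assoc_mult_mat[OF c(2,3,4)] assoc_mult_mat[OF c(2,5,6)] khomD(2)[OF f a] by simp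
    also have "g (src Q b) * (darr N b * arr N a * f (src Q a)) = g (src Q b) * (darr N b * arr N a) * f (src Q a)"
      by (rule assoc_mult_mat[OF c(1) mult_carrier_mat[OF c(2,5)] c(6), symmetric])
    finally show ?thesis .
  qed
  have D: "is_Dmod Q ?N"
    unfolding is_Dmod_def
  proof (intro conjI ballI impI)
    fix a assume a: "a \<in> arrs Q"
    show "arr ?N a \<in> carrier_mat (dimv ?N (tgt Q a)) (dimv ?N (src Q a))"
      "darr ?N a \<in> carrier_mat (dimv ?N (src Q a)) (dimv ?N (tgt Q a))"
      using DmodD(1)[OF M(1) a] \<eta>c[OF a] by auto
    let ?S = "{g \<in> arrs Q. tgt Q g = src Q a}" and ?v = "src Q a"
    let ?m = "dimv M ?v" and ?n = "dimv N ?v"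
    note c = khomD(1)[OF g src_in[OF a]] khomD(1)[OF f src_in[OF a]]
    have b: "arr N b * darr N b \<in> carrier_mat ?n ?n" "g ?v * (arr N b * darr N b) \<in> carrier_mat ?m ?n"
      "g ?v * (arr N b * darr N b) * f ?v = arr M b * \<eta> b" if "b \<in> ?S" for b
    proof -
      from that have b: "b \<in> arrs Q" and ba: "tgt Q b = ?v" by auto
      note cb = DmodD(1,2)[OF N(1) b, unfolded ba] khomD(1)[OF g src_in[OF b]] DmodD(1)[OF M(1) b, unfolded ba]
      show "arr N b * darr N b \<in> carrier_mat ?n ?n" using cb by auto
      then show "g ?v * (arr N b * darr N b) \<in> carrier_mat ?m ?n" using c by auto
      have "g ?v * (arr N b * darr N b) * f ?v = g ?v * arr N b * darr N b * f ?v"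
        using assoc_mult_mat[OF c(1) cb(1,2)] by simp
      also have "\<dots> = arr M b * g (src Q b) * darr N b * f ?v"
        using khomD(2)[OF g b] by (simp add: ba)
      also have "\<dots> = arr M b * g (src Q b) * (darr N b * f ?v)"
        by (rule assoc_mult_mat[OF mult_carrier_mat[OF cb(4,3)] cb(2) c(2)])
      also have "\<dots> = arr M b * \<eta> b"
        unfolding \<eta>_def ba by (rule assoc_mult_mat[OF cb(4,3) mult_carrier_mat[OF cb(2) c(2)]])
      finally show "g ?v * (arr N b * darr N b) * f ?v = arr M b * \<eta> b" .
    qed
    have "\<eta> a * arr M a = g ?v * msum ?n ?n ?S (\<lambda>b. arr N b * darr N b) * f ?v"
      using rel[OF a a refl] DmodD(3)[OF N(1) a] by simp
    also have "g ?v * msum ?n ?n ?S (\<lambda>b. arr N b * darr N b) = msum ?m ?n ?S (\<lambda>b. g ?v * (arr N b * darr N b))"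
      by (rule mult_msum[OF c(1)]) (use b in blast)
    also have "\<dots> * f ?v = msum ?m ?m ?S (\<lambda>b. g ?v * (arr N b * darr N b) * f ?v)"
      by (rule msum_mult[OF c(2)]) (use b in blast)
    also have "\<dots> = msum ?m ?m ?S (\<lambda>b. arr M b * \<eta> b)"
      by (rule msum_cong) (use b in blast)
    finally show "darr ?N a * arr ?N a = msum (dimv ?N ?v) (dimv ?N ?v) ?S (\<lambda>b. arr ?N b * darr ?N b)" by simp
  next
    fix a b assume a: "a \<in> arrs Q" and b: "b \<in> arrs Q" and ab: "a \<noteq> b \<and> tgt Q a = tgt Q b"
    then show "darr ?N b * arr ?N a = 0\<^sub>m (dimv ?N (src Q b)) (dimv ?N (src Q a))"
      using rel[OF a b] DmodD(4)[OF N(1) a b] khomD(1)[OF g src_in[OF b]] khomD(1)[OF f src_in[OF a]] by simp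
  qed
  have "is_hom Q ?N N f"
    unfolding is_hom_def
  proof (intro conjI ballI)
    fix v assume "v \<in> verts Q"
    then show "f v \<in> carrier_mat (dimv N v) (dimv ?N v)" using khomD(1)[OF f] by simp
  next
    fix a assume a: "a \<in> arrs Q"
    note c = khomD(1)[OF f src_in[OF a]] khomD(1)[OF g src_in[OF a]] DmodD(2)[OF N(1) a] khomD(1)[OF f tgt_in[OF a]]
    show "f (tgt Q a) * arr ?N a = arr N a * f (src Q a)" using khomD(2)[OF f a] by simp
    have "f (src Q a) * \<eta> a = f (src Q a) * g (src Q a) * (darr N a * f (tgt Q a))"
      unfolding \<eta>_def by (rule assoc_mult_mat[OF c(1,2) mult_carrier_mat[OF c(3,4)], symmetric])
    then show "f (src Q a) * darr ?N a = darr N a * f (tgt Q a)"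
      using fg[OF src_in[OF a]] left_mult_one_mat[OF mult_carrier_mat[OF c(3,4)]] by simp
  qed
  then have iso: "iso_Dmod Q ?N N"
    by (rule hom_inverse[OF D N(1), of f g]) (use khomD(1)[OF g] gf fg in auto)
  have "exceptional Q ?N" by (rule exceptional_iso[OF N(1) D iso_sym[OF iso] N(2)])
  then have "iso_Dmod Q M ?N" by (rule exceptional_same_arr_iso[OF M(1) D M(2)])
  then show ?thesis by (rule iso_trans[OF M(1) D N(1) _ iso])
qed

end

section \<open>The module of a block matrix\<close>

lemma quiverA_simps [simp]:
  "verts (quiverA n orient) = {1..n}" "arrs (quiverA n orient) = {1..<n}"
  "src (quiverA n orient) a = (if orient a then a else a + 1)"
  "tgt (quiverA n orient) a = (if orient a then a + 1 else a)"
  by (simp_all add: quiverA_def)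

lemma finite_quiverA: "finite_quiver (quiverA n orient)"
  by unfold_locales auto

lemma reach_step: "reach orient (src (quiverA n orient) a) (tgt (quiverA n orient) a)"
  by (auto simp: reach_def less_Suc_eq)

lemma not_reach_back: "\<not> reach orient (tgt (quiverA n orient) a) (src (quiverA n orient) a)"
  using reach_antisym[OF reach_step[of orient n a]] by (auto split: if_splits)

text \<open>Two different arrows into a vertex come from opposite sides of it. Reaching the source
  on the far side would mean traversing the arrow there against its direction.\<close>

lemma incoming_arrow_unique:
  assumes "tgt (quiverA n orient) a = tgt (quiverA n orient) b"
    and "reach orient j (src (quiverA n orient) a)" "reach orient j (src (quiverA n orient) b)"
  shows "a = b"
proof (rule ccontr)
  have wlog: False if "orient a" "\<not> orient b" "a + 1 = b" "reach orient j a" "reach orient j (b + 1)" for a b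
  proof (cases "j \<le> b")
    case True
    then show False using that unfolding reach_def by (metis less_add_one)
  next
    case False
    then have "a \<le> a \<and> a < j" using that by auto
    then show False using that unfolding reach_def by blast
  qed
  assume "a \<noteq> b"
  then show False using assms wlog[of a b] wlog[of b a] by (auto split: if_splits)
qed

lemma outgoing_arrow_unique:
  assumes "src (quiverA n orient) a = src (quiverA n orient) b"
    and "reach orient (tgt (quiverA n orient) a) v" "reach orient (tgt (quiverA n orient) b) v"
  shows "a = b"
proof -
  have opp: "src (quiverA n orient) c = tgt (quiverA n (\<lambda>k. \<not> orient k)) c" "tgt (quiverA n orient) c = src (quiverA n (\<lambda>k. \<not> orient k)) c" for c
    by auto
  show ?thesis
    using assms unfolding opp reach_opposite[of orient, symmetric] by (rule incoming_arrow_unique)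
qed

text \<open>The arrow next to v on the side of j; the decrease in distance is what
  \<open>reach_induct\<close> recurses on.\<close>

lemma last_arrow:
  assumes "reach orient j v" "j \<noteq> v" "j \<in> {1..n}" "v \<in> {1..n}"
  obtains a where "a \<in> arrs (quiverA n orient)" "tgt (quiverA n orient) a = v" "reach orient j (src (quiverA n orient) a)"
    "\<bar>int (src (quiverA n orient) a) - int j\<bar> < \<bar>int v - int j\<bar>"
proof (cases "j < v")
  case True
  then have o: "orient (v - 1)" using assms unfolding reach_def by (metis Suc_pred' add_leE diff_less gr_zeroI less_one not_less_eq less_Suc_eq_le not_less_zero)
  show ?thesis
    by (rule that[of "v - 1"]) (use True o assms in \<open>auto simp: reach_def\<close>)
next
  case False
  then have o: "\<not> orient v" using assms unfolding reach_def by (metis le_refl linorder_neqE_nat)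
  show ?thesis
    by (rule that[of v]) (use False o assms in \<open>auto simp: reach_def\<close>)
qed

lemma reach_induct:
  assumes "reach orient j v" "j \<in> {1..n}" "v \<in> {1..n}" and base: "P j"
    and step: "\<And>a. a \<in> arrs (quiverA n orient) \<Longrightarrow> reach orient j (src (quiverA n orient) a) \<Longrightarrow>
       P (src (quiverA n orient) a) \<Longrightarrow> P (tgt (quiverA n orient) a)"
  shows "P v"
  using assms(1,3)
proof (induction "nat \<bar>int v - int j\<bar>" arbitrary: v rule: less_induct)
  case less
  show ?case
  proof (cases "j = v")
    case False
    obtain a where a: "a \<in> arrs (quiverA n orient)" "tgt (quiverA n orient) a = v" "reach orient j (src (quiverA n orient) a)"
      "\<bar>int (src (quiverA n orient) a) - int j\<bar> < \<bar>int v - int j\<bar>"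
      using last_arrow[OF less.prems(1) False assms(2) less.prems(2)] by blast
    have "src (quiverA n orient) a \<in> {1..n}" using a(1) by auto
    then have "P (src (quiverA n orient) a)" using less.hyps[OF _ a(3)] a(4) by linarith
    then show ?thesis using step[OF a(1,3)] a(2) by simp
  qed (use base in simp)
qed

text \<open>With \<open>path_exists\<close> and \<open>path_unique\<close> this identifies
  \<open>reach\<close>, which is read off the orientation alone, with the existence of a path, then
  unique. Pairs (j, l) can thus replace triples (j, l, p) as basis labels.\<close>

lemma path_reach: "is_path (quiverA n orient) j p v \<Longrightarrow> reach orient j v"
proof (induction p arbitrary: j)
  case (Cons a p)
  then have "reach orient (tgt (quiverA n orient) a) v" "src (quiverA n orient) a = j" unfolding is_path.simps by blast+
  then show ?case using reach_trans[OF reach_step[of orient n a]] by simp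
qed simp

lemma path_unique:
  "is_path (quiverA n orient) j p v \<Longrightarrow> is_path (quiverA n orient) j q v \<Longrightarrow> p = q"
proof (induction p arbitrary: j q)
  case Nil
  then have jv: "j = v" by simp
  show ?case
  proof (cases q)
    case (Cons b q')
    then have "reach orient (tgt (quiverA n orient) b) v" "src (quiverA n orient) b = j"
      using Nil path_reach[of n orient "tgt (quiverA n orient) b" q' v] unfolding Cons is_path.simps by blast+
    then show ?thesis using not_reach_back[of orient n b] jv by simp
  qed simp
next
  case (Cons a p)
  then have a: "reach orient (tgt (quiverA n orient) a) v" "src (quiverA n orient) a = j" "is_path (quiverA n orient) (tgt (quiverA n orient) a) p v"
    using path_reach unfolding is_path.simps by blast+
  show ?case
  proof (cases q)
    case Nil
    then show ?thesis using Cons.prems(2) a not_reach_back[of orient n a] by simp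
  next
    fix b q' assume q: "q = b # q'"
    have b: "reach orient (tgt (quiverA n orient) b) v" "src (quiverA n orient) b = j" "is_path (quiverA n orient) (tgt (quiverA n orient) b) q' v"
      using Cons.prems(2) path_reach unfolding q is_path.simps by blast+
    have "a = b" by (rule outgoing_arrow_unique[OF _ a(1) b(1)]) (use a b in simp)
    then show ?thesis using Cons.IH[OF a(3)] b(3) q by simp
  qed
qed

lemma path_exists:
  assumes "reach orient j v" "j \<in> {1..n}" "v \<in> {1..n}"
  shows "\<exists>p. is_path (quiverA n orient) j p v"
proof (rule reach_induct[OF assms])
  show "\<exists>p. is_path (quiverA n orient) j p j" by (rule exI[of _ "[]"]) simp
next
  fix a assume "a \<in> arrs (quiverA n orient)" "\<exists>p. is_path (quiverA n orient) j p (src (quiverA n orient) a)"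
  then show "\<exists>p. is_path (quiverA n orient) j p (tgt (quiverA n orient) a)" using is_path_snoc by metis
qed

section \<open>The module built from x, with its relations, derivations and generators\<close>

locale typeA =
  fixes n :: nat and orient :: "nat \<Rightarrow> bool" and d :: "nat \<Rightarrow> nat" and TYP :: "'k::field itself"
begin

abbreviation "Q \<equiv> quiverA n orient"

sublocale finite_quiver Q by (rule finite_quiverA)

text \<open>The pair \<open>(j, l) \<in> Bv v\<close> labels the image of the \<open>l\<close>-th generator of \<open>\<Delta>(j)\<close> under the unique path from
  \<open>j\<close> to \<open>v\<close>; in these bases every arrow acts as an inclusion.\<close>
definition Bv :: "nat \<Rightarrow> (nat \<times> nat) set" where
  "Bv v = {p \<in> blocks d n. reach orient (fst p) v}"

definition dm :: "nat \<Rightarrow> nat" where "dm v = card (Bv v)"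

text \<open>An arbitrary numbering of the labels at v, since matrix indices are numbers;
  \<open>pos\<close> is its inverse.\<close>

definition enum :: "nat \<Rightarrow> nat \<Rightarrow> nat \<times> nat" where
  "enum v = (SOME f. bij_betw f {..<dm v} (Bv v))"

definition pos :: "nat \<Rightarrow> nat \<times> nat \<Rightarrow> nat" where
  "pos v = inv_into {..<dm v} (enum v)"

lemma finite_Bv [simp]: "finite (Bv v)"
  by (rule finite_subset[of _ "blocks d n"]) (auto simp: Bv_def)

lemma enum_bij: "bij_betw (enum v) {..<dm v} (Bv v)"
proof -
  have "\<exists>f. bij_betw f {..<dm v} (Bv v)"
    using ex_bij_betw_nat_finite[OF finite_Bv] by (simp add: dm_def lessThan_atLeast0)
  from someI_ex[OF this] show ?thesis unfolding enum_def .
qed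

lemma enum_in: "i < dm v \<Longrightarrow> enum v i \<in> Bv v"
  using enum_bij unfolding bij_betw_def by blast

lemma pos_lt: "p \<in> Bv v \<Longrightarrow> pos v p < dm v"
  using enum_bij unfolding bij_betw_def pos_def by (metis inv_into_into lessThan_iff)

lemma enum_pos: "p \<in> Bv v \<Longrightarrow> enum v (pos v p) = p"
  using enum_bij unfolding bij_betw_def pos_def by (metis f_inv_into_f)

lemma pos_enum: "i < dm v \<Longrightarrow> pos v (enum v i) = i"
  using enum_bij unfolding bij_betw_def pos_def by (metis inv_into_f_f lessThan_iff)

text \<open>The dictionary between structure matrices and entries labelled by pairs. By
  \<open>MM_cong\<close> and \<open>MM_inj\<close>, equality of matrices is equality of labelled
  entries, so the numbering disappears from all later arguments.\<close>

definition MM :: "nat \<Rightarrow> nat \<Rightarrow> 'k imat \<Rightarrow> 'k mat" where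
  "MM v w f = mat (dm v) (dm w) (\<lambda>(i, j). f (enum v i) (enum w j))"

lemma MM_carrier [simp]: "MM v w f \<in> carrier_mat (dm v) (dm w)"
  by (simp add: MM_def)

lemma MM_cong: "(\<And>p q. p \<in> Bv v \<Longrightarrow> q \<in> Bv w \<Longrightarrow> f p q = g p q) \<Longrightarrow> MM v w f = MM v w g"
  unfolding MM_def by (rule cong_mat) (auto simp: enum_in)

lemma MM_inj: "MM v w f = MM v w g \<Longrightarrow> p \<in> Bv v \<Longrightarrow> q \<in> Bv w \<Longrightarrow> f p q = g p q"
proof -
  assume eq: "MM v w f = MM v w g" and pq: "p \<in> Bv v" "q \<in> Bv w"
  show "f p q = g p q"
    using arg_cong[OF eq, of "\<lambda>A. A $$ (pos v p, pos w q)"] pos_lt[OF pq(1)] pos_lt[OF pq(2)] pq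
    by (simp add: MM_def enum_pos)
qed

lemma MM_surj:
  assumes "X \<in> carrier_mat (dm v) (dm w)"
  shows "X = MM v w (\<lambda>p q. X $$ (pos v p, pos w q))"
  using assms by (intro eq_matI) (auto simp: MM_def pos_enum)

lemma MM_mult: "MM u v f * MM v w g = MM u w (\<lambda>p q. \<Sum>r\<in>Bv v. f p r * g r q)"
proof (rule eq_matI)
  fix i j assume "i < dim_row (MM u w (\<lambda>p q. \<Sum>r\<in>Bv v. f p r * g r q))" "j < dim_col (MM u w (\<lambda>p q. \<Sum>r\<in>Bv v. f p r * g r q))"
  then have ij: "i < dm u" "j < dm w" by (auto simp: MM_def)
  have "(MM u v f * MM v w g) $$ (i, j) = (\<Sum>k<dm v. f (enum u i) (enum v k) * g (enum v k) (enum w j))"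
    using ij by (simp add: MM_def scalar_prod_def lessThan_atLeast0)
  also have "\<dots> = (\<Sum>r\<in>Bv v. f (enum u i) r * g r (enum w j))"
    by (rule sum.reindex_bij_betw[OF enum_bij, of "\<lambda>r. f (enum u i) r * g r (enum w j)"])
  finally show "(MM u v f * MM v w g) $$ (i, j) = MM u w (\<lambda>p q. \<Sum>r\<in>Bv v. f p r * g r q) $$ (i, j)"
    using ij by (simp add: MM_def)
qed (auto simp: MM_def)

lemma msum_MM: "msum (dm v) (dm w) S (\<lambda>x. MM v w (F x)) = MM v w (\<lambda>p q. \<Sum>x\<in>S. F x p q)"
  by (rule eq_matI) (auto simp: msum_def MM_def)

lemma MM_diff: "MM v w f - MM v w g = MM v w (\<lambda>p q. f p q - g p q)"
  by (rule eq_matI) (auto simp: MM_def)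

abbreviation incl :: "'k imat" where "incl p q \<equiv> (if p = q then 1 else 0)"

text \<open>One x serves every arrow, because the starred arrows are the components of a single
  endomorphism; at the arrow a the component in the image of a is kept.\<close>

definition xrep :: "'k imat \<Rightarrow> (nat, nat, 'k) drep" where
  "xrep x = \<lparr>dimv = dm, arr = (\<lambda>a. MM (tgt Q a) (src Q a) incl), darr = (\<lambda>a. MM (src Q a) (tgt Q a) x)\<rparr>"

lemma Bv_step: "p \<in> Bv (src Q a) \<Longrightarrow> p \<in> Bv (tgt Q a)"
  using reach_trans reach_step unfolding Bv_def by blast

lemma Bv_unique: "p \<in> Bv (src Q a) \<Longrightarrow> p \<in> Bv (src Q b) \<Longrightarrow> tgt Q a = tgt Q b \<Longrightarrow> a = b"
  using incoming_arrow_unique unfolding Bv_def by blast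

text \<open>A basis vector at v is either a generator at v or comes through the last arrow of its
  path.\<close>

lemma Bv_cases:
  assumes "p \<in> Bv v" "v \<in> verts Q"
  obtains "fst p = v" | a where "a \<in> arrs Q" "tgt Q a = v" "p \<in> Bv (src Q a)"
proof (cases "fst p = v")
  case False
  have "reach orient (fst p) v" "fst p \<in> {1..n}" "p \<in> blocks d n" using assms by (auto simp: Bv_def blocks_def)
  from last_arrow[OF this(1) False this(2) assms(2)[unfolded quiverA_simps(1)]] obtain a where
    "a \<in> arrs Q" "tgt Q a = v" "reach orient (fst p) (src Q a)" by blast
  then show ?thesis using that(2) \<open>p \<in> blocks d n\<close> unfolding Bv_def by blast
qed (use that in blast)

lemma Bv_top: "fst p = tgt Q a \<Longrightarrow> p \<notin> Bv (src Q a)"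
  using not_reach_back unfolding Bv_def by fastforce

text \<open>The entries of the sum of \<open>\<gamma> \<gamma>\<^sup>*\<close> over the arrows
  \<gamma> into v: composing with an inclusion keeps the rows in its image and makes the others
  0.\<close>

definition insum :: "(nat \<Rightarrow> 'k imat) \<Rightarrow> nat \<Rightarrow> 'k imat" where
  "insum G v p q = (\<Sum>g\<in>{g \<in> arrs Q. tgt Q g = v}. if p \<in> Bv (src Q g) then G g p q else 0)"

text \<open>The arrows into one vertex have disjoint images on basis labels, so each row meets at
  most one summand. This recovers a starred arrow from the sum.\<close>

lemma insum_arrow:
  assumes "a \<in> arrs Q" "p \<in> Bv (src Q a)"
  shows "insum G (tgt Q a) p q = G a p q"
proof -
  have "insum G (tgt Q a) p q = (\<Sum>g\<in>{g \<in> arrs Q. tgt Q g = tgt Q a}. if g = a then G a p q else 0)"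
    unfolding insum_def
  proof (rule sum.cong[OF refl])
    fix g assume "g \<in> {g \<in> arrs Q. tgt Q g = tgt Q a}"
    then have "p \<in> Bv (src Q g) \<longleftrightarrow> g = a" using assms(2) Bv_unique by blast
    then show "(if p \<in> Bv (src Q g) then G g p q else 0) = (if g = a then G a p q else 0)" by simp
  qed
  then show ?thesis using assms(1) fin_arrs by (simp del: quiverA_simps)
qed

lemma insum_top: "fst p = v \<Longrightarrow> insum G v p q = 0"
  unfolding insum_def by (rule sum.neutral) (use Bv_top in auto)

lemma mult_arr:
  assumes "tgt Q b = tgt Q a"
  shows "MM v (tgt Q b) g * MM (tgt Q a) (src Q a) incl = MM v (src Q a) g"
  unfolding assms MM_mult
proof (rule MM_cong)
  fix p q assume "q \<in> Bv (src Q a)"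
  then have "q \<in> Bv (tgt Q a)" by (rule Bv_step)
  moreover have "(\<Sum>r\<in>Bv (tgt Q a). g p r * incl r q) = (\<Sum>r\<in>Bv (tgt Q a). if r = q then g p q else 0)"
    by (rule sum.cong) auto
  ultimately show "(\<Sum>r\<in>Bv (tgt Q a). g p r * incl r q) = g p q" by simp
qed

lemma arr_mult: "MM (tgt Q a) (src Q a) incl * MM (src Q a) w g = MM (tgt Q a) w (\<lambda>p q. if p \<in> Bv (src Q a) then g p q else 0)"
  unfolding MM_mult
proof (rule MM_cong)
  fix p q
  have "(\<Sum>r\<in>Bv (src Q a). incl p r * g r q) = (\<Sum>r\<in>Bv (src Q a). if r = p then g p q else 0)"
    by (rule sum.cong) auto
  then show "(\<Sum>r\<in>Bv (src Q a). incl p r * g r q) = (if p \<in> Bv (src Q a) then g p q else 0)" by simp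
qed

text \<open>Composing with an inclusion only restricts columns or extends rows by 0, so both
  relations turn into equations between entries.\<close>

lemma Dmod_MM_iff:
  assumes \<delta>: "\<And>a. a \<in> arrs Q \<Longrightarrow> \<delta> a = MM (src Q a) (tgt Q a) (G a)"
  shows "is_Dmod Q ((xrep x)\<lparr>darr := \<delta>\<rparr>) \<longleftrightarrow>
    (\<forall>a\<in>arrs Q. \<forall>p\<in>Bv (src Q a). \<forall>q\<in>Bv (src Q a). G a p q = insum G (src Q a) p q) \<and>
    (\<forall>a\<in>arrs Q. \<forall>b\<in>arrs Q. a \<noteq> b \<and> tgt Q a = tgt Q b \<longrightarrow> (\<forall>p\<in>Bv (src Q b). \<forall>q\<in>Bv (src Q a). G b p q = 0))"
proof -
  let ?M = "(xrep x)\<lparr>darr := \<delta>\<rparr>"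
  have MM_iff: "MM v w f = MM v w g \<longleftrightarrow> (\<forall>p\<in>Bv v. \<forall>q\<in>Bv w. f p q = g p q)" for v w f g
    using MM_cong MM_inj by blast
  have da: "darr ?M b * arr ?M a = MM (src Q b) (src Q a) (G b)" if "b \<in> arrs Q" "tgt Q b = tgt Q a" for a b
    using \<delta>[OF that(1)] mult_arr[OF that(2)] by (simp add: xrep_def del: quiverA_simps)
  have s: "msum (dimv ?M (src Q a)) (dimv ?M (src Q a)) {g \<in> arrs Q. tgt Q g = src Q a} (\<lambda>g. arr ?M g * darr ?M g)
     = MM (src Q a) (src Q a) (insum G (src Q a))" for a
  proof -
    have "msum (dimv ?M (src Q a)) (dimv ?M (src Q a)) {g \<in> arrs Q. tgt Q g = src Q a} (\<lambda>g. arr ?M g * darr ?M g)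
      = msum (dm (src Q a)) (dm (src Q a)) {g \<in> arrs Q. tgt Q g = src Q a}
          (\<lambda>g. MM (src Q a) (src Q a) (\<lambda>p q. if p \<in> Bv (src Q g) then G g p q else 0))"
    proof -
      have "dimv ?M = dm" by (simp add: xrep_def)
      moreover have "arr ?M g * darr ?M g = MM (src Q a) (src Q a) (\<lambda>p q. if p \<in> Bv (src Q g) then G g p q else 0)"
        if g: "g \<in> arrs Q" "tgt Q g = src Q a" for g
        using \<delta>[OF g(1)] arr_mult[of g "tgt Q g" "G g"] unfolding g(2) by (simp add: xrep_def g(2) del: quiverA_simps)
      ultimately show ?thesis by (simp only:) (rule msum_cong, blast)
    qed
    then show ?thesis unfolding msum_MM insum_def .
  qed
  have z: "0\<^sub>m (dimv ?M v) (dimv ?M w) = MM v w (\<lambda>p q. 0)" for v w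
    by (rule eq_matI) (auto simp: xrep_def MM_def)
  have 1: "(\<forall>a\<in>arrs Q. arr ?M a \<in> carrier_mat (dimv ?M (tgt Q a)) (dimv ?M (src Q a)) \<and>
       darr ?M a \<in> carrier_mat (dimv ?M (src Q a)) (dimv ?M (tgt Q a)))"
    using \<delta> by (simp add: xrep_def del: quiverA_simps)
  have 2: "(\<forall>a\<in>arrs Q. darr ?M a * arr ?M a = msum (dimv ?M (src Q a)) (dimv ?M (src Q a))
         {g \<in> arrs Q. tgt Q g = src Q a} (\<lambda>g. arr ?M g * darr ?M g)) \<longleftrightarrow>
     (\<forall>a\<in>arrs Q. \<forall>p\<in>Bv (src Q a). \<forall>q\<in>Bv (src Q a). G a p q = insum G (src Q a) p q)"
    unfolding s by (rule ball_cong[OF refl]) (simp only: da MM_iff)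
  have 3: "(\<forall>a\<in>arrs Q. \<forall>b\<in>arrs Q. a \<noteq> b \<and> tgt Q a = tgt Q b \<longrightarrow> darr ?M b * arr ?M a = 0\<^sub>m (dimv ?M (src Q b)) (dimv ?M (src Q a)))
     \<longleftrightarrow> (\<forall>a\<in>arrs Q. \<forall>b\<in>arrs Q. a \<noteq> b \<and> tgt Q a = tgt Q b \<longrightarrow> (\<forall>p\<in>Bv (src Q b). \<forall>q\<in>Bv (src Q a). G b p q = 0))"
    unfolding z by (intro ball_cong[OF refl] imp_cong refl) (simp only: da MM_iff)
  show ?thesis unfolding is_Dmod_def 2 3 using 1 by blast
qed

lemma xrep_Dmod:
  assumes x: "supported (blocks d n) (sreach orient) x"
  shows "is_Dmod Q (xrep x)"
proof -
  have "is_Dmod Q ((xrep x)\<lparr>darr := \<lambda>a. MM (src Q a) (tgt Q a) x\<rparr>)"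
  proof (subst Dmod_MM_iff[where G = "\<lambda>_. x"], rule refl, intro conjI ballI impI)
    fix a p q assume a: "a \<in> arrs Q" and p: "p \<in> Bv (src Q a)" and q: "q \<in> Bv (src Q a)"
    show "x p q = insum (\<lambda>_. x) (src Q a) p q"
      using p src_in[OF a]
    proof (cases rule: Bv_cases)
      case 1
      \<comment> \<open>Here p is a generator at the source of a. A nonzero entry would give a
        nontrivial path from there to the vertex of q, which itself has a path back.\<close>
      have "x p q = 0" using x q 1 reach_antisym unfolding supported_def Bv_def by (metis (no_types, lifting) mem_Collect_eq)
      then show ?thesis using insum_top[OF 1] by simp
    next
      case (2 g)
      then show ?thesis using insum_arrow[OF 2(1,3), of "\<lambda>_. x" q] by simp
    qed
  next
    fix a b p q assume ab: "a \<noteq> b \<and> tgt Q a = tgt Q b" and p: "p \<in> Bv (src Q b)" and q: "q \<in> Bv (src Q a)"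
    show "x p q = 0"
    proof (rule ccontr)
      assume "x p q \<noteq> 0"
      then have "p \<in> blocks d n" "reach orient (fst p) (fst q)" using x unfolding supported_def by blast+
      \<comment> \<open>The path from p to q continues to the source of a, so p would come through
        both a and b.\<close>
      then have "p \<in> Bv (src Q a)" using q reach_trans unfolding Bv_def by blast
      then show False using Bv_unique p ab by blast
    qed
  qed
  then show ?thesis by (simp add: xrep_def)
qed

text \<open>The operators \<open>insum G v\<close> commute with the arrows, so they are determined
  by their values on generators, collected in the matrix r of R. Solving [a0, x] = r and reading off
  the component at each arrow gives \<delta> as the commutator with a0.\<close>

lemma xrep_derivations_inner:
  assumes rich: "richardson (blocks d n) (blocks d n) orient x"
  shows "derivations_inner Q (xrep x)"
  unfolding derivations_inner_def
proof (intro allI impI)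
  have x: "supported (blocks d n) (sreach orient) x" using rich by (simp add: richardson_def)
  fix \<delta> assume D: "is_Dmod Q ((xrep x)\<lparr>darr := \<delta>\<rparr>)"
  define G where "G a p q = \<delta> a $$ (pos (src Q a) p, pos (tgt Q a) q)" for a p q
  have \<delta>: "\<delta> a = MM (src Q a) (tgt Q a) (G a)" if "a \<in> arrs Q" for a
    using MM_surj[of "\<delta> a" "src Q a" "tgt Q a"] Dmod_darrD(2)[OF D that] unfolding G_def[abs_def] by (simp add: xrep_def del: quiverA_simps)
  have DD: "(\<forall>a\<in>arrs Q. \<forall>p\<in>Bv (src Q a). \<forall>q\<in>Bv (src Q a). G a p q = insum G (src Q a) p q) \<and>
    (\<forall>a\<in>arrs Q. \<forall>b\<in>arrs Q. a \<noteq> b \<and> tgt Q a = tgt Q b \<longrightarrow> (\<forall>p\<in>Bv (src Q b). \<forall>q\<in>Bv (src Q a). G b p q = 0))"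
    by (rule iffD1[OF Dmod_MM_iff D]) (rule \<delta>)
  have rel1: "G a p q = insum G (src Q a) p q" if "a \<in> arrs Q" "p \<in> Bv (src Q a)" "q \<in> Bv (src Q a)" for a p q
    using DD that by blast
  have rel2: "G b p q = 0" if "a \<in> arrs Q" "b \<in> arrs Q" "a \<noteq> b" "tgt Q a = tgt Q b" "p \<in> Bv (src Q b)" "q \<in> Bv (src Q a)" for a b p q
    using DD that by blast
  \<comment> \<open>Compatibility of \<open>insum\<close> with an arrow a: relation (1) gives the
    rows that come through a, relation (2) kills those that come through another arrow, and
    \<open>insum_top\<close> those that come through none.\<close>
  have step: "insum G (tgt Q a) p q = (if p \<in> Bv (src Q a) then insum G (src Q a) p q else 0)"
    if a: "a \<in> arrs Q" and q: "q \<in> Bv (src Q a)" and p: "p \<in> Bv (tgt Q a)" for a p q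
  proof (cases "p \<in> Bv (src Q a)")
    case True
    then show ?thesis using insum_arrow[OF a True] rel1[OF a True q] by simp
  next
    case False
    have "insum G (tgt Q a) p q = 0"
      using p tgt_in[OF a]
    proof (cases rule: Bv_cases)
      case 1
      then show ?thesis by (rule insum_top)
    next
      case (2 b)
      then have "a \<noteq> b" using False by blast
      then show ?thesis using insum_arrow[OF 2(1,3), of G q] rel2[OF a 2(1) _ _ 2(3) q] 2(2) by simp
    qed
    then show ?thesis using False by simp
  qed
  \<comment> \<open>Following the path of q arrow by arrow shows that column q is the same at every
    vertex as at the vertex where q is a generator.\<close>
  have col: "insum G v p q = (if p \<in> Bv (fst q) then insum G (fst q) p q else 0)"
    if q: "q \<in> Bv v" and v: "v \<in> {1..n}" and p: "p \<in> Bv v" for v p q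
  proof -
    have qB: "reach orient (fst q) v" "fst q \<in> {1..n}" "q \<in> blocks d n" using q by (auto simp: Bv_def blocks_def)
    have "\<forall>p\<in>Bv v. insum G v p q = (if p \<in> Bv (fst q) then insum G (fst q) p q else 0)"
    proof (rule reach_induct[OF qB(1,2) v])
      fix a assume a: "a \<in> arrs Q" and r: "reach orient (fst q) (src Q a)"
        and IH: "\<forall>p\<in>Bv (src Q a). insum G (src Q a) p q = (if p \<in> Bv (fst q) then insum G (fst q) p q else 0)"
      show "\<forall>p\<in>Bv (tgt Q a). insum G (tgt Q a) p q = (if p \<in> Bv (fst q) then insum G (fst q) p q else 0)"
      proof
        fix p assume p: "p \<in> Bv (tgt Q a)"
        have qs: "q \<in> Bv (src Q a)" using r qB by (simp add: Bv_def del: quiverA_simps)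
        have "p \<in> Bv (src Q a)" if "p \<in> Bv (fst q)" using that r reach_trans unfolding Bv_def by blast
        then show "insum G (tgt Q a) p q = (if p \<in> Bv (fst q) then insum G (fst q) p q else 0)"
          using step[OF a qs p] IH by auto
      qed
    qed simp
    then show ?thesis using p by blast
  qed
  \<comment> \<open>Each column is read where its own generator lives. Rows belonging to the same
    vertex vanish there by \<open>insum_top\<close>, which places r in R.\<close>
  define r where "r p q = (if q \<in> blocks d n \<and> p \<in> Bv (fst q) then insum G (fst q) p q else 0)" for p q
  have "supported (blocks d n) (sreach orient) r"
    unfolding supported_def
  proof (intro allI impI)
    fix p q assume "r p q \<noteq> 0"
    then have *: "q \<in> blocks d n" "p \<in> Bv (fst q)" "insum G (fst q) p q \<noteq> 0" by (auto simp: r_def split: if_splits)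
    then have "fst p \<noteq> fst q" using insum_top by blast
    then show "p \<in> blocks d n \<and> q \<in> blocks d n \<and> sreach orient (fst p) (fst q)" using * by (auto simp: Bv_def)
  qed
  then obtain a0 where a0: "supported (blocks d n) (reach orient) a0" "commutator (blocks d n) a0 x = r"
    using rich unfolding richardson_def by blast
  \<comment> \<open>The block pattern of a0 keeps the span of \<open>Bv v\<close> stable at each
    vertex, so its restrictions form an endomorphism over \<open>kQ\<close>.\<close>
  let ?f = "\<lambda>v. MM v v a0"
  have "is_khom Q (xrep x) (xrep x) ?f"
    unfolding is_khom_def
  proof (intro conjI ballI)
    fix v show "?f v \<in> carrier_mat (dimv (xrep x) v) (dimv (xrep x) v)" by (simp add: xrep_def)
  next
    fix a assume a: "a \<in> arrs Q"
    have "MM (tgt Q a) (tgt Q a) a0 * MM (tgt Q a) (src Q a) incl = MM (tgt Q a) (src Q a) a0"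
      by (rule mult_arr) simp
    also have "\<dots> = MM (tgt Q a) (src Q a) (\<lambda>p q. if p \<in> Bv (src Q a) then a0 p q else 0)"
    proof (rule MM_cong)
      fix p q assume q: "q \<in> Bv (src Q a)"
      have "p \<in> Bv (src Q a)" if "a0 p q \<noteq> 0"
        using that a0(1) q reach_trans unfolding supported_def Bv_def by blast
      then show "a0 p q = (if p \<in> Bv (src Q a) then a0 p q else 0)" by (cases "a0 p q = 0") simp_all
    qed
    finally show "?f (tgt Q a) * arr (xrep x) a = arr (xrep x) a * ?f (src Q a)"
      by (simp add: xrep_def arr_mult del: quiverA_simps)
  qed
  moreover have "?f (src Q a) * darr (xrep x) a - darr (xrep x) a * ?f (tgt Q a) = \<delta> a" if a: "a \<in> arrs Q" for a
  proof -
    have "?f (src Q a) * darr (xrep x) a - darr (xrep x) a * ?f (tgt Q a) =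
       MM (src Q a) (tgt Q a) (\<lambda>p q. (\<Sum>u\<in>Bv (src Q a). a0 p u * x u q) - (\<Sum>u\<in>Bv (tgt Q a). x p u * a0 u q))"
      by (simp add: xrep_def MM_mult MM_diff del: quiverA_simps)
    also have "\<dots> = MM (src Q a) (tgt Q a) (G a)"
    proof (rule MM_cong)
      fix p q assume p: "p \<in> Bv (src Q a)" and q: "q \<in> Bv (tgt Q a)"
      have qB: "q \<in> blocks d n" using q by (simp add: Bv_def)
      \<comment> \<open>A contributing u outside \<open>Bv (src Q a)\<close> would still lie in
        \<open>Bv (tgt Q a)\<close>, via q. It cannot be a generator at the target, by antisymmetry
        of paths. If it came through another arrow b, then p would come through both a and
        b.\<close>
      have 1: "(\<Sum>u\<in>Bv (src Q a). a0 p u * x u q) = (\<Sum>u\<in>blocks d n. a0 p u * x u q)"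
      proof (rule sum.mono_neutral_left)
        show "Bv (src Q a) \<subseteq> blocks d n" by (auto simp: Bv_def)
        show "\<forall>u\<in>blocks d n - Bv (src Q a). a0 p u * x u q = 0"
        proof (rule ballI, rule ccontr)
          fix u assume u: "u \<in> blocks d n - Bv (src Q a)" and nz: "a0 p u * x u q \<noteq> 0"
          from nz have "a0 p u \<noteq> 0" "x u q \<noteq> 0" by auto
          then have pu: "reach orient (fst p) (fst u)" and uq: "fst u \<noteq> fst q" "reach orient (fst u) (fst q)"
            using a0(1) x unfolding supported_def by blast+
          have ut: "u \<in> Bv (tgt Q a)" using uq(2) q u reach_trans unfolding Bv_def by blast
          from ut tgt_in[OF a] show False
          proof (cases rule: Bv_cases)
            case 1
            then show ?thesis using uq q reach_antisym unfolding Bv_def by force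
          next
            case (2 b)
            have "p \<in> Bv (src Q b)" using 2(3) pu p reach_trans unfolding Bv_def by blast
            then have "b = a" using p 2(2) Bv_unique by blast
            then show ?thesis using 2(3) u by blast
          qed
        qed
      qed simp
      have 2: "(\<Sum>u\<in>Bv (tgt Q a). x p u * a0 u q) = (\<Sum>u\<in>blocks d n. x p u * a0 u q)"
      proof (rule sum.mono_neutral_left)
        show "Bv (tgt Q a) \<subseteq> blocks d n" by (auto simp: Bv_def)
        show "\<forall>u\<in>blocks d n - Bv (tgt Q a). x p u * a0 u q = 0"
        proof (rule ballI, rule ccontr)
          fix u assume u: "u \<in> blocks d n - Bv (tgt Q a)" and "x p u * a0 u q \<noteq> 0"
          then have "a0 u q \<noteq> 0" by auto
          then have "reach orient (fst u) (fst q)" using a0(1) unfolding supported_def by blast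
          then show False using u q reach_trans unfolding Bv_def by blast
        qed
      qed simp
      have "(\<Sum>u\<in>Bv (src Q a). a0 p u * x u q) - (\<Sum>u\<in>Bv (tgt Q a). x p u * a0 u q) = commutator (blocks d n) a0 x p q"
        unfolding 1 2 commutator_def kmul_def by simp
      also have "\<dots> = insum G (tgt Q a) p q"
        using a0(2) col[OF q tgt_in[OF a, unfolded quiverA_simps(1)] Bv_step[OF p]] qB by (simp add: r_def)
      also have "\<dots> = G a p q" by (rule insum_arrow[OF a p])
      finally show "(\<Sum>u\<in>Bv (src Q a). a0 p u * x u q) - (\<Sum>u\<in>Bv (tgt Q a). x p u * a0 u q) = G a p q" .
    qed
    finally show ?thesis using \<delta>[OF a] by simp
  qed
  ultimately show "\<exists>f. is_khom Q (xrep x) (xrep x) f \<and>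
      (\<forall>a\<in>arrs Q. f (src Q a) * darr (xrep x) a - darr (xrep x) a * f (tgt Q a) = \<delta> a)" by blast
qed

definition bvec :: "nat \<Rightarrow> nat \<times> nat \<Rightarrow> 'k vec" where
  "bvec v p = unit_vec (dm v) (pos v p)"

lemma arr_bvec:
  assumes "p \<in> Bv (src Q a)" shows "arr (xrep x) a *\<^sub>v bvec (src Q a) p = bvec (tgt Q a) p"
proof (rule eq_vecI)
  fix i assume "i < dim_vec (bvec (tgt Q a) p)"
  then have i: "i < dm (tgt Q a)" by (simp add: bvec_def)
  note pl = pos_lt[OF assms] and pt = pos_lt[OF Bv_step[OF assms]]
  have "(arr (xrep x) a *\<^sub>v bvec (src Q a) p) $ i = incl (enum (tgt Q a) i) p"
    using i pl enum_pos[OF assms] by (simp add: xrep_def bvec_def MM_def del: quiverA_simps)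
  also have "\<dots> = (if i = pos (tgt Q a) p then 1 else 0)"
    using enum_pos[OF Bv_step[OF assms]] pos_enum[OF i] by auto
  finally show "(arr (xrep x) a *\<^sub>v bvec (src Q a) p) $ i = bvec (tgt Q a) p $ i"
    using i pt by (simp add: bvec_def del: quiverA_simps)
qed (simp add: xrep_def bvec_def MM_def)

lemma path_act_bvec:
  "is_path Q j as v \<Longrightarrow> p \<in> Bv j \<Longrightarrow> path_act (xrep x) as (bvec j p) = bvec v p"
proof (induction as arbitrary: j)
  case (Cons a as)
  then have "src Q a = j" "is_path Q (tgt Q a) as v" unfolding is_path.simps by blast+
  then show ?case using Cons.IH[of "tgt Q a"] arr_bvec[of p a] Bv_step[of p a] Cons.prems(2) by (simp del: quiverA_simps)
qed simp

text \<open>The family consists of the distinct unit vectors numbered by \<pi>, so each coordinate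
  isolates one coefficient.\<close>

lemma lincomb_bvec:
  assumes bij: "bij_betw \<pi> S (Bv v)" and b: "\<And>z. z \<in> S \<Longrightarrow> b z = bvec v (\<pi> z)" and z: "z \<in> S"
  shows "lincomb (dm v) S c b $ pos v (\<pi> z) = c z"
proof -
  have \<pi>: "\<pi> y \<in> Bv v" if "y \<in> S" for y using bij that by (rule bij_betwE[THEN bspec])
  have fin: "finite S" using bij_betw_finite[OF bij] by simp
  have "lincomb (dm v) S c b $ pos v (\<pi> z) = (\<Sum>y\<in>S. c y * b y $ pos v (\<pi> z))"
    by (rule lincomb_index[OF pos_lt[OF \<pi>[OF z]]])
  also have "\<dots> = (\<Sum>y\<in>S. if y = z then c z else 0)"
  proof (rule sum.cong[OF refl])
    fix y assume y: "y \<in> S"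
    show "c y * b y $ pos v (\<pi> z) = (if y = z then c z else 0)"
    proof (cases "y = z")
      case True
      then show ?thesis using pos_lt[OF \<pi>[OF z]] by (simp add: b[OF z] bvec_def)
    next
      case False
      then have "\<pi> y \<noteq> \<pi> z" using inj_onD[OF bij_betw_imp_inj_on[OF bij] _ y z] by blast
      then have "pos v (\<pi> y) \<noteq> pos v (\<pi> z)" using enum_pos[OF \<pi>[OF y]] enum_pos[OF \<pi>[OF z]] by metis
      then show ?thesis
        using False pos_lt[OF \<pi>[OF z]] pos_lt[OF \<pi>[OF y]] by (simp add: b[OF y] bvec_def)
    qed
  qed
  also have "\<dots> = c z" using fin z by simp
  finally show ?thesis .
qed

lemma bvec_basis:
  assumes bij: "bij_betw \<pi> S (Bv v)" and b: "\<And>z. z \<in> S \<Longrightarrow> b z = bvec v (\<pi> z)"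
  shows "finite S \<and> (\<forall>c. lincomb (dm v) S c b = 0\<^sub>v (dm v) \<longrightarrow> (\<forall>z\<in>S. c z = 0)) \<and>
    (\<forall>w\<in>carrier_vec (dm v). \<exists>c. lincomb (dm v) S c b = w)"
proof (intro conjI allI impI ballI)
  show "finite S" using bij_betw_finite[OF bij] by simp
  show "c z = 0" if "lincomb (dm v) S c b = 0\<^sub>v (dm v)" "z \<in> S" for c z
    using lincomb_bvec[OF bij b that(2), of c] that(1) pos_lt bij_betwE[OF bij] that(2) by simp
  show "\<exists>c. lincomb (dm v) S c b = w" if w: "w \<in> carrier_vec (dm v)" for w
  proof (rule exI[of _ "\<lambda>z. w $ pos v (\<pi> z)"], rule eq_vecI)
    fix i assume "i < dim_vec w"
    then have i: "i < dm v" using w by simp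
    obtain z where z: "z \<in> S" "\<pi> z = enum v i"
      using enum_in[OF i] bij_betw_imp_surj_on[OF bij] by (metis imageE)
    show "lincomb (dm v) S (\<lambda>z. w $ pos v (\<pi> z)) b $ i = w $ i"
      using lincomb_bvec[OF bij b z(1), of "\<lambda>z. w $ pos v (\<pi> z)"] by (simp add: z(2) pos_enum[OF i])
  qed (use w in \<open>simp add: lincomb_def\<close>)
qed

text \<open>The generators are the basis vectors labelled (j, l) at j itself. Since arrows act as
  inclusions and paths are unique, forgetting the path is a bijection from the path basis at v to
  \<open>Bv v\<close>, under which path vectors are unit vectors.\<close>

lemma xrep_delta_dim: "delta_dim Q (xrep x) d"
  unfolding delta_dim_def Let_def
proof (rule exI[of _ "\<lambda>j l. bvec j (j, l)"], rule conjI)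
  show "\<forall>j\<in>verts Q. \<forall>l<d j. bvec j (j, l) \<in> carrier_vec (dimv (xrep x) j)" by (simp add: bvec_def xrep_def)
  have dv: "dimv (xrep x) v = dm v" for v by (simp add: xrep_def)
  define S where "S v = {(j, l, p). j \<in> verts Q \<and> l < d j \<and> is_path Q j p v}" for v
  define b where "b = (\<lambda>(j, l, p). path_act (xrep x) p (bvec j (j, l)))"
  define \<pi> where "\<pi> = (\<lambda>(j, l, p :: nat list). (j, l) :: nat \<times> nat)"
  have S: "\<pi> z \<in> Bv v" "b z = bvec v (\<pi> z)" if z: "z \<in> S v" for v z
  proof -
    obtain j l p where jlp: "z = (j, l, p)" "j \<in> {1..n}" "l < d j" "is_path Q j p v" using z by (auto simp: S_def)
    have "(j, l) \<in> blocks d n" using jlp by (auto simp: blocks_def)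
    then show "\<pi> z \<in> Bv v" "b z = bvec v (\<pi> z)"
      using path_reach[OF jlp(4)] path_act_bvec[OF jlp(4), of "(j, l)"] by (auto simp: Bv_def \<pi>_def b_def jlp(1))
  qed
  have bij: "bij_betw \<pi> (S v) (Bv v)" if v: "v \<in> verts Q" for v
    unfolding bij_betw_def
  proof
    show "inj_on \<pi> (S v)" using path_unique by (auto simp: inj_on_def \<pi>_def S_def)
    have "p \<in> \<pi> ` S v" if p: "p \<in> Bv v" for p
    proof -
      have r: "reach orient (fst p) v" "fst p \<in> {1..n}" "snd p < d (fst p)" using p by (auto simp: Bv_def blocks_def)
      obtain as where "is_path Q (fst p) as v" using path_exists[OF r(1,2)] v by auto
      then have "(fst p, snd p, as) \<in> S v" "\<pi> (fst p, snd p, as) = p" using r by (auto simp: S_def \<pi>_def)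
      then show ?thesis by (metis imageI)
    qed
    then show "\<pi> ` S v = Bv v" using S(1) by blast
  qed
  show "\<forall>v\<in>verts Q. finite {(j, l, p). j \<in> verts Q \<and> l < d j \<and> is_path Q j p v} \<and>
      (\<forall>c. lincomb (dimv (xrep x) v) {(j, l, p). j \<in> verts Q \<and> l < d j \<and> is_path Q j p v} c
            (\<lambda>(j, l, p). path_act (xrep x) p (bvec j (j, l))) = 0\<^sub>v (dimv (xrep x) v) \<longrightarrow>
          (\<forall>z\<in>{(j, l, p). j \<in> verts Q \<and> l < d j \<and> is_path Q j p v}. c z = 0)) \<and>
      (\<forall>w\<in>carrier_vec (dimv (xrep x) v). \<exists>c. lincomb (dimv (xrep x) v)
          {(j, l, p). j \<in> verts Q \<and> l < d j \<and> is_path Q j p v} c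
          (\<lambda>(j, l, p). path_act (xrep x) p (bvec j (j, l))) = w)"
    unfolding S_def[symmetric] b_def[symmetric] dv by (intro ballI bvec_basis[OF bij S(2)])
qed

end

theorem mainTheorem1:
  fixes n :: nat and orient :: "nat \<Rightarrow> bool" and d :: "nat \<Rightarrow> nat"
  assumes "alg_closed TYPE('k::field_char_0)"
    and "\<exists>i\<in>{1..n}. d i \<noteq> 0"
  shows "(\<exists>M :: (nat, nat, 'k) drep.
            is_Dmod (quiverA n orient) M \<and> exceptional (quiverA n orient) M
            \<and> delta_filtered (quiverA n orient) M \<and> delta_dim (quiverA n orient) M d)
       \<and> (\<forall>M N :: (nat, nat, 'k) drep.
            is_Dmod (quiverA n orient) M \<and> exceptional (quiverA n orient) M
            \<and> delta_filtered (quiverA n orient) M \<and> delta_dim (quiverA n orient) M d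
          \<and> is_Dmod (quiverA n orient) N \<and> exceptional (quiverA n orient) N
            \<and> delta_filtered (quiverA n orient) N \<and> delta_dim (quiverA n orient) N d
          \<longrightarrow> iso_Dmod (quiverA n orient) M N)"
proof (intro conjI allI impI)
  interpret typeA n orient d "TYPE('k)" .
  obtain x :: "'k imat" where x: "richardson (blocks d n) (blocks d n) orient x"
    using richardson_exists by blast
  have D: "is_Dmod (quiverA n orient) (xrep x)" by (rule xrep_Dmod) (use x in \<open>simp add: richardson_def\<close>)
  show "\<exists>M :: (nat, nat, 'k) drep.
            is_Dmod (quiverA n orient) M \<and> exceptional (quiverA n orient) M
            \<and> delta_filtered (quiverA n orient) M \<and> delta_dim (quiverA n orient) M d"
    using D xrep_delta_dim inner_imp_exceptional[OF D xrep_delta_dim xrep_derivations_inner[OF x]]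
    unfolding delta_filtered_def by blast
qed (use finite_quiver.exceptional_unique[OF finite_quiverA] in blast)

end
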